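(* Let $s\ge 0$ and $\varphi\in\mathcal{F}(\mathbb{C}^n)$. The operator $S_\varphi$ is bounded on $\mathcal{F}^{s,2}(\mathbb{C}^n)$ if and only if $\varphi\in M\mathcal{F}^{s,2}(\mathbb{C}^n)$, i.e. if and only if $\varphi=Gm$ for some $m\in MW_H^{s,2}(\mathbb{R}^n)$.
   Context: For $z,w\in\mathbb{C}^n$ write $z\cdot w=\sum_j z_jw_j$, $z^2=z\cdot z$. Let $d\nu(z)=c_ne^{-\frac12|z|^2}dz$ on $\mathbb{C}^n$ with $c_n=(2\pi)^{-n}$; the Fock space $\mathcal{F}(\mathbb{C}^n)$ is the Hilbert space of entire functions square integrable with respect to $\nu$. The Bargmann transform $B:L^2(\mathbb{R}^n)\to\mathcal{F}(\mathbb{C}^n)$ is, up to a positive normalizing constant making it unitary, $Bf(z)=e^{-\frac14z^2}\int_{\mathbb{R}^n}f(u)e^{-\frac12|u|^2}e^{u\cdot z}du$. With $d\gamma(x)=e^{-|x|^2}dx$, the Gauss-Bargmann transform is $Gf(z)=\int_{\mathbb{R}^n}f(\xi)e^{-(\xi-\frac i2z)^2}d\xi$ for $f\in L^2(\mathbb{R}^n,d\gamma)$. Let $H=-\Delta+|x|^2$ be the Hermite operator on $\mathbb{R}^n$, whose eigenfunctions are the normalized Hermite functions $\Phi_\alpha$, $\alpha\in\mathbb{N}^n$, with $H\Phi_\alpha=(2|\alpha|+n)\Phi_\alpha$; powers $H^{s}$ are defined spectrally. The Hermite-Sobolev space is $W_H^{s,2}(\mathbb{R}^n)=\{f\in L^2(\mathbb{R}^n):H^{s/2}f\in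 L^2(\mathbb{R}^n)\}$ with norm $\|H^{s/2}f\|_2$. The Fock-Sobolev space $\mathcal{F}^{s,2}(\mathbb{C}^n)$ is the image of $W_H^{s,2}(\mathbb{R}^n)$ under $B$, with the transported norm $\|F\|=\|H^{s/2}B^*F\|_2$. For measurable $m$ on $\mathbb{R}^n$, $T_mf(x)=(2\pi)^{-n/2}\int_{\mathbb{R}^n}e^{ix\cdot\xi}m(\xi)\widehat f(\xi)d\xi$. $MW_H^{s,2}(\mathbb{R}^n)$ is the set of all $m$ for which $T_m$ is bounded on $W_H^{s,2}(\mathbb{R}^n)$, and $M\mathcal{F}^{s,2}(\mathbb{C}^n)$ is the image of $MW_H^{s,2}(\mathbb{R}^n)$ under $G$. For $\varphi\in\mathcal{F}(\mathbb{C}^n)$, $S_\varphi F(z)=\int_{\mathbb{C}^n}F(w)\varphi(z-\bar w)e^{\frac12z\cdot\bar w}d\nu(w)$, which converges absolutely for holomorphic polynomials $F$; $S_\varphi$ is called bounded on $\mathcal{F}^{s,2}(\mathbb{C}^n)$ if it extends from the (dense) space of holomorphic polynomials to a bounded linear operator of $\mathcal{F}^{s,2}(\mathbb{C}^n)$ into itself. *)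

theory Defs
  imports "HOL-Analysis.Analysis"
begin

section \<open>Vectors in \<open>\<complex>\<^sup>n\<close>\<close>

text \<open>The dimension \<open>n\<close> is \<open>CARD('n)\<close>. The product \<open>cdot\<close> is bilinear (not sesquilinear), and is
  unrelated to the real inner product that the library puts on \<open>complex ^ 'n\<close>.\<close>

definition cdot :: "complex ^ 'n \<Rightarrow> complex ^ 'n \<Rightarrow> complex" where
  "cdot z w = (\<Sum>j\<in>UNIV. z $ j * w $ j)"

definition cvec :: "real ^ 'n \<Rightarrow> complex ^ 'n" where
  "cvec x = (\<chi> j. complex_of_real (x $ j))"

definition vcnj :: "complex ^ 'n \<Rightarrow> complex ^ 'n" where
  "vcnj z = (\<chi> j. cnj (z $ j))"


section \<open>The Hilbert space \<open>L\<^sup>2(\<real>\<^sup>n)\<close>\<close>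

text \<open>Elements are represented by Lebesgue measurable functions, not by equivalence classes; all
  notions below depend on such a function only up to null sets. The real number \<open>l2_norm f\<close> is
  meaningful only for \<open>f \<in> L2\<close>, since non-integrable functions have integral \<open>0\<close>.\<close>

definition L2 :: "(real ^ 'n \<Rightarrow> complex) set" where
  "L2 = {f \<in> borel_measurable lebesgue. integrable lebesgue (\<lambda>x. (cmod (f x))\<^sup>2)}"

definition l2_inner :: "(real ^ 'n \<Rightarrow> complex) \<Rightarrow> (real ^ 'n \<Rightarrow> complex) \<Rightarrow> complex" where
  "l2_inner f g = (LINT x|lebesgue. f x * cnj (g x))"

definition l2_norm :: "(real ^ 'n \<Rightarrow> complex) \<Rightarrow> real" where
  "l2_norm f = sqrt (LINT x|lebesgue. (cmod (f x))\<^sup>2)"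

definition l2_tendsto ::
    "('i \<Rightarrow> real ^ 'n \<Rightarrow> complex) \<Rightarrow> (real ^ 'n \<Rightarrow> complex) \<Rightarrow> 'i filter \<Rightarrow> bool" where
  "l2_tendsto h g F \<longleftrightarrow>
     (\<forall>\<^sub>F a in F. h a \<in> L2) \<and> g \<in> L2 \<and> ((\<lambda>a. l2_norm (\<lambda>x. h a x - g x)) \<longlongrightarrow> 0) F"


section \<open>Hermite functions and the Hermite-Sobolev spaces\<close>

definition hermite_poly :: "nat \<Rightarrow> real \<Rightarrow> real" where
  "hermite_poly k t = (-1) ^ k * exp (t\<^sup>2) * (deriv ^^ k) (\<lambda>u. exp (- u\<^sup>2)) t"

definition hermite_fun1 :: "nat \<Rightarrow> real \<Rightarrow> real" where
  "hermite_fun1 k t = hermite_poly k t * exp (- t\<^sup>2 / 2) / sqrt (2 ^ k * fact k * sqrt pi)"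

definition hermite_fun :: "nat ^ 'n \<Rightarrow> real ^ 'n \<Rightarrow> complex" where
  "hermite_fun \<alpha> x = complex_of_real (\<Prod>j\<in>UNIV. hermite_fun1 (\<alpha> $ j) (x $ j))"

definition hermite_eigenvalue :: "nat ^ 'n \<Rightarrow> real" where
  "hermite_eigenvalue \<alpha> = 2 * real (\<Sum>j\<in>UNIV. \<alpha> $ j) + real CARD('n)"

text \<open>Spectral definition of the powers of the Hermite operator \<open>H = -\<Delta> + |x|\<^sup>2\<close>:
  \<open>H\<^sup>\<sigma> f\<close> is the unconditional \<open>L\<^sup>2\<close>-sum over \<open>\<alpha>\<close> of \<open>(2|\<alpha>| + n)\<^sup>\<sigma> \<langle>f, \<Phi>\<^sub>\<alpha>\<rangle> \<Phi>\<^sub>\<alpha>\<close>. It is in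
  \<open>L\<^sup>2\<close> precisely when this series converges there.\<close>

definition has_hermite_power ::
    "real \<Rightarrow> (real ^ 'n \<Rightarrow> complex) \<Rightarrow> (real ^ 'n \<Rightarrow> complex) \<Rightarrow> bool" where
  "has_hermite_power \<sigma> f g \<longleftrightarrow>
     l2_tendsto
       (\<lambda>A x. \<Sum>\<alpha>\<in>A. complex_of_real (hermite_eigenvalue \<alpha> powr \<sigma>)
                    * l2_inner f (hermite_fun \<alpha>) * hermite_fun \<alpha> x)
       g (finite_subsets_at_top UNIV)"

definition hermite_power :: "real \<Rightarrow> (real ^ 'n \<Rightarrow> complex) \<Rightarrow> real ^ 'n \<Rightarrow> complex" where
  "hermite_power \<sigma> f = (SOME g. has_hermite_power \<sigma> f g)"

definition hermite_sobolev :: "real \<Rightarrow> (real ^ 'n \<Rightarrow> complex) set" where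
  "hermite_sobolev s = {f \<in> L2. \<exists>g. has_hermite_power (s / 2) f g}"

definition hermite_sobolev_norm :: "real \<Rightarrow> (real ^ 'n \<Rightarrow> complex) \<Rightarrow> real" where
  "hermite_sobolev_norm s f = l2_norm (hermite_power (s / 2) f)"


section \<open>Fourier multipliers\<close>

text \<open>The Fourier transform on \<open>L\<^sup>2\<close> (\<open>\<epsilon> = -1\<close>) and its inverse (\<open>\<epsilon> = 1\<close>), defined as the
  \<open>L\<^sup>2\<close>-limit of the integrals truncated to balls.\<close>

definition has_fourier ::
    "real \<Rightarrow> (real ^ 'n \<Rightarrow> complex) \<Rightarrow> (real ^ 'n \<Rightarrow> complex) \<Rightarrow> bool" where
  "has_fourier \<epsilon> f g \<longleftrightarrow>
     l2_tendsto
       (\<lambda>R y. complex_of_real ((2 * pi) powr (- real CARD('n) / 2))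
              * (LINT x:cball 0 R|lebesgue. exp (\<i> * complex_of_real (\<epsilon> * (x \<bullet> y))) * f x))
       g at_top"

definition fourier :: "(real ^ 'n \<Rightarrow> complex) \<Rightarrow> real ^ 'n \<Rightarrow> complex" where
  "fourier f = (SOME g. has_fourier (-1) f g)"

definition inv_fourier :: "(real ^ 'n \<Rightarrow> complex) \<Rightarrow> real ^ 'n \<Rightarrow> complex" where
  "inv_fourier f = (SOME g. has_fourier 1 f g)"

definition multiplier_op ::
    "(real ^ 'n \<Rightarrow> complex) \<Rightarrow> (real ^ 'n \<Rightarrow> complex) \<Rightarrow> real ^ 'n \<Rightarrow> complex" where
  "multiplier_op m f = inv_fourier (\<lambda>\<xi>. m \<xi> * fourier f \<xi>)"

text \<open>The requirement that \<open>m\<close> times the Fourier transform of \<open>f\<close> lie in \<open>L2\<close> says that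
  \<open>multiplier_op m f\<close> exists as an element of \<open>L\<^sup>2\<close>.\<close>

definition hermite_multipliers :: "real \<Rightarrow> (real ^ 'n \<Rightarrow> complex) set" where
  "hermite_multipliers s = {m \<in> borel_measurable lebesgue.
     (\<forall>f\<in>hermite_sobolev s.
        (\<lambda>\<xi>. m \<xi> * fourier f \<xi>) \<in> L2 \<and> multiplier_op m f \<in> hermite_sobolev s) \<and>
     (\<exists>C. \<forall>f\<in>hermite_sobolev s.
        hermite_sobolev_norm s (multiplier_op m f) \<le> C * hermite_sobolev_norm s f)}"


section \<open>Fock space, Bargmann transform and Fock-Sobolev spaces\<close>

text \<open>Holomorphy on \<open>\<complex>\<^sup>n\<close>: Frechet differentiable with a complex linear derivative. The derivative
  in \<open>has_derivative\<close> is only real linear.\<close>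

definition entire :: "(complex ^ 'n \<Rightarrow> complex) \<Rightarrow> bool" where
  "entire F \<longleftrightarrow> (\<forall>z. \<exists>D. (F has_derivative D) (at z) \<and> (\<forall>c v. D (c *s v) = c * D v))"

definition fock_measure :: "(complex ^ 'n) measure" where
  "fock_measure =
     density lborel (\<lambda>z. ennreal ((2 * pi) powr (- real CARD('n)) * exp (- (norm z)\<^sup>2 / 2)))"

definition fock_space :: "(complex ^ 'n \<Rightarrow> complex) set" where
  "fock_space = {F. entire F \<and> integrable fock_measure (\<lambda>z. (cmod (F z))\<^sup>2)}"

text \<open>The constant \<open>\<pi>\<close> to the power \<open>-n/4\<close> is the positive one that makes the Bargmann transform
  unitary onto the Fock space: it sends \<open>\<Phi>\<^sub>0\<close> to the constant function \<open>1\<close>, which has norm \<open>1\<close>.\<close>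

definition bargmann :: "(real ^ 'n \<Rightarrow> complex) \<Rightarrow> complex ^ 'n \<Rightarrow> complex" where
  "bargmann f z =
     complex_of_real (pi powr (- real CARD('n) / 4)) * exp (- cdot z z / 4)
     * (LINT u|lebesgue. f u * complex_of_real (exp (- (norm u)\<^sup>2 / 2)) * exp (cdot (cvec u) z))"

definition bargmann_adjoint :: "(complex ^ 'n \<Rightarrow> complex) \<Rightarrow> real ^ 'n \<Rightarrow> complex" where
  "bargmann_adjoint F = (SOME f. f \<in> L2 \<and>
     (\<forall>g\<in>L2. l2_inner f g = (LINT z|fock_measure. F z * cnj (bargmann g z))))"

definition fock_sobolev :: "real \<Rightarrow> (complex ^ 'n \<Rightarrow> complex) set" where
  "fock_sobolev s = bargmann ` hermite_sobolev s"

definition fock_sobolev_norm :: "real \<Rightarrow> (complex ^ 'n \<Rightarrow> complex) \<Rightarrow> real" where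
  "fock_sobolev_norm s F = hermite_sobolev_norm s (bargmann_adjoint F)"


section \<open>Gauss-Bargmann transform\<close>

definition gauss_bargmann :: "(real ^ 'n \<Rightarrow> complex) \<Rightarrow> complex ^ 'n \<Rightarrow> complex" where
  "gauss_bargmann f z =
     (LINT \<xi>|lebesgue. f \<xi> * exp (- cdot (cvec \<xi> - (\<i> / 2) *s z) (cvec \<xi> - (\<i> / 2) *s z)))"

text \<open>Every multiplier \<open>m\<close> of \<open>hermite_sobolev s\<close> is square integrable for the Gaussian measure
  \<open>exp (-|x|\<^sup>2) dx\<close> (apply \<open>multiplier_op m\<close> to \<open>\<Phi>\<^sub>0\<close>), so it is in the domain of the transform.\<close>

definition fock_multipliers :: "real \<Rightarrow> (complex ^ 'n \<Rightarrow> complex) set" where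
  "fock_multipliers s = gauss_bargmann ` hermite_multipliers s"


section \<open>The operators \<open>S\<^sub>\<phi>\<close>\<close>

definition S_op ::
    "(complex ^ 'n \<Rightarrow> complex) \<Rightarrow> (complex ^ 'n \<Rightarrow> complex) \<Rightarrow> complex ^ 'n \<Rightarrow> complex" where
  "S_op \<phi> F z = (LINT w|fock_measure. F w * \<phi> (z - vcnj w) * exp (cdot z (vcnj w) / 2))"

definition holomorphic_polys :: "(complex ^ 'n \<Rightarrow> complex) set" where
  "holomorphic_polys =
     {F. \<exists>(A :: (nat ^ 'n) set) c. finite A \<and>
           F = (\<lambda>z. \<Sum>\<alpha>\<in>A. c \<alpha> * (\<Prod>j\<in>UNIV. (z $ j) ^ (\<alpha> $ j)))}"

definition bounded_linear_op_fock_sobolev ::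
    "real \<Rightarrow> ((complex ^ 'n \<Rightarrow> complex) \<Rightarrow> (complex ^ 'n \<Rightarrow> complex)) \<Rightarrow> bool" where
  "bounded_linear_op_fock_sobolev s T \<longleftrightarrow>
     (\<forall>F\<in>fock_sobolev s. T F \<in> fock_sobolev s) \<and>
     (\<forall>F\<in>fock_sobolev s. \<forall>G\<in>fock_sobolev s. T (\<lambda>z. F z + G z) = (\<lambda>z. T F z + T G z)) \<and>
     (\<forall>c. \<forall>F\<in>fock_sobolev s. T (\<lambda>z. c * F z) = (\<lambda>z. c * T F z)) \<and>
     (\<exists>C. \<forall>F\<in>fock_sobolev s. fock_sobolev_norm s (T F) \<le> C * fock_sobolev_norm s F)"

definition S_bounded :: "real \<Rightarrow> (complex ^ 'n \<Rightarrow> complex) \<Rightarrow> bool" where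
  "S_bounded s \<phi> \<longleftrightarrow>
     (\<exists>T. bounded_linear_op_fock_sobolev s T \<and> (\<forall>F\<in>holomorphic_polys. T F = S_op \<phi> F))"

end

theory Submission
  imports Defs "HOL-Probability.Probability" "HOL-Complex_Analysis.Complex_Analysis" "HOL-Real_Asymp.Real_Asymp"
begin

text \<open>
  Write \<open>B\<close> for the Bargmann transform, \<open>G\<close> for the Gauss-Bargmann transform and
  \<open>W\<close> for the Hermite-Sobolev space. The theorem rests on one formula: \<open>S\<close> with symbol
  \<open>G m\<close> is, up to the factor \<open>\<pi>\<close> to the power \<open>n/2\<close>, the Fourier multiplier
  \<open>T\<^sub>m\<close> conjugated by \<open>B\<close> (\<open>S_op_poly\<close>, \<open>bargmann_inv_fourier\<close>). To see
  it, insert the integrals that define \<open>G m\<close> and \<open>B f\<close> into \<open>S\<close> and integrate over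
  the complex variable \<open>w\<close> first. The quadratic terms in \<open>w\<close> and in its conjugate combine to a
  pure phase, so that this is a Gaussian integral, and its value is the Fourier kernel times Gaussian
  weights in the two real variables (\<open>wkern_integral\<close>).

  If \<open>m\<close> is a multiplier, then \<open>T\<^sub>m\<close> conjugated by \<open>B\<close> is a bounded operator that
  agrees with \<open>S\<close> on polynomials (\<open>S_bounded_of_multiplier\<close>).

  Conversely, let \<open>T\<close> be a bounded extension of \<open>S\<close> with symbol \<open>\<phi>\<close>. The mean value
  property gives \<open>S 1 = \<phi>\<close> (\<open>S_op_one\<close>), so \<open>\<phi> = T 1\<close> is in the Fock-Sobolev
  space, that is \<open>\<phi> = B f\<^sub>0\<close>. Since \<open>B\<close> turns the Fourier transform into the rotation
  by \<open>\<i>\<close>, it follows that \<open>\<phi> = G m\<close> where \<open>m\<close> is a multiple of the Fourier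
  transform of \<open>f\<^sub>0\<close> times \<open>exp (|\<xi>|\<^sup>2 / 2)\<close>; at this point \<open>m\<close> is only known to be square
  integrable for the Gaussian measure. For \<open>f\<close> in \<open>W\<close> and \<open>T (B f) = B g\<close>, the formula
  above says that the Fourier transforms of \<open>f\<close>, multiplied by \<open>m\<close>, and of \<open>g\<close> have, after
  multiplication by a Gaussian and a constant, the same Fourier integrals; this is clear for finite sums of Hermite
  functions and follows in general because both sides are continuous in the norm of \<open>W\<close>, which
  dominates the \<open>L\<^sup>2\<close> norm for \<open>s \<ge> 0\<close>. By injectivity of the Fourier transform on
  \<open>L\<^sup>1\<close> (\<open>fourier_injective_L1\<close>) the two functions agree almost everywhere, so that
  \<open>T\<^sub>m f\<close> is a multiple of \<open>g\<close> and \<open>m\<close> is a multiplier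
  (\<open>multiplier_of_S_bounded\<close>).

  The Hilbert space side is reduced to Hermite coefficients. The Hermite functions are complete
  (\<open>hermite_complete\<close>), and with the Riesz-Fischer theorem this identifies \<open>L\<^sup>2\<close> with the square
  summable families of coefficients. On coefficients, powers of the Hermite operator are diagonal
  (\<open>has_hermite_power_iff\<close>), the Fourier transform multiplies by powers of \<open>\<i>\<close>
  (\<open>has_fourier_iff\<close>) and the Bargmann transform is a power series
  (\<open>bargmann_has_sum\<close>).
\<close>


abbreviation gaussian :: "'a::real_normed_vector \<Rightarrow> complex" where
  "gaussian x \<equiv> complex_of_real (exp (- (norm x)\<^sup>2 / 2))"

abbreviation fourier_char :: "real ^ 'n \<Rightarrow> real ^ 'n \<Rightarrow> complex" where
  "fourier_char x y \<equiv> exp (\<i> * complex_of_real (x \<bullet> y))"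

section \<open>Lebesgue measure: isometries, product integrals, box integrals\<close>

lemma nn_integral_lborel_shift:
  fixes g :: "'a::euclidean_space \<Rightarrow> ennreal"
  assumes [measurable]: "g \<in> borel_measurable borel"
  shows "(\<integral>\<^sup>+x. g (t + x) \<partial>lborel) = (\<integral>\<^sup>+x. g x \<partial>lborel)"
proof -
  have "lborel = distr lborel borel (\<lambda>x::'a. t + 1 *\<^sub>R x)"
    by (subst lborel_affine[of 1 t]) (simp_all add: density_1)
  then have "(\<integral>\<^sup>+x. g x \<partial>lborel) = (\<integral>\<^sup>+x. g x \<partial>distr lborel borel (\<lambda>x::'a. t + 1 *\<^sub>R x))"
    by simp
  also have "\<dots> = (\<integral>\<^sup>+x. g (t + x) \<partial>lborel)"
    by (subst nn_integral_distr) auto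
  finally show ?thesis by simp
qed

lemma nn_integral_lborel_reflect:
  fixes g :: "'a::euclidean_space \<Rightarrow> ennreal"
  assumes [measurable]: "g \<in> borel_measurable borel"
  shows "(\<integral>\<^sup>+x. g (t - x) \<partial>lborel) = (\<integral>\<^sup>+x. g x \<partial>lborel)"
proof -
  have "lborel = distr lborel borel (\<lambda>x::'a. t + (-1) *\<^sub>R x)"
    by (subst lborel_affine[of "-1" t]) (simp_all add: density_1)
  then have "(\<integral>\<^sup>+x. g x \<partial>lborel) = (\<integral>\<^sup>+x. g x \<partial>distr lborel borel (\<lambda>x::'a. t + (-1) *\<^sub>R x))"
    by simp
  also have "\<dots> = (\<integral>\<^sup>+x. g (t - x) \<partial>lborel)"
    by (subst nn_integral_distr) auto
  finally show ?thesis by simp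
qed

text \<open>Uniqueness of Haar measure: integrating the indicators of a set \<open>A\<close> and of a translate of the unit
  ball over both variables in the two possible orders shows that the image measure and the Lebesgue
  measure are proportional, and an isometry preserves the volume of the ball. Domain and codomain are
  different types so that the result also covers the identification of \<open>\<complex>\<^sup>n\<close> with
  \<open>\<real>\<^sup>n \<times> \<real>\<^sup>n\<close>.\<close>

lemma lborel_distr_linear_isometry:
  fixes f :: "'a::euclidean_space \<Rightarrow> 'b::euclidean_space"
  assumes lin: "linear f" and norm_f: "\<And>x. norm (f x) = norm x" and surj: "surj f"
  shows "distr lborel borel f = lborel"
proof (rule measure_eqI)
  have [measurable]: "f \<in> borel_measurable borel"
    by (intro borel_measurable_continuous_onI linear_continuous_on)
       (simp add: lin linear_conv_bounded_linear[symmetric])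
  have "inj f"
    unfolding linear_injective_0[OF lin] using norm_f by (metis norm_eq_zero)
  with lin surj have dim: "DIM('a) = DIM('b)"
    using dim_image_eq[OF lin, of UNIV] by simp
  define B where "B = ball (0::'b) 1"
  have [measurable]: "B \<in> sets borel" by (simp add: B_def)
  have fB: "f -` B = ball 0 1" by (auto simp: B_def norm_f)
  fix A assume "A \<in> sets (distr lborel borel f)"
  then have [measurable]: "A \<in> sets borel" by simp
  define I :: "ennreal" where
    "I = (\<integral>\<^sup>+x. \<integral>\<^sup>+y. indicator A (f x) * indicator B (f x + y) \<partial>lborel \<partial>(lborel::'a measure))"
  have "I = (\<integral>\<^sup>+x. indicator A (f x) * emeasure lborel B \<partial>(lborel::'a measure))"
    unfolding I_def
    by (intro nn_integral_cong)
       (simp add: nn_integral_cmult nn_integral_lborel_shift[of "indicator B"])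
  also have "\<dots> = emeasure (distr lborel borel f) A * emeasure lborel B"
    by (simp add: nn_integral_multc nn_integral_distr[of f lborel borel "indicator A", simplified, symmetric])
  finally have I1: "I = emeasure (distr lborel borel f) A * emeasure lborel B" .
  have "I = (\<integral>\<^sup>+y. \<integral>\<^sup>+x. indicator A (f x) * indicator B (f x + y) \<partial>(lborel::'a measure) \<partial>lborel)"
    unfolding I_def by (rule lborel_pair.Fubini') measurable
  also have "\<dots> = (\<integral>\<^sup>+y. \<integral>\<^sup>+x. indicator A (f x - y) * indicator B (f x) \<partial>(lborel::'a measure) \<partial>lborel)"
  proof (rule nn_integral_cong)
    fix y :: 'b
    obtain v where v: "y = f v" using surj by (meson surj_def)
    show "(\<integral>\<^sup>+x. indicator A (f x) * indicator B (f x + y) \<partial>(lborel::'a measure))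
        = (\<integral>\<^sup>+x. indicator A (f x - y) * indicator B (f x) \<partial>(lborel::'a measure))"
      using nn_integral_lborel_shift[of "\<lambda>x. indicator A (f x - y) * indicator B (f x)" v]
      by (simp add: v linear_add[OF lin] add.commute)
  qed
  also have "\<dots> = (\<integral>\<^sup>+x. \<integral>\<^sup>+y. indicator A (f x - y) * indicator B (f x) \<partial>lborel \<partial>(lborel::'a measure))"
    by (rule lborel_pair.Fubini'[symmetric]) measurable
  also have "\<dots> = (\<integral>\<^sup>+x. emeasure lborel A * indicator B (f x) \<partial>(lborel::'a measure))"
    by (intro nn_integral_cong)
       (simp add: nn_integral_multc nn_integral_lborel_reflect[of "indicator A"])
  also have "\<dots> = emeasure lborel A * emeasure lborel (ball (0::'a) 1)"
  proof -
    have "indicator B (f x) = (indicator (ball 0 1) x :: ennreal)" for x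
      using fB by (auto simp: indicator_def)
    then show ?thesis by (simp add: nn_integral_cmult_indicator)
  qed
  also have "emeasure lborel (ball (0::'a) 1) = emeasure lborel B"
    by (simp add: B_def emeasure_ball dim)
  finally have "emeasure (distr lborel borel f) A * emeasure lborel B
      = emeasure lborel A * emeasure lborel B"
    using I1 by simp
  moreover have "emeasure lborel B \<noteq> 0" "emeasure lborel B \<noteq> \<top>"
    using unit_ball_vol_pos[of "DIM('b)"] by (auto simp: B_def emeasure_ball simp del: unit_ball_vol_pos)
  ultimately show "emeasure (distr lborel borel f) A = emeasure lborel A"
    by (metis ennreal_mult_divide_eq)
qed simp

definition complex_vec :: "(real ^ 'n) \<times> (real ^ 'n) \<Rightarrow> complex ^ 'n" where
  "complex_vec p = (\<chi> j. Complex (fst p $ j) (snd p $ j))"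

lemma complex_vec_nth [simp]: "complex_vec p $ j = Complex (fst p $ j) (snd p $ j)"
  by (simp add: complex_vec_def)

lemma norm_complex_vec_sq: "(norm z)\<^sup>2 = (\<Sum>j\<in>UNIV. (cmod (z $ j))\<^sup>2)" for z :: "complex ^ 'n"
  by (simp add: norm_vec_def L2_set_def sum_nonneg)

lemma norm_real_vec_sq: "(norm x)\<^sup>2 = (\<Sum>j\<in>UNIV. (x $ j)\<^sup>2)" for x :: "real ^ 'n"
  by (simp add: norm_vec_def L2_set_def sum_nonneg)

lemma norm_complex_vec: "norm (complex_vec p) = norm p"
proof (rule power2_eq_imp_eq)
  show "(norm (complex_vec p))\<^sup>2 = (norm p)\<^sup>2"
    unfolding norm_complex_vec_sq
    by (simp add: norm_prod_def norm_real_vec_sq cmod_power2 sum.distrib real_sqrt_pow2 sum_nonneg)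
qed auto

lemma linear_complex_vec: "linear complex_vec"
  by (rule linearI) (auto simp: vec_eq_iff complex_eq_iff)

lemma surj_complex_vec: "surj complex_vec"
proof
  show "UNIV \<subseteq> range (complex_vec :: (real ^ 'n) \<times> (real ^ 'n) \<Rightarrow> _)"
  proof
    fix z :: "complex ^ 'n"
    have "z = complex_vec ((\<chi> j. Re (z $ j)), (\<chi> j. Im (z $ j)))"
      by (simp add: vec_eq_iff)
    then show "z \<in> range complex_vec" by blast
  qed
qed simp

lemma lborel_complex_vec:
  "distr (lborel \<Otimes>\<^sub>M lborel) borel complex_vec = (lborel :: (complex ^ 'n) measure)"
  using lborel_distr_linear_isometry[OF linear_complex_vec norm_complex_vec surj_complex_vec]
  by (simp add: lborel_prod)

lemma measurable_complex_vec [measurable]: "complex_vec \<in> borel_measurable borel"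
  by (intro borel_measurable_continuous_onI linear_continuous_on)
     (simp add: linear_complex_vec linear_conv_bounded_linear[symmetric])

lemma lborel_vec_prod:
  fixes f :: "'n::finite \<Rightarrow> real \<Rightarrow> complex"
  assumes f: "\<And>j. integrable lborel (f j)"
  shows integrable_vec_prod: "integrable lborel (\<lambda>x::real^'n. \<Prod>j\<in>UNIV. f j (x $ j))" (is ?I)
    and integral_vec_prod:
      "(LINT x|lborel. (\<Prod>j\<in>UNIV. f j ((x::real^'n) $ j))) = (\<Prod>j\<in>UNIV. LINT t|lborel. f j t)" (is ?E)
proof -
  interpret product_sigma_finite "\<lambda>b::real^'n. lborel :: real measure" ..
  have [measurable]: "f j \<in> borel_measurable borel" for j
    using borel_measurable_integrable[OF f[of j]] by simp
  define ix where "ix b = (THE j. b = axis j (1::real))" for b :: "real ^ 'n"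
  have ix [simp]: "ix (axis j 1) = j" for j
    by (auto simp: ix_def axis_eq_axis)
  have B: "(Basis :: (real^'n) set) = range (\<lambda>j. axis j 1)"
    by (auto simp: Basis_vec_def)
  have inj: "inj (\<lambda>j::'n. axis j (1::real))"
    by (auto simp: inj_on_def axis_eq_axis)
  have re: "(\<Prod>b\<in>Basis. h (ix b) (g b)) = (\<Prod>j\<in>UNIV. h j (g (axis j 1)))"
    for h :: "'n \<Rightarrow> 'c \<Rightarrow> complex" and g :: "real ^ 'n \<Rightarrow> 'c"
    by (simp add: B prod.reindex[OF inj])
  have comp: "(\<Sum>b\<in>Basis. v b *\<^sub>R b) $ j = v (axis j 1)" for v and j :: 'n
  proof -
    have "(\<Sum>b\<in>Basis. v b *\<^sub>R b) $ j = (\<Sum>b\<in>Basis. v b *\<^sub>R b) \<bullet> axis j (1::real)"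
      by (simp add: inner_axis)
    also have "\<dots> = v (axis j 1)" by (subst inner_sum_left_Basis) (auto simp: Basis_vec_def)
    finally show ?thesis .
  qed
  let ?P = "\<Pi>\<^sub>M b\<in>(Basis::(real^'n) set). (lborel::real measure)"
  have eq: "(\<lambda>v. \<Prod>j\<in>UNIV. f j ((\<Sum>b\<in>Basis. v b *\<^sub>R b) $ j))
      = (\<lambda>v. \<Prod>b\<in>(Basis::(real^'n) set). f (ix b) (v b))"
    by (rule ext) (simp only: comp re)
  show ?I
    by (subst lborel_eq, subst integrable_distr_eq)
       (simp_all add: eq product_integrable_prod[OF finite_Basis f] del: sum_component)
  show ?E
    apply (subst lborel_eq, subst integral_distr)
      apply (simp_all add: eq del: sum_component)
    apply (subst product_integral_prod[OF finite_Basis f])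
    apply (simp add: re[of "\<lambda>j _. integral\<^sup>L lborel (f j)" undefined])
    done
qed

lemma lebesgue_borel_version:
  fixes f :: "'a::euclidean_space \<Rightarrow> complex"
  assumes "f \<in> borel_measurable lebesgue"
  obtains g where "g \<in> borel_measurable borel" "AE x in lborel. f x = g x"
proof -
  from assms have "(\<lambda>x. Re (f x)) \<in> borel_measurable lebesgue" "(\<lambda>x. Im (f x)) \<in> borel_measurable lebesgue"
    by measurable
  from this[THEN completion_ex_borel_measurable_real] obtain a b
    where [measurable]: "a \<in> borel_measurable borel" "b \<in> borel_measurable borel"
      and ab: "AE x in lborel. Re (f x) = a x" "AE x in lborel. Im (f x) = b x"
    by auto
  show ?thesis
  proof
    show "(\<lambda>x. complex_of_real (a x) + \<i> * complex_of_real (b x)) \<in> borel_measurable borel" by measurable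
    show "AE x in lborel. f x = complex_of_real (a x) + \<i> * complex_of_real (b x)"
      using ab by eventually_elim (simp add: complex_eq_iff)
  qed
qed

text \<open>The positive and negative parts of \<open>g\<close> are densities of two finite measures that agree on boxes,
  hence on all Borel sets.\<close>

lemma AE_zero_of_box_integrals_real:
  fixes g :: "'a::euclidean_space \<Rightarrow> real"
  assumes g: "integrable lborel g"
    and z: "\<And>a b. (LINT x|lborel. indicator (box a b) x * g x) = 0"
  shows "AE x in lborel. g x = 0"
proof -
  have [measurable]: "g \<in> borel_measurable borel"
    using borel_measurable_integrable[OF g] by simp
  let ?p = "\<lambda>x. ennreal (g x)" and ?n = "\<lambda>x. ennreal (- g x)"
  have fin: "(\<integral>\<^sup>+x. ?p x \<partial>lborel) \<noteq> \<infinity>" "(\<integral>\<^sup>+x. ?n x \<partial>lborel) \<noteq> \<infinity>"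
    using real_integrable_def[of lborel g] g by auto
  have box: "emeasure (density lborel ?p) (box a b) = emeasure (density lborel ?n) (box a b)" for a b
  proof -
    let ?h = "\<lambda>x. indicator (box a b) x * g x"
    have ih: "integrable lborel ?h"
      using integrable_mult_indicator[of "box a b" lborel g] g by simp
    have "(\<integral>\<^sup>+x. ?p x * indicator (box a b) x \<partial>lborel) = (\<integral>\<^sup>+x. ennreal (?h x) \<partial>lborel)"
      by (intro nn_integral_cong) (auto simp: indicator_def)
    moreover have "(\<integral>\<^sup>+x. ?n x * indicator (box a b) x \<partial>lborel) = (\<integral>\<^sup>+x. ennreal (- ?h x) \<partial>lborel)"
      by (intro nn_integral_cong) (auto simp: indicator_def)
    moreover have "(\<integral>\<^sup>+x. ennreal (?h x) \<partial>lborel) = (\<integral>\<^sup>+x. ennreal (- ?h x) \<partial>lborel)"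
    proof -
      have "enn2real (\<integral>\<^sup>+x. ennreal (?h x) \<partial>lborel) = enn2real (\<integral>\<^sup>+x. ennreal (- ?h x) \<partial>lborel)"
        using real_lebesgue_integral_def[OF ih] z[of a b] by simp
      moreover have "(\<integral>\<^sup>+x. ennreal (?h x) \<partial>lborel) \<noteq> \<infinity>" "(\<integral>\<^sup>+x. ennreal (- ?h x) \<partial>lborel) \<noteq> \<infinity>"
        using ih unfolding real_integrable_def by auto
      ultimately show ?thesis by (simp add: less_top) (metis ennreal_enn2real)
    qed
    ultimately show ?thesis by (simp add: emeasure_density)
  qed
  have "density lborel ?p = density lborel ?n"
  proof (rule measure_eqI_generator_eq)
    let ?E = "range (\<lambda>(a, b). box a b::'a set)"
    show "Int_stable ?E" by (auto simp: Int_stable_def box_Int_box)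
    show "?E \<subseteq> Pow UNIV" "sets (density lborel ?p) = sigma_sets UNIV ?E"
      "sets (density lborel ?n) = sigma_sets UNIV ?E" by (simp_all add: borel_eq_box)
    let ?A = "\<lambda>n::nat. box (- (real n *\<^sub>R One)) (real n *\<^sub>R One) :: 'a set"
    show "range ?A \<subseteq> ?E" "(\<Union>i. ?A i) = UNIV"
      unfolding UN_box_eq_UNIV by auto
    show "emeasure (density lborel ?p) X = emeasure (density lborel ?n) X" if "X \<in> ?E" for X
      using that box by auto
    fix i
    have "emeasure (density lborel ?p) (?A i) \<le> emeasure (density lborel ?p) UNIV"
      by (rule emeasure_mono) auto
    also have "\<dots> = (\<integral>\<^sup>+x. ?p x \<partial>lborel)" by (simp add: emeasure_density)
    finally show "emeasure (density lborel ?p) (?A i) \<noteq> \<infinity>"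
      using fin by (auto simp: top_unique)
  qed
  then have "AE x in lborel. ?p x = ?n x"
    using finite_density_unique[of ?p lborel ?n] fin by auto
  then show ?thesis
  proof eventually_elim
    case (elim x)
    then show ?case by (cases "g x \<ge> 0") (auto simp: ennreal_neg ennreal_eq_0_iff)
  qed
qed

lemma AE_zero_of_box_integrals:
  fixes g :: "'a::euclidean_space \<Rightarrow> complex"
  assumes g: "integrable lborel g"
    and z: "\<And>a b. (LINT x|lborel. indicator (box a b) x *\<^sub>R g x) = 0"
  shows "AE x in lborel. g x = 0"
proof -
  have i: "integrable lborel (\<lambda>x. indicator (box a b) x *\<^sub>R g x)" for a b
    using g by (intro integrable_mult_indicator) auto
  have "(LINT x|lborel. indicator (box a b) x * Re (g x)) = 0" for a b
    using integral_Re[OF i, of a b] z[of a b] by simp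
  then have 1: "AE x in lborel. Re (g x) = 0"
    using g by (intro AE_zero_of_box_integrals_real) auto
  have "(LINT x|lborel. indicator (box a b) x * Im (g x)) = 0" for a b
    using integral_Im[OF i, of a b] z[of a b] by simp
  then have 2: "AE x in lborel. Im (g x) = 0"
    using g by (intro AE_zero_of_box_integrals_real) auto
  from 1 2 show ?thesis by eventually_elim (simp add: complex_eq_iff)
qed


section \<open>Gaussian integrals and injectivity of the Fourier transform\<close>

lemma integrable_lebesgue_iff:
  fixes f g :: "'a::euclidean_space \<Rightarrow> 'b::{banach, second_countable_topology}"
  assumes "f \<in> borel_measurable lebesgue" "g \<in> borel_measurable borel" "AE x in lborel. f x = g x"
  shows "integrable lebesgue f \<longleftrightarrow> integrable lborel g" "integral\<^sup>L lebesgue f = integral\<^sup>L lborel g"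
proof -
  have g: "g \<in> borel_measurable lborel" using assms by simp
  have ae: "AE x in lebesgue. f x = g x" by (rule AE_completion[OF assms(3)])
  have g': "g \<in> borel_measurable lebesgue" using g by (rule measurable_completion)
  show "integrable lebesgue f \<longleftrightarrow> integrable lborel g"
    using integrable_cong_AE[OF assms(1) g' ae] integrable_completion[OF g] by simp
  show "integral\<^sup>L lebesgue f = integral\<^sup>L lborel g"
    using integral_cong_AE[OF assms(1) g' ae] integral_completion[OF g] by simp
qed

text \<open>The form of Tonelli's criterion that is used throughout: a pointwise bound by \<open>V\<close> whose inner
  integrals are dominated by an integrable function.\<close>

lemma integrable_pair_dominated:
  fixes F :: "'a::euclidean_space \<Rightarrow> 'b::euclidean_space \<Rightarrow> complex"
  assumes [measurable]: "case_prod F \<in> borel_measurable (lborel \<Otimes>\<^sub>M lborel)"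
    and v: "\<And>x. integrable lborel (V x)"
    and b: "\<And>x y. cmod (F x y) \<le> V x y"
    and u: "integrable lborel u"
    and vi: "\<And>x. (LINT y|lborel. V x y) \<le> u x"
  shows "integrable (lborel \<Otimes>\<^sub>M lborel) (case_prod F)"
proof (rule lborel_pair.Fubini_integrable)
  have iF: "integrable lborel (F x)" for x
  proof (rule Bochner_Integration.integrable_bound[OF v[of x]])
    show "F x \<in> borel_measurable lborel" by measurable
    show "AE y in lborel. norm (F x y) \<le> norm (V x y)" using b[of x] by (auto intro: order_trans[OF _ abs_ge_self])
  qed
  then show "AE x in lborel. integrable lborel (\<lambda>y. case_prod F (x, y))" by simp
  have "(LINT y|lborel. cmod (F x y)) \<le> u x" for x
    by (rule order_trans[OF integral_mono vi]) (use iF v b in auto)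
  then show "integrable lborel (\<lambda>x. LINT y|lborel. norm (case_prod F (x, y)))"
    by (intro Bochner_Integration.integrable_bound[OF u]) (auto intro: order_trans[OF _ abs_ge_self])
qed simp

lemma lborel_integral_affine:
  fixes f :: "'a::euclidean_space \<Rightarrow> complex"
  assumes c: "c \<noteq> 0" and [measurable]: "f \<in> borel_measurable borel"
  shows "(LINT x|lborel. f x) = \<bar>c\<bar> ^ DIM('a) *\<^sub>R (LINT x|lborel. f (t + c *\<^sub>R x))"
proof -
  have "(LINT x|lborel. f x) =
      (LINT x|density (distr lborel borel (\<lambda>x::'a. t + c *\<^sub>R x)) (\<lambda>_. ennreal (\<bar>c\<bar>^DIM('a))). f x)"
    using lborel_affine[OF c, of t] by simp
  also have "\<dots> = \<bar>c\<bar> ^ DIM('a) *\<^sub>R (LINT x|lborel. f (t + c *\<^sub>R x))"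
    by (subst integral_density) (auto simp: integral_distr)
  finally show ?thesis .
qed

lemma lborel_integrable_affine:
  fixes f :: "'a::euclidean_space \<Rightarrow> complex"
  assumes c: "c \<noteq> 0" and f: "integrable lborel f"
  shows "integrable lborel (\<lambda>x. f (t + c *\<^sub>R x))"
proof -
  have [measurable]: "f \<in> borel_measurable borel" using borel_measurable_integrable[OF f] by simp
  have "integrable (density (distr lborel borel (\<lambda>x::'a. t + c *\<^sub>R x)) (\<lambda>_. ennreal (\<bar>c\<bar>^DIM('a)))) f"
    using lborel_affine[OF c, of t] f by simp
  then have "integrable (distr lborel borel (\<lambda>x::'a. t + c *\<^sub>R x)) (\<lambda>x. \<bar>c\<bar>^DIM('a) *\<^sub>R f x)"
    by (subst (asm) integrable_density) auto
  then have "integrable (distr lborel borel (\<lambda>x::'a. t + c *\<^sub>R x)) f"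
    using integrable_scaleR_right[of "inverse (\<bar>c\<bar>^DIM('a))"] c by fastforce
  then show ?thesis by (subst (asm) integrable_distr_eq) auto
qed

lemma gauss_real:
  fixes a b :: real
  assumes a: "a > 0"
  shows "integrable lborel (\<lambda>x. exp (- a * x\<^sup>2 + b * x))"
proof -
  define s where "s = 1 / sqrt (2 * a)"
  have s: "s > 0" "s\<^sup>2 = 1 / (2 * a)" using a by (auto simp: s_def power_divide)
  have "exp (- a * x\<^sup>2 + b * x)
      = (sqrt (2 * pi * s\<^sup>2) * exp (b\<^sup>2 / (4 * a))) * normal_density (b / (2 * a)) s x" for x
  proof -
    have "- a * x\<^sup>2 + b * x = b\<^sup>2 / (4 * a) + (- (x - b / (2 * a))\<^sup>2 / (2 * s\<^sup>2))"
      unfolding s(2) using a by (simp add: field_simps power2_eq_square)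
    then have "exp (- a * x\<^sup>2 + b * x) = exp (b\<^sup>2 / (4 * a)) * exp (- (x - b / (2 * a))\<^sup>2 / (2 * s\<^sup>2))"
      by (simp only: exp_add)
    then show ?thesis using s(1) by (simp add: normal_density_def)
  qed
  then show ?thesis using s(1) by simp
qed

lemma gauss_integrable:
  fixes a :: real and b :: complex
  assumes a: "a > 0"
  shows "integrable lborel (\<lambda>x::real. exp (- of_real a * (of_real x)\<^sup>2 + b * of_real x))"
  by (rule Bochner_Integration.integrable_bound[OF gauss_real[OF a, of "Re b"]])
     (auto simp flip: of_real_power)

lemma gauss_std_integral:
  "(LINT x|lborel. exp (- (of_real x)\<^sup>2 / 2 + \<i> * of_real (t * x))) = sqrt (2 * pi) * exp (- (complex_of_real t)\<^sup>2 / 2)"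
proof -
  have "complex_of_real (exp (- (t^2) / 2)) = char std_normal_distribution t"
    by (simp add: char_std_normal_distribution)
  also have "\<dots> = (LINT x|lborel. std_normal_density x *\<^sub>R exp (\<i> * of_real (t * x)))"
    unfolding char_def by (subst integral_density) auto
  also have "\<dots> = (LINT x|lborel. (1 / sqrt (2 * pi)) *\<^sub>R exp (- (of_real x)\<^sup>2 / 2 + \<i> * of_real (t * x)))"
    by (intro Bochner_Integration.integral_cong)
       (auto simp: std_normal_density_def scaleR_conv_of_real exp_of_real[symmetric] mult_exp_exp)
  finally show ?thesis
    by (simp add: scaleR_conv_of_real field_simps exp_of_real[symmetric])
qed

text \<open>Completing the square moves the real part of \<open>b\<close> into a translation; what is left is the
  characteristic function of the standard normal distribution.\<close>

lemma gauss_integral: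
  fixes a :: real and b :: complex
  assumes a: "a > 0"
  shows "(LINT x|lborel. exp (- of_real a * (of_real x)\<^sup>2 + b * of_real x)) = sqrt (pi / a) * exp (b\<^sup>2 / (4 * of_real a))"
proof -
  define s where "s = 1 / sqrt (2 * a)"
  have s: "s > 0" "s\<^sup>2 = 1 / (2 * a)" using a by (auto simp: s_def power_divide)
  define t where "t = Re b / (2 * a)"
  have e: "- of_real a * (of_real (t + s * x))\<^sup>2 + b * of_real (t + s * x)
     = (of_real ((Re b)\<^sup>2) / (4 * of_real a) + \<i> * of_real (Im b * t))
       + (- (of_real x)\<^sup>2 / 2 + \<i> * of_real (Im b * s * x))" for x
  proof -
    have "a * (t + s * x)\<^sup>2 = a * t\<^sup>2 + 2 * a * t * s * x + a * s\<^sup>2 * x\<^sup>2"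
      by (simp add: power2_eq_square algebra_simps)
    also have "a * s\<^sup>2 = 1/2" using a s by simp
    finally have 1: "a * (t + s * x)\<^sup>2 = a * t\<^sup>2 + 2 * a * t * s * x + 1/2 * x\<^sup>2" .
    have 2: "2 * a * t = Re b" using a by (simp add: t_def)
    have 3: "(Re b)\<^sup>2 / (4 * a) = a * t\<^sup>2" using a by (simp add: t_def power2_eq_square field_simps)
    have "- a * (t + s * x)\<^sup>2 + Re b * (t + s * x) = (Re b)\<^sup>2 / (4 * a) - x\<^sup>2 / 2"
    proof -
      have "- a * (t + s * x)\<^sup>2 + Re b * (t + s * x) = - (a * (t + s * x)\<^sup>2) + (2 * a * t) * (t + s * x)"
        by (simp only: 2 mult_minus_left)
      also have "\<dots> = a * t\<^sup>2 - x\<^sup>2 / 2"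
        unfolding 1 by (simp add: algebra_simps power2_eq_square)
      finally show ?thesis unfolding 3 .
    qed
    then show ?thesis
      using a by (simp add: complex_eq_iff algebra_simps power2_eq_square Re_divide Im_divide)
  qed
  have "(LINT x|lborel. exp (- of_real a * (of_real x)\<^sup>2 + b * of_real x))
     = s *\<^sub>R (LINT x|lborel. exp (- of_real a * (of_real (t + s * x))\<^sup>2 + b * of_real (t + s * x)))"
    using lborel_integral_affine[of s "\<lambda>x. exp (- of_real a * (of_real x)\<^sup>2 + b * of_real x)" t] s by simp
  also have "\<dots> = s *\<^sub>R (exp (of_real ((Re b)\<^sup>2) / (4 * of_real a) + \<i> * of_real (Im b * t))
       * (sqrt (2 * pi) * exp (- (complex_of_real (Im b * s))\<^sup>2 / 2)))"
    unfolding e exp_add[of "_ + _" "_ + _"] gauss_std_integral[symmetric] by simp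
  also have "\<dots> = (s * sqrt (2 * pi)) * exp ((of_real ((Re b)\<^sup>2) / (4 * of_real a) + \<i> * of_real (Im b * t))
       + - (complex_of_real (Im b * s))\<^sup>2 / 2)"
    unfolding exp_add[of "_ + _" "- _ / _"] by (simp add: scaleR_conv_of_real)
  also have "s * sqrt (2 * pi) = sqrt (pi / a)"
    using a by (simp add: s_def real_sqrt_divide real_sqrt_mult)
  also have "(of_real ((Re b)\<^sup>2) / (4 * of_real a) + \<i> * of_real (Im b * t))
       + - (complex_of_real (Im b * s))\<^sup>2 / 2 = b\<^sup>2 / (4 * of_real a)"
  proof -
    have 1: "(complex_of_real (Im b * s))\<^sup>2 = of_real ((Im b)\<^sup>2 / (2 * a))"
      by (simp add: power_mult_distrib s(2) flip: of_real_power)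
    show ?thesis unfolding 1 t_def using a
      by (simp add: complex_eq_iff power2_eq_square Re_divide Im_divide field_simps)
  qed
  finally show ?thesis .
qed

lemma gauss_vec_exponent:
  fixes x :: "real ^ 'n"
  shows "exp (- of_real (a * (norm x)\<^sup>2) + cdot (cvec x) b)
    = (\<Prod>j\<in>UNIV. exp (- of_real a * (of_real (x $ j))\<^sup>2 + b $ j * of_real (x $ j)))"
  by (simp add: norm_real_vec_sq cdot_def cvec_def sum_distrib_left exp_sum[symmetric]
      sum.distrib sum_subtractf mult.commute)

lemma gauss_vec:
  fixes b :: "complex ^ 'n"
  assumes a: "a > 0"
  shows gauss_vec_integrable: "integrable lborel (\<lambda>x::real^'n. exp (- of_real (a * (norm x)\<^sup>2) + cdot (cvec x) b))"
    and gauss_vec_integral: "(LINT x|lborel. exp (- of_real (a * (norm (x::real^'n))\<^sup>2) + cdot (cvec x) b))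
      = of_real (sqrt (pi / a)) ^ CARD('n) * exp (cdot b b / (4 * of_real a))"
proof -
  have i: "integrable lborel (\<lambda>t::real. exp (- of_real a * (of_real t)\<^sup>2 + b $ j * of_real t))" for j
    by (rule gauss_integrable[OF a])
  show "integrable lborel (\<lambda>x::real^'n. exp (- of_real (a * (norm x)\<^sup>2) + cdot (cvec x) b))"
    unfolding gauss_vec_exponent by (rule integrable_vec_prod[OF i])
  have "exp (cdot b b / (4 * of_real a)) = (\<Prod>j\<in>UNIV. exp ((b $ j)\<^sup>2 / (4 * of_real a)))"
    by (simp add: cdot_def exp_sum[symmetric] sum_divide_distrib power2_eq_square)
  then show "(LINT x|lborel. exp (- of_real (a * (norm (x::real^'n))\<^sup>2) + cdot (cvec x) b))
      = of_real (sqrt (pi / a)) ^ CARD('n) * exp (cdot b b / (4 * of_real a))"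
    unfolding gauss_vec_exponent integral_vec_prod[OF i] gauss_integral[OF a] by (simp add: prod.distrib)
qed

lemma gauss_vec_real_integrable:
  fixes b :: "real ^ 'n"
  assumes a: "a > 0"
  shows "integrable lborel (\<lambda>x::real^'n. exp (- a * (norm x)\<^sup>2 + x \<bullet> b))"
proof -
  have "integrable lborel (\<lambda>x::real^'n. norm (exp (- of_real (a * (norm x)\<^sup>2) + cdot (cvec x) (cvec b))))"
    by (intro integrable_norm gauss_vec_integrable a)
  then show ?thesis by (simp add: cdot_def cvec_def inner_vec_def)
qed

lemma measurable_cvec [measurable]: "cvec \<in> borel_measurable borel"
  unfolding cvec_def by (intro borel_measurable_continuous_onI continuous_intros continuous_on_vec_lambda)

lemma measurable_cdot [measurable (raw)]:
  assumes "f \<in> borel_measurable M" "g \<in> borel_measurable M"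
  shows "(\<lambda>x. cdot (f x) (g x)) \<in> borel_measurable M"
proof -
  have "(\<lambda>z::complex^'n. z $ j) \<in> borel_measurable borel" for j
    by (intro borel_measurable_continuous_onI continuous_intros)
  from measurable_compose[OF assms(1) this] measurable_compose[OF assms(2) this]
  show ?thesis unfolding cdot_def by measurable
qed

lemma cdot_cvec_ii: "cdot (cvec y) (\<i> *s cvec x) = \<i> * of_real (y \<bullet> x)"
  by (simp add: cdot_def cvec_def inner_vec_def sum_distrib_left mult_ac)

text \<open>Gaussians are superpositions of characters, so \<open>g\<close> integrates to zero against all translated and
  dilated Gaussians, hence against the indicator of a box convolved with a narrow Gaussian. In the limit
  this gives the integral of \<open>g\<close> over the box, because the boundary of a box is a null set.\<close>

lemma fourier_injective_L1_borel:
  fixes g :: "real ^ 'n \<Rightarrow> complex"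
  assumes g: "integrable lborel g"
    and z: "\<And>y. (LINT x|lborel. fourier_char x y * g x) = 0"
  shows "AE x in lborel. g x = 0"
proof (rule AE_zero_of_box_integrals[OF g])
  have [measurable]: "g \<in> borel_measurable borel" "g \<in> borel_measurable lborel"
    using borel_measurable_integrable[OF g] by simp_all
  fix a b :: "real ^ 'n"
  let ?N = "CARD('n)"
  let ?G = "\<lambda>v::real^'n. exp (- (norm v)\<^sup>2 / 2)"
  have iG: "integrable lborel ?G"
    using gauss_vec_real_integrable[of "1/2" "0::real^'n"] by simp
  \<comment> \<open>The Gaussian centred at \<open>c\<close> is the integral of the characters against a Gaussian in \<open>y\<close>.\<close>
  have heat: "(LINT x|lborel. of_real (exp (- (k * norm (x - c))\<^sup>2 / 2)) * g x) = 0" for k :: real and c :: "real ^ 'n"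
  proof -
    define F where "F x y = exp (- of_real ((1/2) * (norm y)\<^sup>2) + \<i> * of_real (y \<bullet> (k *\<^sub>R (x - c)))) * g x"
      for x y :: "real ^ 'n"
    have Fn: "cmod (F x y) = cmod (g x) * ?G y" for x y
      by (simp add: F_def norm_mult)
    have iF: "integrable (lborel \<Otimes>\<^sub>M lborel) (case_prod F)"
    proof (rule integrable_pair_dominated)
      show "case_prod F \<in> borel_measurable (lborel \<Otimes>\<^sub>M lborel)"
        unfolding F_def case_prod_beta by measurable
      show "integrable lborel (\<lambda>y. cmod (g x) * ?G y)" for x using iG by simp
      show "cmod (F x y) \<le> cmod (g x) * ?G y" for x y by (simp add: Fn)
      show "integrable lborel (\<lambda>x. cmod (g x) * (LINT y|lborel. ?G y))" using g by simp
    qed simp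
    have sw: "(LINT x|lborel. LINT y|lborel. F x y) = (LINT y|lborel. LINT x|lborel. F x y)"
      by (rule lborel_pair.Fubini_integral[OF iF, symmetric])
    have f0: "(LINT x|lborel. F x y) = 0" for y
    proof -
      have "F x y = (of_real (?G y) * exp (- \<i> * of_real (c \<bullet> (k *\<^sub>R y)))) * (exp (\<i> * of_real (x \<bullet> (k *\<^sub>R y))) * g x)" for x
        unfolding F_def
        by (simp add: mult_exp_exp exp_of_real[symmetric] inner_diff inner_commute algebra_simps)
      then have "(LINT x|lborel. F x y) = (of_real (?G y) * exp (- \<i> * of_real (c \<bullet> (k *\<^sub>R y)))) *
          (LINT x|lborel. exp (\<i> * of_real (x \<bullet> (k *\<^sub>R y))) * g x)"
        by (simp only: integral_mult_right_zero)
      then show ?thesis by (simp only: z mult_zero_right)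
    qed
    have f1: "(LINT y|lborel. F x y) = (of_real (sqrt (2 * pi)) ^ ?N) * (of_real (exp (- (k * norm (x - c))\<^sup>2 / 2)) * g x)" for x
    proof -
      have "cdot (\<i> *s cvec (k *\<^sub>R (x - c))) (\<i> *s cvec (k *\<^sub>R (x - c))) = - of_real ((k * norm (x - c))\<^sup>2)"
      proof -
        have "(k * norm (x - c))\<^sup>2 = (\<Sum>j\<in>UNIV. (k * (x $ j - c $ j))\<^sup>2)"
          by (simp add: power_mult_distrib norm_real_vec_sq sum_distrib_left)
        then show ?thesis
          by (simp add: cdot_def cvec_def sum_negf power2_eq_square mult_ac)
      qed
      then show ?thesis
        unfolding F_def
        using gauss_vec_integral[of "1/2" "\<i> *s cvec (k *\<^sub>R (x - c))", unfolded cdot_cvec_ii]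
        by (simp add: exp_of_real[symmetric] mult.commute)
    qed
    show ?thesis using sw unfolding f0 f1 by simp
  qed
  \<comment> \<open>The indicator of the box convolved with a Gaussian of width of order \<open>1 / (k + 1)\<close>, up to normalization.\<close>
  define L where "L k x = (LINT v|lborel. indicator (box a b) (x + inverse (real (Suc k)) *\<^sub>R v) * ?G v)"
    for k and x :: "real ^ 'n"
  have [measurable]: "L k \<in> borel_measurable borel" for k unfolding L_def by measurable
  have Lz: "(LINT x|lborel. of_real (L k x) * g x) = 0" for k
  proof -
    define K where "K = real (Suc k)"
    have K: "K > 0" by (simp add: K_def)
    define F where "F c x = of_real (indicator (box a b) c * exp (- (K * norm (x - c))\<^sup>2 / 2)) * g x"
      for x c :: "real ^ 'n"
    have bd: "emeasure lborel (box a b) < \<infinity>" by (simp add: emeasure_lborel_box_eq less_top[symmetric])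
    have iF: "integrable (lborel \<Otimes>\<^sub>M lborel) (case_prod F)"
    proof (rule integrable_pair_dominated)
      show "case_prod F \<in> borel_measurable (lborel \<Otimes>\<^sub>M lborel)"
        unfolding F_def case_prod_beta by measurable
      show "integrable lborel (\<lambda>x. indicator (box a b) c * cmod (g x))" for c using g by simp
      show "cmod (F c x) \<le> indicator (box a b) c * cmod (g x)" for x c
        by (auto simp: F_def norm_mult indicator_def intro: mult_left_le_one_le)
      show "integrable lborel (\<lambda>c. indicator (box a b) c * (LINT x|lborel. cmod (g x)))"
        using bd by (intro integrable_mult_left integrable_real_indicator) auto
    qed simp
    have "0 = (LINT c|lborel. LINT x|lborel. F c x)"
      unfolding F_def using heat[of K] by (simp add: mult.assoc)
    also have "\<dots> = (LINT x|lborel. LINT c|lborel. F c x)"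
      by (rule lborel_pair.Fubini_integral[OF iF, symmetric])
    finally have sw: "0 = (LINT x|lborel. LINT c|lborel. F c x)" .
    have f1: "(LINT c|lborel. F c x) = (inverse K ^ ?N) *\<^sub>R (of_real (L k x) * g x)" for x
    proof -
      have "(LINT c|lborel. F c x) = \<bar>inverse K\<bar> ^ DIM(real^'n) *\<^sub>R (LINT v|lborel. F (x + inverse K *\<^sub>R v) x)"
        using K by (intro lborel_integral_affine) (auto simp: F_def)
      also have "(LINT v|lborel. F (x + inverse K *\<^sub>R v) x) = (LINT v|lborel. of_real (indicator (box a b) (x + inverse K *\<^sub>R v) * ?G v)) * g x"
      proof -
        have KK: "K * (inverse K * r) = r" for r using K by (simp add: field_simps)
        show ?thesis unfolding F_def using K by (simp add: KK)
      qed
      also have "(LINT v|lborel. complex_of_real (indicator (box a b) (x + inverse K *\<^sub>R v) * ?G v)) = of_real (L k x)"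
        unfolding L_def K_def by (rule integral_complex_of_real)
      finally show ?thesis using K by simp
    qed
    show ?thesis using sw K unfolding f1 by simp
  qed
  define c where "c = (LINT v|lborel. ?G v)"
  have "c = sqrt (2 * pi) ^ ?N"
  proof -
    have "complex_of_real c = (LINT v|lborel. of_real (?G v))" unfolding c_def by simp
    also have "\<dots> = of_real (sqrt (2 * pi) ^ ?N)"
      using gauss_vec_integral[of "1/2" "0::complex^'n"]
      by (simp add: exp_of_real[symmetric] cdot_def mult.commute)
    finally show ?thesis by (simp only: of_real_eq_iff)
  qed
  then have c0: "c \<noteq> 0" by simp
  have lim: "AE x in lborel. (\<lambda>k. L k x) \<longlonglongrightarrow> indicator (box a b) x * c"
  proof -
    have "cbox a b - box a b \<in> null_sets lebesgue"
      using negligible_frontier_interval[of a b] by (simp add: negligible_iff_null_sets)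
    then have "AE x in lebesgue. x \<notin> cbox a b - box a b" by (rule AE_not_in)
    then have "AE x in lborel. x \<notin> cbox a b - box a b"
      by (simp add: AE_completion_iff)
    then show ?thesis
    proof eventually_elim
      case (elim x)
      have lv: "(\<lambda>k. x + inverse (real (Suc k)) *\<^sub>R v) \<longlonglongrightarrow> x" for v
        using tendsto_add[OF tendsto_const tendsto_scaleR[OF LIMSEQ_inverse_real_of_nat tendsto_const], of x v] by simp
      have "\<forall>\<^sub>F k in sequentially. indicator (box a b) (x + inverse (real (Suc k)) *\<^sub>R v) = (indicator (box a b) x :: real)" for v
      proof (cases "x \<in> box a b")
        case True
        then have "\<forall>\<^sub>F k in sequentially. x + inverse (real (Suc k)) *\<^sub>R v \<in> box a b"
          using lv[of v] open_box topological_tendstoD by blast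
        then show ?thesis by eventually_elim (simp add: True)
      next
        case False
        then have "x \<in> - cbox a b" using elim by auto
        then have "\<forall>\<^sub>F k in sequentially. x + inverse (real (Suc k)) *\<^sub>R v \<in> - cbox a b"
          using lv[of v] topological_tendstoD open_Compl[OF closed_cbox] by blast
        then show ?thesis
          by eventually_elim (use False box_subset_cbox in \<open>auto simp: indicator_def\<close>)
      qed
      then have l: "(\<lambda>k. indicator (box a b) (x + inverse (real (Suc k)) *\<^sub>R v) * ?G v) \<longlonglongrightarrow> indicator (box a b) x * ?G v" for v
        by (intro tendsto_mult tendsto_const tendsto_eventually)
      have "(\<lambda>k. L k x) \<longlonglongrightarrow> (LINT v|lborel. indicator (box a b) x * ?G v)"
        unfolding L_def
        by (rule integral_dominated_convergence[where w="?G"])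
           (use iG l in \<open>auto simp: indicator_def\<close>)
      then show ?case by (simp add: c_def)
    qed
  qed
  have Lb: "0 \<le> L k x" "L k x \<le> c" for k x
  proof -
    show "0 \<le> L k x" unfolding L_def by (intro integral_nonneg_AE) auto
    show "L k x \<le> c" unfolding L_def c_def
    proof (rule integral_mono[OF _ iG])
      show "integrable lborel (\<lambda>v. indicator (box a b) (x + inverse (real (Suc k)) *\<^sub>R v) * ?G v)"
        by (rule Bochner_Integration.integrable_bound[OF iG]) (auto simp: indicator_def)
    qed (auto simp: indicator_def)
  qed
  have "(\<lambda>k. LINT x|lborel. of_real (L k x) * g x) \<longlonglongrightarrow> (LINT x|lborel. of_real (indicator (box a b) x * c) * g x)"
  proof (rule integral_dominated_convergence[where w="\<lambda>x. c * cmod (g x)"])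
    show "integrable lborel (\<lambda>x. c * cmod (g x))" using g by simp
    show "AE x in lborel. (\<lambda>k. of_real (L k x) * g x) \<longlonglongrightarrow> of_real (indicator (box a b) x * c) * g x"
      using lim by eventually_elim (intro tendsto_intros)
    show "AE x in lborel. norm (of_real (L k x) * g x) \<le> c * cmod (g x)" for k
      using Lb by (auto simp: norm_mult intro!: mult_right_mono AE_I2)
  qed auto
  then have "(LINT x|lborel. of_real (indicator (box a b) x * c) * g x) = 0"
    unfolding Lz using LIMSEQ_unique tendsto_const by blast
  also have "(LINT x|lborel. of_real (indicator (box a b) x * c) * g x) = of_real c * (LINT x|lborel. indicator (box a b) x *\<^sub>R g x)"
    by (subst integral_mult_right_zero[symmetric]) (simp add: scaleR_conv_of_real mult_ac)
  finally show "(LINT x|lborel. indicator (box a b) x *\<^sub>R g x) = 0"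
    using c0 by simp
qed

lemma fourier_injective_L1:
  fixes g :: "real ^ 'n \<Rightarrow> complex"
  assumes g: "integrable lebesgue g"
    and z: "\<And>y. (LINT x|lebesgue. fourier_char x y * g x) = 0"
  shows "AE x in lebesgue. g x = 0"
proof -
  have m: "g \<in> borel_measurable lebesgue" using g by simp
  then obtain h where h[measurable]: "h \<in> borel_measurable borel" and gh: "AE x in lborel. g x = h x"
    by (rule lebesgue_borel_version)
  have "AE x in lborel. h x = 0"
  proof (rule fourier_injective_L1_borel)
    show "integrable lborel h" using integrable_lebesgue_iff(1)[OF m h gh] g by simp
    fix y :: "real ^ 'n"
    have [measurable]: "(\<lambda>x. fourier_char x y) \<in> borel_measurable lebesgue"
      by (rule measurable_completion) simp
    have "(LINT x|lebesgue. fourier_char x y * g x) = (LINT x|lborel. fourier_char x y * h x)"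
      using m gh by (intro integrable_lebesgue_iff(2)) auto
    then show "(LINT x|lborel. fourier_char x y * h x) = 0" using z by simp
  qed
  then have "AE x in lborel. g x = 0" using gh by eventually_elim simp
  then show ?thesis by (rule AE_completion)
qed


section \<open>Hermite polynomials in one variable\<close>

text \<open>Hermite polynomials by their three-term recursion, which allows inductions that never differentiate.
  The coefficients are generic since both the real and the complex versions are needed.\<close>

fun hpoly :: "nat \<Rightarrow> 'a::idom poly" where
  "hpoly 0 = 1"
| "hpoly (Suc 0) = [:0, 2:]"
| "hpoly (Suc (Suc k)) = [:0, 2:] * hpoly (Suc k) - smult (of_nat (2 * Suc k)) (hpoly k)"

lemma pderiv_hpoly: "pderiv (hpoly k :: 'a::{idom,semiring_char_0} poly) = smult (of_nat (2 * k)) (hpoly (k - 1))"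
proof (induction k rule: hpoly.induct)
  case (3 k)
  show ?case
  proof (cases k)
    case 0
    then show ?thesis by (simp add: pderiv_pCons pderiv_diff pderiv_smult pderiv_mult)
  next
    case (Suc l)
    have "hpoly (Suc k) = [:0, 2:] * hpoly k - smult (of_nat (2 * k)) (hpoly (k - 1) :: 'a poly)"
      by (simp add: Suc)
    then have h: "[:0, 2:] * hpoly k = hpoly (Suc k) + smult (of_nat (2 * k)) (hpoly (k - 1) :: 'a poly)"
      by simp
    have "pderiv (hpoly (Suc (Suc k)) :: 'a poly)
       = smult 2 (hpoly (Suc k)) + smult (of_nat (2 * Suc k)) ([:0, 2:] * hpoly k)
         - smult (of_nat (2 * Suc k)) (smult (of_nat (2 * k)) (hpoly (k - 1)))"
      using 3 by (simp only: hpoly.simps pderiv_diff pderiv_mult pderiv_smult diff_Suc_1)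
        (simp add: pderiv_pCons)
    also have "\<dots> = smult (of_nat (2 * Suc (Suc k))) (hpoly (Suc k))"
      unfolding h by (simp add: smult_add_right algebra_simps flip: smult_add_left)
    finally show ?thesis by simp
  qed
qed (auto simp: pderiv_pCons pderiv_1)

lemma hpoly_Suc: "(hpoly (Suc k) :: 'a::{idom,semiring_char_0} poly) = [:0, 2:] * hpoly k - pderiv (hpoly k)"
  by (cases k) (simp_all add: pderiv_hpoly pderiv_1 del: mult_pCons_left)

lemma poly_hpoly_of_real: "poly (hpoly k) (of_real x) = (of_real (poly (hpoly k) x) :: complex)"
  by (induction k rule: hpoly.induct) auto

lemma hermite_poly_eq: "hermite_poly k t = poly (hpoly k) t"
proof -
  have "(deriv ^^ k) (\<lambda>u::real. exp (- u\<^sup>2)) = (\<lambda>u. (-1) ^ k * poly (hpoly k) u * exp (- u\<^sup>2))"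
  proof (induction k)
    case (Suc k)
    have "((\<lambda>u. (-1) ^ k * poly (hpoly k) u * exp (- u\<^sup>2)) has_field_derivative
        ((-1) ^ Suc k * poly (hpoly (Suc k)) u * exp (- u\<^sup>2))) (at u)" for u :: real
      by (auto intro!: derivative_eq_intros simp: hpoly_Suc algebra_simps simp del: hpoly.simps)
    then show ?case
      by (auto simp: Suc intro!: DERIV_imp_deriv)
  qed simp
  then have "hermite_poly k t = ((-1) ^ k * (-1) ^ k) * (exp (t\<^sup>2) * exp (- t\<^sup>2)) * poly (hpoly k) t"
    by (simp add: hermite_poly_def)
  also have "(-1) ^ k * (-1) ^ k = (1::real)" by (simp flip: power_mult_distrib)
  also have "exp (t\<^sup>2) * exp (- t\<^sup>2) = 1" by (simp flip: exp_add)
  finally show ?thesis by simp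
qed

lemma power_le_exp_abs: "\<bar>x\<bar> ^ k \<le> fact k * exp \<bar>x\<bar>" for x :: real
proof -
  have e: "(\<lambda>n. \<bar>x\<bar> ^ n / fact n) sums exp \<bar>x\<bar>"
    using exp_converges[of "\<bar>x\<bar>"] by (simp add: divide_inverse mult.commute)
  have "(\<Sum>n\<in>{k}. \<bar>x\<bar> ^ n / fact n) \<le> (\<Sum>n. \<bar>x\<bar> ^ n / fact n)"
    by (intro sum_le_suminf sums_summable[OF e]) auto
  then show ?thesis using sums_unique[OF e] by (simp add: field_simps)
qed

text \<open>The sum of two exponentials, instead of the exponential of the absolute value, keeps the bound inside
  the class of Gaussians with a linear term.\<close>

lemma power_le_exp: "\<bar>x\<bar> ^ k \<le> fact k * (exp x + exp (- x))" for x :: real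
proof -
  have "exp \<bar>x\<bar> \<le> exp x + exp (- x)" by (simp add: abs_real_def add_increasing add_increasing2)
  then have "fact k * exp \<bar>x\<bar> \<le> fact k * (exp x + exp (- x))" by (intro mult_left_mono) auto
  with power_le_exp_abs[of x k] show ?thesis by (rule order_trans)
qed

definition gexp :: "real \<Rightarrow> complex \<Rightarrow> real \<Rightarrow> complex" where
  "gexp a z x = exp (- of_real a * (of_real x)\<^sup>2 + z * of_real x)"

lemma monom_gexp_bound: "cmod ((of_real x) ^ k * gexp a z x) \<le> fact k * (cmod (gexp a (z + 1) x) + cmod (gexp a (z - 1) x))"
proof -
  have "cmod ((of_real x) ^ k * gexp a z x) = \<bar>x\<bar> ^ k * cmod (gexp a z x)"
    by (simp add: norm_mult norm_power)
  also have "\<dots> \<le> (fact k * (exp x + exp (- x))) * cmod (gexp a z x)"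
    by (intro mult_right_mono power_le_exp) auto
  also have "\<dots> = fact k * (cmod (gexp a (z + 1) x) + cmod (gexp a (z - 1) x))"
  proof -
    have "gexp a (z + 1) x = gexp a z x * of_real (exp x)" "gexp a (z - 1) x = gexp a z x * of_real (exp (- x))"
      by (simp_all add: gexp_def exp_of_real[symmetric] mult_exp_exp algebra_simps)
    then have "cmod (gexp a (z + 1) x) = cmod (gexp a z x) * exp x" "cmod (gexp a (z - 1) x) = cmod (gexp a z x) * exp (- x)"
      by (simp_all only: norm_mult norm_of_real abs_exp_cancel)
    then show ?thesis by (simp add: algebra_simps)
  qed
  finally show ?thesis .
qed

lemma measurable_gexp [measurable]: "gexp a z \<in> borel_measurable borel"
  unfolding gexp_def by measurable

lemma gexp_integrable: "a > 0 \<Longrightarrow> integrable lborel (gexp a z)"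
  unfolding gexp_def by (rule gauss_integrable)

lemma poly_gexp_integrable:
  assumes a: "a > 0"
  shows "integrable lborel (\<lambda>x. poly p (of_real x) * gexp a z x)"
proof -
  have "integrable lborel (\<lambda>x. (of_real x) ^ k * gexp a z x)" for k
    by (rule Bochner_Integration.integrable_bound[where
          f="\<lambda>x. fact k * (cmod (gexp a (z + 1) x) + cmod (gexp a (z - 1) x))"])
       (use monom_gexp_bound gexp_integrable[OF a] in
         \<open>auto intro!: integrable_norm Bochner_Integration.integrable_add integrable_mult_right intro: order_trans[OF _ abs_ge_self]\<close>)
  then show ?thesis
    by (simp add: poly_altdef sum_distrib_right mult.assoc)
qed

lemma gexp_tendsto_0:
  assumes a: "a > 0"
  shows "(gexp a z \<longlongrightarrow> 0) at_top" "(gexp a z \<longlongrightarrow> 0) at_bot"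
proof -
  have n: "norm (gexp a z x) = exp (- a * x\<^sup>2 + Re z * x)" for x
    by (simp add: gexp_def flip: of_real_power)
  have "((\<lambda>x. exp (- a * x\<^sup>2 + Re z * x)) \<longlongrightarrow> 0) at_top" using a by real_asymp
  then show "(gexp a z \<longlongrightarrow> 0) at_top" by (subst tendsto_norm_zero_iff[symmetric]) (simp add: n)
  have "((\<lambda>x. exp (- a * x\<^sup>2 + Re z * x)) \<longlongrightarrow> 0) at_bot" using a by real_asymp
  then show "(gexp a z \<longlongrightarrow> 0) at_bot" by (subst tendsto_norm_zero_iff[symmetric]) (simp add: n)
qed

lemma poly_gexp_tendsto_0:
  assumes a: "a > 0" and F: "F = at_top \<or> F = at_bot"
  shows "((\<lambda>x. poly p (of_real x) * gexp a z x) \<longlongrightarrow> 0) F"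
proof -
  have "((\<lambda>x. (of_real x) ^ k * gexp a z x) \<longlongrightarrow> 0) F" for k
  proof (rule Lim_null_comparison)
    show "\<forall>\<^sub>F x in F. norm ((of_real x) ^ k * gexp a z x) \<le> fact k * (cmod (gexp a (z + 1) x) + cmod (gexp a (z - 1) x))"
      using monom_gexp_bound by simp
    show "((\<lambda>x. fact k * (cmod (gexp a (z + 1) x) + cmod (gexp a (z - 1) x))) \<longlongrightarrow> 0) F"
      using F gexp_tendsto_0[OF a] by (auto intro!: tendsto_eq_intros)
  qed
  then have "((\<lambda>x. \<Sum>i\<le>degree p. coeff p i * ((of_real x) ^ i * gexp a z x)) \<longlongrightarrow> (\<Sum>i\<le>degree p. coeff p i * 0)) F"
    by (intro tendsto_sum tendsto_mult tendsto_const)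
  then show ?thesis by (simp add: poly_altdef sum_distrib_right mult.assoc)
qed

text \<open>The integrand is the derivative of a function that vanishes at infinity. All integrals of Hermite
  polynomials below are instances of this integration by parts.\<close>

lemma poly_gexp_parts:
  assumes a: "a > 0"
  shows "(LINT x|lborel. poly (pderiv p + p * [:z, - 2 * of_real a:]) (of_real x) * gexp a z x) = 0"
proof -
  let ?F = "\<lambda>x. poly p (of_real x) * gexp a z x"
  let ?f = "\<lambda>x. poly (pderiv p + p * [:z, - 2 * of_real a:]) (of_real x) * gexp a z x"
  have "((\<lambda>w. poly p w * exp (- of_real a * w\<^sup>2 + z * w)) has_field_derivative
      (poly (pderiv p + p * [:z, - 2 * of_real a:]) w * exp (- of_real a * w\<^sup>2 + z * w))) (at w)" for w
    by (auto intro!: derivative_eq_intros simp: algebra_simps)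
  then have D: "(?F has_vector_derivative ?f x) (at x)" for x
    unfolding gexp_def using has_vector_derivative_real_field[of _ _ x UNIV] by auto
  have i: "integrable lborel ?f" by (rule poly_gexp_integrable[OF a])
  have c: "continuous_on UNIV ?f" unfolding gexp_def by (intro continuous_intros)
  have "(LBINT x=-\<infinity>..\<infinity>. ?f x) = 0 - 0"
  proof (rule interval_integral_FTC_integrable[where F="?F"])
    show "isCont ?f x" for x using c by (simp add: continuous_on_eq_continuous_at)
    show "set_integrable lborel (einterval (-\<infinity>) \<infinity>) ?f"
      using i by (simp add: set_integrable_def)
    show "((?F \<circ> real_of_ereal) \<longlongrightarrow> 0) (at_right (-\<infinity>))"
      using poly_gexp_tendsto_0[OF a, of at_bot p z] by (simp add: ereal_tendsto_simps)
    show "((?F \<circ> real_of_ereal) \<longlongrightarrow> 0) (at_left \<infinity>)"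
      using poly_gexp_tendsto_0[OF a, of at_top p z] by (simp add: ereal_tendsto_simps)
  qed (use D in auto)
  then show ?thesis
    by (simp add: interval_lebesgue_integral_def set_lebesgue_integral_def)
qed

lemma hpoly_bargmann_integral:
  "(LINT x|lborel. poly (hpoly k) (of_real x) * gexp 1 z x) = z ^ k * (of_real (sqrt pi) * exp (z\<^sup>2 / 4))"
proof (induction k)
  case 0
  then show ?case using gauss_integral[of 1 z] by (simp add: gexp_def)
next
  case (Suc k)
  let ?I = "\<lambda>p. LINT x|lborel. poly p (of_real x) * gexp 1 z x"
  note i = poly_gexp_integrable[of 1, simplified]
  have eq: "pderiv (hpoly k) + hpoly k * [:z, - 2 * of_real 1:] = smult z (hpoly k) - hpoly (Suc k)"
    by (subst poly_eq_poly_eq_iff[symmetric]) (auto simp: hpoly_Suc fun_eq_iff algebra_simps simp del: hpoly.simps)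
  have "?I (smult z (hpoly k) - hpoly (Suc k)) = 0"
    using poly_gexp_parts[of 1 "hpoly k" z, OF zero_less_one, unfolded eq] .
  moreover have "?I (smult z (hpoly k) - hpoly (Suc k)) = z * ?I (hpoly k) - ?I (hpoly (Suc k))"
    using i by (simp add: left_diff_distrib mult.assoc del: hpoly.simps)
  ultimately show ?case using Suc by (simp add: mult.assoc del: hpoly.simps)
qed

lemma hpoly_orthogonal:
  "(LINT x|lborel. poly (hpoly j) (of_real x) * poly (hpoly k) (of_real x) * gexp 1 0 x)
    = (if j = k then of_real (2 ^ k * fact k * sqrt pi) else 0)"
proof -
  define J where "J j k = (LINT x|lborel. poly (hpoly j * hpoly k) (of_real x) * gexp 1 0 x)" for j k
  have sym: "J j k = J k j" for j k by (simp add: J_def mult.commute)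
  have J0: "J j 0 = (if j = 0 then of_real (sqrt pi) else 0)" for j
    using hpoly_bargmann_integral[of j 0] by (simp add: J_def)
  have JS: "J j (Suc k) = of_nat (2 * j) * J (j - 1) k" for j k
  proof -
    have eq: "pderiv (hpoly j * hpoly k) + hpoly j * hpoly k * [:0, - 2 * of_real 1:]
       = smult (of_nat (2 * j)) (hpoly (j - 1) * hpoly k) - hpoly j * (hpoly (Suc k) :: complex poly)"
      by (subst poly_eq_poly_eq_iff[symmetric])
         (auto simp: hpoly_Suc[of k] pderiv_mult pderiv_hpoly[of j] fun_eq_iff algebra_simps simp del: hpoly.simps)
    have "(LINT x|lborel. poly (smult (of_nat (2 * j)) (hpoly (j - 1) * hpoly k) - hpoly j * hpoly (Suc k)) (of_real x) * gexp 1 0 x) = 0"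
      using poly_gexp_parts[of 1 "hpoly j * hpoly k" 0, OF zero_less_one, unfolded eq] .
    moreover have "(LINT x|lborel. poly (smult (of_nat (2 * j)) (hpoly (j - 1) * hpoly k) - hpoly j * hpoly (Suc k)) (of_real x) * gexp 1 0 x)
        = of_nat (2 * j) * J (j - 1) k - J j (Suc k)"
      unfolding J_def
      using poly_gexp_integrable[of 1 "smult (of_nat (2 * j)) (hpoly (j - 1) * hpoly k)" 0]
        poly_gexp_integrable[of 1 "hpoly j * hpoly (Suc k)" 0]
      unfolding poly_diff left_diff_distrib
      by (subst Bochner_Integration.integral_diff) (simp_all add: mult.assoc del: hpoly.simps poly_mult)
    ultimately show ?thesis by simp
  qed
  have "J j k = (if j = k then of_real (2 ^ k * fact k * sqrt pi) else 0)"
  proof (induction k arbitrary: j)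
    case 0
    then show ?case by (simp add: J0)
  next
    case (Suc k)
    then show ?case by (cases j) (simp_all add: JS algebra_simps)
  qed
  then show ?thesis by (simp add: J_def)
qed

text \<open>Integration by parts yields for these integrals the three-term recursion of the Hermite polynomials,
  up to the powers of \<open>\<i> \<epsilon>\<close>; the sign works out because the square of
  \<open>\<i> \<epsilon>\<close> is \<open>-1\<close>.\<close>

lemma hpoly_fourier_integral:
  assumes e: "\<epsilon>\<^sup>2 = (1::real)"
  shows "(LINT x|lborel. poly (hpoly k) (of_real x) * gexp (1/2) (\<i> * of_real (\<epsilon> * y)) x)
    = (\<i> * of_real \<epsilon>) ^ k * of_real (sqrt (2 * pi)) * poly (hpoly k) (of_real y) * exp (- (of_real y)\<^sup>2 / 2)"
proof -
  define z where "z = \<i> * complex_of_real (\<epsilon> * y)"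
  define u where "u = \<i> * complex_of_real \<epsilon>"
  have u2: "u\<^sup>2 = -1" using e by (simp add: u_def power_mult_distrib flip: of_real_power)
  have zu: "z = u * of_real y" by (simp add: z_def u_def)
  let ?I = "\<lambda>p. LINT x|lborel. poly p (of_real x) * gexp (1/2) z x"
  note i = poly_gexp_integrable[of "1/2", simplified]
  have lin: "?I (smult c p + smult d q) = c * ?I p + d * ?I q" for c d p q
    using i by (simp add: distrib_right mult.assoc)
  have rec: "?I (hpoly (Suc k)) = 2 * z * ?I (hpoly k) + of_nat (2 * k) * ?I (hpoly (k - 1))" for k
  proof -
    have "hpoly (Suc k) = smult (-2) (pderiv (hpoly k) + hpoly k * [:z, - 2 * of_real (1/2):])
        + smult 1 (smult (2 * z) (hpoly k) + smult (of_nat (2 * k)) (hpoly (k - 1)))"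
      by (subst poly_eq_poly_eq_iff[symmetric])
         (auto simp: hpoly_Suc pderiv_hpoly[of k] fun_eq_iff algebra_simps simp del: hpoly.simps)
    then have "?I (hpoly (Suc k)) = (-2) * ?I (pderiv (hpoly k) + hpoly k * [:z, - 2 * of_real (1/2):])
        + 1 * ?I (smult (2 * z) (hpoly k) + smult (of_nat (2 * k)) (hpoly (k - 1)))"
      unfolding lin[symmetric] by (simp only:)
    also have "?I (pderiv (hpoly k) + hpoly k * [:z, - 2 * of_real (1/2):]) = 0"
      by (rule poly_gexp_parts) simp
    finally show ?thesis unfolding lin by simp
  qed
  have "?I (hpoly k) = u ^ k * of_real (sqrt (2 * pi)) * poly (hpoly k) (of_real y) * exp (- (of_real y)\<^sup>2 / 2)"
  proof (induction k rule: hpoly.induct)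
    case 1
    have "z\<^sup>2 = - (of_real y)\<^sup>2" by (simp add: zu power_mult_distrib u2)
    then show ?case using gauss_integral[of "1/2" z] by (simp add: gexp_def mult.commute)
  next
    case 2
    have "z\<^sup>2 = - (of_real y)\<^sup>2" by (simp add: zu power_mult_distrib u2)
    then have "?I 1 = of_real (sqrt (2 * pi)) * exp (- (of_real y)\<^sup>2 / 2)"
      using gauss_integral[of "1/2" z] by (simp add: gexp_def mult.commute)
    then show ?case using rec[of 0] by (simp add: zu)
  next
    case (3 k)
    have uu: "u ^ k = - (u ^ Suc (Suc k))" using u2 by (simp add: power2_eq_square mult.assoc[symmetric])
    have "?I (hpoly (Suc (Suc k))) = 2 * z * ?I (hpoly (Suc k)) + of_nat (2 * Suc k) * ?I (hpoly k)"
      using rec[of "Suc k"] by (simp only: diff_Suc_1)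
    also have "\<dots> = 2 * (u * of_real y) * (u ^ Suc k * of_real (sqrt (2 * pi)) * poly (hpoly (Suc k)) (of_real y) * exp (- (of_real y)\<^sup>2 / 2))
        + of_nat (2 * Suc k) * (- (u ^ Suc (Suc k)) * of_real (sqrt (2 * pi)) * poly (hpoly k) (of_real y) * exp (- (of_real y)\<^sup>2 / 2))"
      unfolding 3(1) 3(2) unfolding zu uu[symmetric] ..
    also have "\<dots> = u ^ Suc (Suc k) * of_real (sqrt (2 * pi)) * poly (hpoly (Suc (Suc k))) (of_real y) * exp (- (of_real y)\<^sup>2 / 2)"
      by (simp add: algebra_simps)
    finally show ?case .
  qed
  then show ?thesis unfolding z_def u_def .
qed


section \<open>Hermite functions in several variables\<close>

definition hermite_norm :: "nat \<Rightarrow> real" where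
  "hermite_norm k = sqrt (2 ^ k * fact k * sqrt pi)"

lemma hermite_norm_pos: "hermite_norm k > 0" by (simp add: hermite_norm_def)

lemma hermite_fun1_eq:
  "complex_of_real (hermite_fun1 k t) = poly (hpoly k) (of_real t) * gexp (1/2) 0 t / of_real (hermite_norm k)"
  by (simp add: hermite_fun1_def hermite_poly_eq poly_hpoly_of_real gexp_def hermite_norm_def exp_of_real[symmetric])

lemma measurable_hermite_fun1 [measurable]: "hermite_fun1 k \<in> borel_measurable borel"
  unfolding hermite_fun1_def hermite_poly_eq
  by (intro borel_measurable_continuous_onI continuous_intros) auto

lemma measurable_vec_nth [measurable]: "(\<lambda>x::real^'n. x $ j) \<in> borel_measurable borel"
  by (intro borel_measurable_continuous_onI continuous_intros)

lemma measurable_hermite_fun [measurable]: "hermite_fun \<alpha> \<in> borel_measurable borel"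
  unfolding hermite_fun_def by measurable

lemma hermite_fun_prod: "hermite_fun \<alpha> x * (\<Prod>j\<in>UNIV. h j) = (\<Prod>j\<in>UNIV. of_real (hermite_fun1 (\<alpha> $ j) (x $ j)) * h j)"
  for x :: "real ^ 'n"
  by (simp add: hermite_fun_def prod.distrib)

lemma cnj_hermite_fun [simp]: "cnj (hermite_fun \<alpha> x) = hermite_fun \<alpha> x"
  by (simp add: hermite_fun_def)

lemma hermite_fun1_eq':
  "complex_of_real (hermite_fun1 k t) = poly (hpoly k) (of_real t) * exp (- (of_real t)\<^sup>2 / 2) / of_real (hermite_norm k)"
  by (simp add: hermite_fun1_eq gexp_def)

lemma exp_cdot_cvec: "exp (cdot (cvec x) b) = (\<Prod>j\<in>UNIV. exp (b $ j * of_real (x $ j)))" for x :: "real ^ 'n"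
  by (simp add: cdot_def cvec_def exp_sum[symmetric] mult.commute)

lemma exp_gauss_vec: "gaussian x = (\<Prod>j\<in>UNIV. exp (- (of_real (x $ j))\<^sup>2 / 2))" for x :: "real ^ 'n"
  by (simp add: norm_real_vec_sq exp_of_real[symmetric] exp_sum[symmetric] sum_divide_distrib sum_negf)

lemma hermite_fun1_exp: "of_real (hermite_fun1 k t) * exp (b * of_real t) = poly (hpoly k) (of_real t) * gexp (1/2) b t / of_real (hermite_norm k)"
  by (simp add: hermite_fun1_eq gexp_def mult_exp_exp)

lemma hermite_fun1_gauss_exp: "of_real (hermite_fun1 k t) * (exp (- (of_real t)\<^sup>2 / 2) * exp (b * of_real t)) = poly (hpoly k) (of_real t) * gexp 1 b t / of_real (hermite_norm k)"
  by (simp add: hermite_fun1_eq gexp_def mult_exp_exp)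

lemma hermite_fun_exp_integrable_borel:
  "integrable lborel (\<lambda>x. hermite_fun \<alpha> x * exp (cdot (cvec x) b))"
  unfolding exp_cdot_cvec hermite_fun_prod hermite_fun1_exp
  by (intro integrable_vec_prod integrable_divide_zero poly_gexp_integrable) auto

lemma hermite_fun_norm_exp_integrable_borel:
  "integrable lborel (\<lambda>x. cmod (hermite_fun \<alpha> x) * exp (x \<bullet> b))"
proof -
  have "integrable lborel (\<lambda>x. cmod (hermite_fun \<alpha> x * exp (cdot (cvec x) (cvec b))))"
    by (intro integrable_norm hermite_fun_exp_integrable_borel)
  then show ?thesis by (simp add: norm_mult cdot_def cvec_def inner_vec_def)
qed

lemma hermite_fun_orthonormal_borel:
  "(LINT x|lborel. hermite_fun \<alpha> x * cnj (hermite_fun \<beta> x)) = (if \<alpha> = \<beta> then 1 else 0)"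
proof -
  have e: "hermite_fun \<alpha> x * cnj (hermite_fun \<beta> x)
    = (\<Prod>j\<in>UNIV. poly (hpoly (\<alpha> $ j)) (of_real (x $ j)) * poly (hpoly (\<beta> $ j)) (of_real (x $ j)) * gexp 1 0 (x $ j)
         / of_real (hermite_norm (\<alpha> $ j) * hermite_norm (\<beta> $ j)))" for x
  proof -
    have "hermite_fun \<alpha> x * cnj (hermite_fun \<beta> x) = (\<Prod>j\<in>UNIV. of_real (hermite_fun1 (\<alpha> $ j) (x $ j)) * of_real (hermite_fun1 (\<beta> $ j) (x $ j)))"
      unfolding cnj_hermite_fun by (simp add: hermite_fun_def prod.distrib)
    also have "\<dots> = (\<Prod>j\<in>UNIV. poly (hpoly (\<alpha> $ j)) (of_real (x $ j)) * poly (hpoly (\<beta> $ j)) (of_real (x $ j)) * gexp 1 0 (x $ j)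
         / of_real (hermite_norm (\<alpha> $ j) * hermite_norm (\<beta> $ j)))"
    proof (rule prod.cong)
      fix j
      have "gexp (1/2) 0 (x $ j) * gexp (1/2) 0 (x $ j) = gexp 1 0 (x $ j)"
        by (simp add: gexp_def mult_exp_exp)
      then show "of_real (hermite_fun1 (\<alpha> $ j) (x $ j)) * of_real (hermite_fun1 (\<beta> $ j) (x $ j)) = poly (hpoly (\<alpha> $ j)) (of_real (x $ j)) * poly (hpoly (\<beta> $ j)) (of_real (x $ j)) * gexp 1 0 (x $ j)
         / of_real (hermite_norm (\<alpha> $ j) * hermite_norm (\<beta> $ j))"
        unfolding hermite_fun1_eq by (simp add: mult_ac flip: \<open>_ = gexp 1 0 _\<close>)
    qed simp
    finally show ?thesis .
  qed
  have o: "(LINT t|lborel. poly (hpoly j) (of_real t) * poly (hpoly k) (of_real t) * gexp 1 0 t / of_real (hermite_norm j * hermite_norm k))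
     = (if j = k then 1 else 0)" for j k
    unfolding integral_divide_zero hpoly_orthogonal using hermite_norm_pos[of k]
    by (auto simp: hermite_norm_def power2_eq_square[symmetric] simp flip: of_real_mult)
  have "(LINT x|lborel. hermite_fun \<alpha> x * cnj (hermite_fun \<beta> x)) = (\<Prod>j\<in>UNIV. if \<alpha> $ j = \<beta> $ j then 1 else 0)"
    unfolding e
  proof (subst integral_vec_prod)
    show "integrable lborel (\<lambda>t. poly (hpoly (\<alpha> $ j)) (of_real t) * poly (hpoly (\<beta> $ j)) (of_real t) * gexp 1 0 t
         / of_real (hermite_norm (\<alpha> $ j) * hermite_norm (\<beta> $ j)))" for j
      using poly_gexp_integrable[of 1 "hpoly (\<alpha> $ j) * hpoly (\<beta> $ j)" 0] by simp
  qed (simp only: o)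
  also have "\<dots> = (if \<alpha> = \<beta> then 1 else 0)"
    by (auto simp: vec_eq_iff)
  finally show ?thesis .
qed

definition multi_degree :: "nat ^ 'n \<Rightarrow> nat" where
  "multi_degree \<alpha> = (\<Sum>j\<in>UNIV. \<alpha> $ j)"

lemma hermite_fun_fourier_borel:
  assumes e: "\<epsilon>\<^sup>2 = (1::real)"
  shows "(LINT x|lborel. exp (\<i> * of_real (\<epsilon> * (x \<bullet> y))) * hermite_fun \<alpha> x)
    = of_real ((2 * pi) powr (real CARD('n) / 2)) * (\<i> * of_real \<epsilon>) ^ multi_degree \<alpha> * hermite_fun \<alpha> (y :: real ^ 'n)"
proof -
  have eq: "exp (\<i> * of_real (\<epsilon> * (x \<bullet> y))) * hermite_fun \<alpha> x
     = (\<Prod>j\<in>UNIV. poly (hpoly (\<alpha> $ j)) (of_real (x $ j)) * gexp (1/2) (\<i> * of_real (\<epsilon> * y $ j)) (x $ j) / of_real (hermite_norm (\<alpha> $ j)))" for x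
  proof -
    have "exp (\<i> * of_real (\<epsilon> * (x \<bullet> y))) = (\<Prod>j\<in>UNIV. exp ((\<i> * of_real (\<epsilon> * y $ j)) * of_real (x $ j)))"
      by (simp add: inner_vec_def sum_distrib_left exp_sum[symmetric] mult_ac)
    then have "exp (\<i> * of_real (\<epsilon> * (x \<bullet> y))) * hermite_fun \<alpha> x
      = hermite_fun \<alpha> x * (\<Prod>j\<in>UNIV. exp ((\<i> * of_real (\<epsilon> * y $ j)) * of_real (x $ j)))" by simp
    also note hermite_fun_prod
    finally show ?thesis unfolding hermite_fun1_exp .
  qed
  have "(LINT x|lborel. exp (\<i> * of_real (\<epsilon> * (x \<bullet> y))) * hermite_fun \<alpha> x)
    = (\<Prod>j\<in>UNIV. (\<i> * of_real \<epsilon>) ^ (\<alpha> $ j) * of_real (sqrt (2 * pi)) * (poly (hpoly (\<alpha> $ j)) (of_real (y $ j)) * exp (- (of_real (y $ j))\<^sup>2 / 2) / of_real (hermite_norm (\<alpha> $ j))))"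
    unfolding eq
    by (subst integral_vec_prod)
       (auto intro!: integrable_divide_zero poly_gexp_integrable simp only: integral_divide_zero hpoly_fourier_integral[OF e] mult.assoc times_divide_eq_right)
  also have "\<dots> = (\<i> * of_real \<epsilon>) ^ multi_degree \<alpha> * of_real (sqrt (2 * pi)) ^ CARD('n) * hermite_fun \<alpha> y"
    unfolding hermite_fun1_eq'[symmetric] hermite_fun_def of_real_prod
    by (simp add: prod.distrib power_sum multi_degree_def)
  also have "sqrt (2 * pi) ^ CARD('n) = (2 * pi) powr (real CARD('n) / 2)"
    by (simp add: powr_half_sqrt[symmetric] powr_powr powr_realpow[symmetric])
  then have "complex_of_real (sqrt (2 * pi)) ^ CARD('n) = of_real ((2 * pi) powr (real CARD('n) / 2))"
    by (metis of_real_power)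
  finally show ?thesis by simp
qed

definition fock_monomial :: "nat ^ 'n \<Rightarrow> complex ^ 'n \<Rightarrow> complex" where
  "fock_monomial \<alpha> z = (\<Prod>j\<in>UNIV. (z $ j) ^ (\<alpha> $ j) / of_real (sqrt (2 ^ (\<alpha> $ j) * fact (\<alpha> $ j))))"

lemma bargmann_borel:
  assumes [measurable]: "f \<in> borel_measurable borel"
  shows "bargmann f z =
     complex_of_real (pi powr (- real CARD('n) / 4)) * exp (- cdot z z / 4)
     * (LINT u|lborel. f u * gaussian u * exp (cdot (cvec u) (z :: complex ^ 'n)))"
  unfolding bargmann_def by (subst integral_completion) auto

text \<open>The Bargmann transform factorizes over the coordinates, and in one variable
  \<open>hpoly_bargmann_integral\<close> applies.\<close>

lemma bargmann_hermite_fun: "bargmann (hermite_fun \<alpha>) z = fock_monomial \<alpha> (z :: complex ^ 'n)"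
proof -
  have eq: "hermite_fun \<alpha> u * gaussian u * exp (cdot (cvec u) z)
    = (\<Prod>j\<in>UNIV. poly (hpoly (\<alpha> $ j)) (of_real (u $ j)) * gexp 1 (z $ j) (u $ j) / of_real (hermite_norm (\<alpha> $ j)))" for u
    unfolding exp_cdot_cvec exp_gauss_vec mult.assoc prod.distrib[symmetric] hermite_fun_prod hermite_fun1_gauss_exp ..
  have "(LINT u|lborel. hermite_fun \<alpha> u * gaussian u * exp (cdot (cvec u) z))
    = (\<Prod>j\<in>UNIV. (z $ j) ^ (\<alpha> $ j) * (of_real (sqrt pi) * exp ((z $ j)\<^sup>2 / 4)) / of_real (hermite_norm (\<alpha> $ j)))"
    unfolding eq
    by (subst integral_vec_prod)
       (auto intro!: integrable_divide_zero poly_gexp_integrable simp only: integral_divide_zero hpoly_bargmann_integral)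
  also have "\<dots> = fock_monomial \<alpha> z * of_real (pi powr (1/4)) ^ CARD('n) * exp (cdot z z / 4)"
  proof -
    have h: "hermite_norm k = sqrt (2 ^ k * fact k) * pi powr (1/4)" for k
      by (simp add: hermite_norm_def real_sqrt_mult powr_half_sqrt[symmetric] powr_powr)
    have p: "sqrt pi = pi powr (1/4) * pi powr (1/4)"
      by (simp add: powr_add[symmetric] powr_half_sqrt)
    have "(z $ j) ^ (\<alpha> $ j) * (of_real (sqrt pi) * exp ((z $ j)\<^sup>2 / 4)) / of_real (hermite_norm (\<alpha> $ j))
      = (z $ j) ^ (\<alpha> $ j) / of_real (sqrt (2 ^ (\<alpha> $ j) * fact (\<alpha> $ j))) * of_real (pi powr (1/4)) * exp ((z $ j)\<^sup>2 / 4)" for j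
      unfolding h p by simp
    then show ?thesis
      by (simp only: prod.distrib fock_monomial_def prod_constant cdot_def)
         (simp add: exp_sum[symmetric] sum_divide_distrib power2_eq_square)
  qed
  also have "complex_of_real (pi powr (1/4)) ^ CARD('n) = of_real (pi powr (real CARD('n) / 4))"
    by (simp add: powr_powr powr_realpow[symmetric] flip: of_real_power)
  finally show ?thesis
    by (simp add: bargmann_borel powr_minus field_simps exp_minus flip: of_real_mult)
qed


section \<open>The space \<open>L\<^sup>2\<close> and its completeness\<close>

lemma L2_measurable: "f \<in> L2 \<Longrightarrow> f \<in> borel_measurable lebesgue"
  by (simp add: L2_def)

lemma L2_sq_integrable: "f \<in> L2 \<Longrightarrow> integrable lebesgue (\<lambda>x. (cmod (f x))\<^sup>2)"
  by (simp add: L2_def)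

lemma L2_I: "f \<in> borel_measurable lebesgue \<Longrightarrow> integrable lebesgue (\<lambda>x. (cmod (f x))\<^sup>2) \<Longrightarrow> f \<in> L2"
  by (simp add: L2_def)

lemma L2_dominated:
  assumes "f \<in> borel_measurable lebesgue" "integrable lebesgue g" "AE x in lebesgue. (cmod (f x))\<^sup>2 \<le> g x"
  shows "f \<in> L2"
proof (rule L2_I[OF assms(1)])
  show "integrable lebesgue (\<lambda>x. (cmod (f x))\<^sup>2)"
    by (rule Bochner_Integration.integrable_bound[OF assms(2)])
       (use assms in \<open>auto elim!: eventually_mono\<close>)
qed

lemma L2_add [intro]: assumes "f \<in> L2" "g \<in> L2" shows "(\<lambda>x. f x + g x) \<in> L2"
proof (rule L2_dominated)
  have [measurable]: "f \<in> borel_measurable lebesgue" "g \<in> borel_measurable lebesgue"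
    using assms by (auto intro: L2_measurable)
  show "(\<lambda>x. f x + g x) \<in> borel_measurable lebesgue" by measurable
  show "integrable lebesgue (\<lambda>x. 2 * (cmod (f x))\<^sup>2 + 2 * (cmod (g x))\<^sup>2)"
    using assms by (auto intro!: Bochner_Integration.integrable_add simp: L2_sq_integrable)
  show "AE x in lebesgue. (cmod (f x + g x))\<^sup>2 \<le> 2 * (cmod (f x))\<^sup>2 + 2 * (cmod (g x))\<^sup>2"
  proof (rule AE_I2)
    fix x
    have "(cmod (f x + g x))\<^sup>2 \<le> (cmod (f x) + cmod (g x))\<^sup>2"
      by (intro power_mono norm_triangle_ineq) auto
    also have "\<dots> \<le> 2 * (cmod (f x))\<^sup>2 + 2 * (cmod (g x))\<^sup>2"
      using sum_squares_bound[of "cmod (f x)" "cmod (g x)"] by (simp add: power2_sum)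
    finally show "(cmod (f x + g x))\<^sup>2 \<le> 2 * (cmod (f x))\<^sup>2 + 2 * (cmod (g x))\<^sup>2" .
  qed
qed

lemma L2_cmult [intro]: assumes "f \<in> L2" shows "(\<lambda>x. c * f x) \<in> L2"
proof (rule L2_I)
  have [measurable]: "f \<in> borel_measurable lebesgue" using assms by (rule L2_measurable)
  show "(\<lambda>x. c * f x) \<in> borel_measurable lebesgue" by measurable
  show "integrable lebesgue (\<lambda>x. (cmod (c * f x))\<^sup>2)"
    using assms by (simp add: norm_mult power_mult_distrib L2_sq_integrable)
qed

lemma L2_zero [intro, simp]: "(\<lambda>x. 0) \<in> L2"
  by (simp add: L2_def)

lemma L2_diff [intro]: assumes "f \<in> L2" "g \<in> L2" shows "(\<lambda>x. f x - g x) \<in> L2"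
  using L2_add[OF assms(1) L2_cmult[OF assms(2), of "-1"]] by simp

lemma L2_sum [intro]: "(\<And>i. i \<in> I \<Longrightarrow> f i \<in> L2) \<Longrightarrow> (\<lambda>x. \<Sum>i\<in>I. f i x) \<in> L2"
  by (induction I rule: infinite_finite_induct) auto

lemma L2_mult_bounded:
  assumes f: "f \<in> L2" and g: "g \<in> borel_measurable lebesgue" and b: "\<And>x. cmod (g x) \<le> C"
  shows "(\<lambda>x. g x * f x) \<in> L2"
proof (rule L2_dominated[where g="\<lambda>x. C\<^sup>2 * (cmod (f x))\<^sup>2"])
  show "(\<lambda>x. g x * f x) \<in> borel_measurable lebesgue" using g L2_measurable[OF f] by measurable
  show "integrable lebesgue (\<lambda>x. C\<^sup>2 * (cmod (f x))\<^sup>2)" using f by (simp add: L2_sq_integrable)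
  show "AE x in lebesgue. (cmod (g x * f x))\<^sup>2 \<le> C\<^sup>2 * (cmod (f x))\<^sup>2"
    using b by (auto simp: norm_mult power_mult_distrib intro!: mult_right_mono power_mono)
qed

lemma L2_cong_AE:
  assumes "f \<in> L2" "AE x in lebesgue. f x = g x" shows "g \<in> L2"
proof (rule L2_dominated)
  have f: "f \<in> borel_measurable lebesgue" using assms by (auto intro: L2_measurable)
  show "g \<in> borel_measurable lebesgue"
    using f assms(2) by (rule borel_measurable_AE)
  show "integrable lebesgue (\<lambda>x. (cmod (f x))\<^sup>2)" using assms by (simp add: L2_sq_integrable)
  show "AE x in lebesgue. (cmod (g x))\<^sup>2 \<le> (cmod (f x))\<^sup>2" using assms(2) by eventually_elim simp
qed

lemma L2_mult_integrable:
  assumes "f \<in> L2" "g \<in> L2" shows "integrable lebesgue (\<lambda>x. f x * g x)"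
proof (rule Bochner_Integration.integrable_bound)
  have [measurable]: "f \<in> borel_measurable lebesgue" "g \<in> borel_measurable lebesgue"
    using assms by (auto intro: L2_measurable)
  show "(\<lambda>x. f x * g x) \<in> borel_measurable lebesgue" by measurable
  show "integrable lebesgue (\<lambda>x. (cmod (f x))\<^sup>2 + (cmod (g x))\<^sup>2)"
    using assms by (auto simp: L2_sq_integrable)
  have "cmod (f x) * cmod (g x) \<le> (cmod (f x))\<^sup>2 + (cmod (g x))\<^sup>2" for x
    using sum_squares_bound[of "cmod (f x)" "cmod (g x)"] by (auto intro: order_trans[rotated])
  then show "AE x in lebesgue. norm (f x * g x) \<le> norm ((cmod (f x))\<^sup>2 + (cmod (g x))\<^sup>2)"
    by (auto simp: norm_mult)
qed

lemma measurable_cnj [measurable (raw)]: "f \<in> borel_measurable M \<Longrightarrow> (\<lambda>x. cnj (f x)) \<in> borel_measurable M"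
  by (rule measurable_compose[OF _ borel_measurable_continuous_onI]) (auto intro: continuous_intros)

lemma L2_cnj: "f \<in> L2 \<Longrightarrow> (\<lambda>x. cnj (f x)) \<in> L2"
  by (auto simp: L2_def)

lemma L2_inner_integrable: "f \<in> L2 \<Longrightarrow> g \<in> L2 \<Longrightarrow> integrable lebesgue (\<lambda>x. f x * cnj (g x))"
  by (intro L2_mult_integrable L2_cnj)

lemma l2_norm_nonneg [simp]: "l2_norm f \<ge> 0"
  by (simp add: l2_norm_def)

lemma l2_norm_sq: "(l2_norm f)\<^sup>2 = (LINT x|lebesgue. (cmod (f x))\<^sup>2)"
  by (simp add: l2_norm_def)

lemma l2_norm_cong_AE:
  assumes "f \<in> L2" "AE x in lebesgue. f x = g x" shows "l2_norm f = l2_norm g"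
proof -
  have [measurable]: "f \<in> borel_measurable lebesgue" "g \<in> borel_measurable lebesgue"
    using assms L2_cong_AE by (auto intro: L2_measurable)
  show ?thesis unfolding l2_norm_def
    by (intro arg_cong[where f=sqrt] integral_cong_AE) (use assms(2) in \<open>auto elim!: eventually_mono\<close>)
qed

lemma l2_inner_cong_AE:
  assumes "f \<in> L2" "h \<in> L2" "AE x in lebesgue. f x = g x" shows "l2_inner f h = l2_inner g h"
proof -
  have [measurable]: "f \<in> borel_measurable lebesgue" "g \<in> borel_measurable lebesgue" "h \<in> borel_measurable lebesgue"
    using assms L2_cong_AE by (auto intro: L2_measurable)
  show ?thesis unfolding l2_inner_def
    by (intro integral_cong_AE) (use assms(3) in \<open>auto elim!: eventually_mono\<close>)
qed

lemma l2_inner_self: "f \<in> L2 \<Longrightarrow> l2_inner f f = of_real ((l2_norm f)\<^sup>2)"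
  unfolding l2_norm_sq l2_inner_def by (simp add: complex_norm_square[symmetric] flip: of_real_power)

lemma l2_inner_commute: "l2_inner g f = cnj (l2_inner f g)"
  unfolding l2_inner_def Bochner_Integration.integral_cnj[symmetric] by (simp add: mult.commute)

lemma l2_inner_add_left: "f \<in> L2 \<Longrightarrow> g \<in> L2 \<Longrightarrow> h \<in> L2 \<Longrightarrow> l2_inner (\<lambda>x. f x + g x) h = l2_inner f h + l2_inner g h"
  by (simp add: l2_inner_def distrib_right L2_inner_integrable)

lemma l2_inner_diff_left: "f \<in> L2 \<Longrightarrow> g \<in> L2 \<Longrightarrow> h \<in> L2 \<Longrightarrow> l2_inner (\<lambda>x. f x - g x) h = l2_inner f h - l2_inner g h"
  by (simp add: l2_inner_def left_diff_distrib L2_inner_integrable)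

lemma l2_inner_cmult_left: "l2_inner (\<lambda>x. c * f x) h = c * l2_inner f h"
  by (simp add: l2_inner_def mult.assoc)

lemma l2_inner_sum_left:
  "(\<And>i. i \<in> I \<Longrightarrow> f i \<in> L2) \<Longrightarrow> h \<in> L2 \<Longrightarrow> l2_inner (\<lambda>x. \<Sum>i\<in>I. f i x) h = (\<Sum>i\<in>I. l2_inner (f i) h)"
  by (simp add: l2_inner_def sum_distrib_right L2_inner_integrable)

text \<open>The quadratic polynomial \<open>t \<mapsto> \<integral> (|f| - t |g|)\<^sup>2\<close> is nonnegative.\<close>

lemma L2_Cauchy_Schwarz:
  assumes f: "f \<in> L2" and g: "g \<in> L2"
  shows "(LINT x|lebesgue. cmod (f x * g x)) \<le> l2_norm f * l2_norm g"
proof -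
  define A B C where "A = (LINT x|lebesgue. (cmod (f x))\<^sup>2)" and "B = (LINT x|lebesgue. (cmod (g x))\<^sup>2)"
    and "C = (LINT x|lebesgue. cmod (f x * g x))"
  have i: "integrable lebesgue (\<lambda>x. (cmod (f x))\<^sup>2)" "integrable lebesgue (\<lambda>x. (cmod (g x))\<^sup>2)"
    "integrable lebesgue (\<lambda>x. cmod (f x * g x))"
    using f g L2_mult_integrable[OF f g] by (auto simp: L2_sq_integrable)
  have q: "0 \<le> A - 2 * t * C + t\<^sup>2 * B" for t
  proof -
    have "0 \<le> (LINT x|lebesgue. (cmod (f x) - t * cmod (g x))\<^sup>2)" by simp
    also have "\<dots> = (LINT x|lebesgue. (cmod (f x))\<^sup>2 - 2 * t * cmod (f x * g x) + t\<^sup>2 * (cmod (g x))\<^sup>2)"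
      by (intro Bochner_Integration.integral_cong) (auto simp: power2_eq_square norm_mult algebra_simps)
    also have "\<dots> = A - 2 * t * C + t\<^sup>2 * B"
      using i by (simp add: A_def B_def C_def)
    finally show ?thesis .
  qed
  have C: "C \<ge> 0" and B: "B \<ge> 0" and A: "A \<ge> 0" by (auto simp: C_def B_def A_def)
  have "C\<^sup>2 \<le> A * B"
  proof (cases "B = 0")
    case True
    show ?thesis
    proof (cases "C = 0")
      case False
      then have "0 \<le> A - 2 * ((A + 1) / (2 * C)) * C" using q[of "(A + 1) / (2 * C)"] True by simp
      then show ?thesis using False by simp
    qed (use A B in simp)
  next
    case False
    then show ?thesis using q[of "C / B"] B by (simp add: power2_eq_square field_simps)
  qed
  then have "C \<le> sqrt A * sqrt B"
    using C by (metis real_le_rsqrt real_sqrt_mult)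
  then show ?thesis by (simp add: A_def B_def C_def l2_norm_def)
qed

lemma l2_inner_Cauchy_Schwarz: "f \<in> L2 \<Longrightarrow> g \<in> L2 \<Longrightarrow> cmod (l2_inner f g) \<le> l2_norm f * l2_norm g"
  using L2_Cauchy_Schwarz[of f "\<lambda>x. cnj (g x)"] integral_norm_bound[of lebesgue "\<lambda>x. f x * cnj (g x)"]
  by (auto simp: L2_cnj l2_inner_def l2_norm_def norm_mult)

lemma l2_norm_triangle:
  assumes f: "f \<in> L2" and g: "g \<in> L2"
  shows "l2_norm (\<lambda>x. f x + g x) \<le> l2_norm f + l2_norm g"
proof (rule power2_le_imp_le)
  have i: "integrable lebesgue (\<lambda>x. (cmod (f x))\<^sup>2)" "integrable lebesgue (\<lambda>x. (cmod (g x))\<^sup>2)"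
    "integrable lebesgue (\<lambda>x. cmod (f x * g x))" "integrable lebesgue (\<lambda>x. (cmod (f x + g x))\<^sup>2)"
    using f g L2_mult_integrable[OF f g] L2_add[OF f g] by (auto simp: L2_sq_integrable)
  have "(l2_norm (\<lambda>x. f x + g x))\<^sup>2 \<le> (LINT x|lebesgue. (cmod (f x))\<^sup>2 + 2 * cmod (f x * g x) + (cmod (g x))\<^sup>2)"
    unfolding l2_norm_sq
  proof (rule integral_mono)
    fix x
    have "(cmod (f x + g x))\<^sup>2 \<le> (cmod (f x) + cmod (g x))\<^sup>2"
      by (intro power_mono norm_triangle_ineq) auto
    then show "(cmod (f x + g x))\<^sup>2 \<le> (cmod (f x))\<^sup>2 + 2 * cmod (f x * g x) + (cmod (g x))\<^sup>2"
      by (simp add: power2_sum norm_mult)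
  qed (use i in auto)
  also have "\<dots> = (l2_norm f)\<^sup>2 + 2 * (LINT x|lebesgue. cmod (f x * g x)) + (l2_norm g)\<^sup>2"
    using i by (simp add: l2_norm_sq)
  also have "\<dots> \<le> (l2_norm f + l2_norm g)\<^sup>2"
    using L2_Cauchy_Schwarz[OF f g] by (simp add: power2_sum)
  finally show "(l2_norm (\<lambda>x. f x + g x))\<^sup>2 \<le> (l2_norm f + l2_norm g)\<^sup>2" .
qed simp

lemma l2_norm_minus_commute: "l2_norm (\<lambda>x. f x - g x) = l2_norm (\<lambda>x. g x - f x)"
  by (simp add: l2_norm_def norm_minus_commute)

lemma l2_norm_diff_triangle:
  assumes "f \<in> L2" "g \<in> L2" "h \<in> L2"
  shows "l2_norm (\<lambda>x. f x - h x) \<le> l2_norm (\<lambda>x. f x - g x) + l2_norm (\<lambda>x. g x - h x)"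
  using l2_norm_triangle[OF L2_diff[OF assms(1,2)] L2_diff[OF assms(2,3)]] by simp

lemma L2_iff_nn:
  assumes [measurable]: "f \<in> borel_measurable lebesgue"
  shows "f \<in> L2 \<longleftrightarrow> (\<integral>\<^sup>+x. ennreal ((cmod (f x))\<^sup>2) \<partial>lebesgue) < \<infinity>"
  unfolding L2_def by (auto simp: integrable_iff_bounded)

lemma l2_norm_nn: "f \<in> L2 \<Longrightarrow> (\<integral>\<^sup>+x. ennreal ((cmod (f x))\<^sup>2) \<partial>lebesgue) = ennreal ((l2_norm f)\<^sup>2)"
  unfolding l2_norm_sq by (intro nn_integral_eq_integral L2_sq_integrable) auto

lemma L2_le_nn:
  assumes [measurable]: "f \<in> borel_measurable lebesgue" and C: "C \<ge> 0"
    and le: "(\<integral>\<^sup>+x. ennreal ((cmod (f x))\<^sup>2) \<partial>lebesgue) \<le> ennreal (C\<^sup>2)"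
  shows "f \<in> L2" "l2_norm f \<le> C"
proof -
  show "f \<in> L2" unfolding L2_iff_nn[OF assms(1)] using le by (simp add: order_le_less_trans)
  from l2_norm_nn[OF this] le have "(l2_norm f)\<^sup>2 \<le> C\<^sup>2" by simp
  then show "l2_norm f \<le> C" using C by (rule power2_le_imp_le)
qed

text \<open>The sum of \<open>4\<^sup>n |F\<^sub>n\<^sub>+\<^sub>1 - F\<^sub>n|\<^sup>2\<close> has finite integral, so almost everywhere the increments are
  dominated by a geometric sequence and the sequence converges. Fatou's lemma shows that the pointwise
  limit is also the limit in the mean.\<close>

lemma L2_Riesz_Fischer:
  assumes F: "\<And>n::nat. F n \<in> L2"
    and C: "\<And>n. l2_norm (\<lambda>x. F (Suc n) x - F n x) \<le> (1/4) ^ n"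
  obtains f where "f \<in> L2" "(\<lambda>n. l2_norm (\<lambda>x. F n x - f x)) \<longlonglongrightarrow> 0"
proof -
  have [measurable]: "F n \<in> borel_measurable lebesgue" for n using F by (rule L2_measurable)
  \<comment> \<open>The factor \<open>4 ^ n\<close> still leaves a convergent sum, since the integrals decay like \<open>16 ^ (- n)\<close>.\<close>
  define D where "D n x = 4 ^ n * (cmod (F (Suc n) x - F n x))\<^sup>2" for n x
  have [measurable]: "D n \<in> borel_measurable lebesgue" for n unfolding D_def by measurable
  have "(\<integral>\<^sup>+x. (\<Sum>n. ennreal (D n x)) \<partial>lebesgue) = (\<Sum>n. \<integral>\<^sup>+x. ennreal (D n x) \<partial>lebesgue)"
    by (rule nn_integral_suminf) measurable
  also have "\<dots> \<le> (\<Sum>n. ennreal ((1/4) ^ n))"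
  proof (intro suminf_le summableI)
    fix n
    have "(\<integral>\<^sup>+x. ennreal (D n x) \<partial>lebesgue) = ennreal (4 ^ n) * (\<integral>\<^sup>+x. ennreal ((cmod (F (Suc n) x - F n x))\<^sup>2) \<partial>lebesgue)"
      unfolding D_def by (subst nn_integral_cmult[symmetric]) (auto simp: ennreal_mult)
    also have "\<dots> = ennreal (4 ^ n * (l2_norm (\<lambda>x. F (Suc n) x - F n x))\<^sup>2)"
      by (subst l2_norm_nn) (use F in \<open>auto simp: ennreal_mult\<close>)
    also have "\<dots> \<le> ennreal (4 ^ n * ((1/4) ^ n)\<^sup>2)"
      using C[of n] by (intro ennreal_leI mult_left_mono power_mono) auto
    also have "4 ^ n * ((1/4) ^ n)\<^sup>2 = (1/4::real) ^ n"
      by (simp add: power2_eq_square power_divide)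
    finally show "(\<integral>\<^sup>+x. ennreal (D n x) \<partial>lebesgue) \<le> ennreal ((1/4) ^ n)" .
  qed
  also have "\<dots> = ennreal (\<Sum>n. (1/4) ^ n)"
    by (intro suminf_ennreal2) auto
  finally have "(\<integral>\<^sup>+x. (\<Sum>n. ennreal (D n x)) \<partial>lebesgue) \<noteq> \<infinity>" by (auto simp: top_unique)
  then have "AE x in lebesgue. (\<Sum>n. ennreal (D n x)) \<noteq> \<infinity>"
    by (intro nn_integral_PInf_AE) measurable
  then have conv: "AE x in lebesgue. convergent (\<lambda>n. F n x)"
  proof eventually_elim
    case (elim x)
    then obtain K where K: "K \<ge> 0" "(\<Sum>n. ennreal (D n x)) = ennreal K"
      by (cases "\<Sum>n. ennreal (D n x)") auto
    have "D n x \<le> K" for n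
    proof -
      have "ennreal (D n x) \<le> (\<Sum>n. ennreal (D n x))"
        using sum_le_suminf[of "\<lambda>n. ennreal (D n x)" "{n}"] by simp
      then show ?thesis using K by (simp add: D_def)
    qed
    then have b: "cmod (F (Suc n) x - F n x) \<le> sqrt K * (1/2) ^ n" for n
    proof -
      have "(2 ^ n * cmod (F (Suc n) x - F n x))\<^sup>2 \<le> K"
        using \<open>D n x \<le> K\<close> by (simp add: D_def power_mult_distrib power2_eq_square[of "2 ^ n"] flip: power_mult_distrib[of 2 2])
      then have "2 ^ n * cmod (F (Suc n) x - F n x) \<le> sqrt K" by (rule real_le_rsqrt)
      then show ?thesis by (simp add: field_simps power_divide)
    qed
    have "summable (\<lambda>n. F (Suc n) x - F n x)"
      by (rule summable_comparison_test'[of "\<lambda>n. sqrt K * (1/2) ^ n"]) (use b in auto)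
    then have "convergent (\<lambda>n. (\<Sum>i<n. F (Suc i) x - F i x) + F 0 x)"
      by (intro convergent_add convergent_const) (simp add: summable_iff_convergent)
    moreover have "(\<lambda>n. (\<Sum>i<n. F (Suc i) x - F i x) + F 0 x) = (\<lambda>n. F n x)"
      using sum_lessThan_telescope[of "\<lambda>i. F i x"] by (simp add: fun_eq_iff)
    ultimately show ?case by simp
  qed
  define f where "f x = lim (\<lambda>n. F n x)" for x
  have [measurable]: "f \<in> borel_measurable lebesgue" unfolding f_def by (rule borel_measurable_lim_metric) measurable
  have fl: "AE x in lebesgue. (\<lambda>n. F n x) \<longlonglongrightarrow> f x"
    using conv by eventually_elim (simp add: f_def convergent_LIMSEQ_iff)
  have dist: "l2_norm (\<lambda>x. F (n + k) x - F n x) \<le> 4 / 3 * ((1/4) ^ n - (1/4) ^ (n + k))" for n k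
  proof (induction k)
    case 0
    then show ?case by (simp add: l2_norm_def)
  next
    case (Suc k)
    have "l2_norm (\<lambda>x. F (n + Suc k) x - F n x) \<le> l2_norm (\<lambda>x. F (Suc (n + k)) x - F (n + k) x) + l2_norm (\<lambda>x. F (n + k) x - F n x)"
      using l2_norm_diff_triangle[OF F[of "Suc (n + k)"] F[of "n + k"] F[of n]] by simp
    also have "\<dots> \<le> (1/4) ^ (n + k) + 4 / 3 * ((1/4) ^ n - (1/4) ^ (n + k))"
      by (intro add_mono C Suc)
    also have "\<dots> = 4 / 3 * ((1/4) ^ n - (1/4) ^ (n + Suc k))" by (simp add: algebra_simps)
    finally show ?case .
  qed
  have d: "l2_norm (\<lambda>x. F m x - F n x) \<le> 2 * (1/4) ^ n" if "m \<ge> n" for m n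
  proof -
    have "l2_norm (\<lambda>x. F m x - F n x) \<le> 4 / 3 * ((1/4) ^ n - (1/4) ^ m)"
      using dist[of n "m - n"] that by simp
    also have "\<dots> \<le> 4 / 3 * (1/4) ^ n" by simp
    also have "\<dots> \<le> 2 * (1/4) ^ n" by (intro mult_right_mono) auto
    finally show ?thesis .
  qed
  have lim: "(\<lambda>x. f x - F n x) \<in> L2" "l2_norm (\<lambda>x. f x - F n x) \<le> 2 * (1/4) ^ n" for n
  proof -
    have "(\<integral>\<^sup>+x. ennreal ((cmod (f x - F n x))\<^sup>2) \<partial>lebesgue)
        = (\<integral>\<^sup>+x. liminf (\<lambda>m. ennreal ((cmod (F m x - F n x))\<^sup>2)) \<partial>lebesgue)"
    proof (rule nn_integral_cong_AE)
      show "AE x in lebesgue. ennreal ((cmod (f x - F n x))\<^sup>2) = liminf (\<lambda>m. ennreal ((cmod (F m x - F n x))\<^sup>2))"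
        using fl
      proof eventually_elim
        case (elim x)
        have "(\<lambda>m. ennreal ((cmod (F m x - F n x))\<^sup>2)) \<longlonglongrightarrow> ennreal ((cmod (f x - F n x))\<^sup>2)"
          by (intro tendsto_ennrealI tendsto_intros elim)
        then show ?case by (rule lim_imp_Liminf[OF sequentially_bot, symmetric])
      qed
    qed
    also have "\<dots> \<le> liminf (\<lambda>m. \<integral>\<^sup>+x. ennreal ((cmod (F m x - F n x))\<^sup>2) \<partial>lebesgue)"
      by (rule nn_integral_liminf) measurable
    also have "\<dots> \<le> liminf (\<lambda>m. ennreal ((2 * (1/4) ^ n)\<^sup>2))"
    proof (rule Liminf_mono)
      show "\<forall>\<^sub>F m in sequentially. (\<integral>\<^sup>+x. ennreal ((cmod (F m x - F n x))\<^sup>2) \<partial>lebesgue) \<le> ennreal ((2 * (1/4) ^ n)\<^sup>2)"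
        using eventually_ge_at_top[of n]
      proof eventually_elim
        case (elim m)
        show ?case
          unfolding l2_norm_nn[OF L2_diff[OF F[of m] F[of n]]]
          by (intro ennreal_leI power_mono d[OF elim]) auto
      qed
    qed
    also have "\<dots> = ennreal ((2 * (1/4) ^ n)\<^sup>2)"
      by (rule Liminf_const) simp
    finally have le: "(\<integral>\<^sup>+x. ennreal ((cmod (f x - F n x))\<^sup>2) \<partial>lebesgue) \<le> ennreal ((2 * (1/4) ^ n)\<^sup>2)" .
    show "(\<lambda>x. f x - F n x) \<in> L2" "l2_norm (\<lambda>x. f x - F n x) \<le> 2 * (1/4) ^ n"
      by (rule L2_le_nn[OF _ _ le]; simp)+
  qed
  show ?thesis
  proof
    show "f \<in> L2" using L2_add[OF lim(1)[of 0] F[of 0]] by simp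
    show "(\<lambda>n. l2_norm (\<lambda>x. F n x - f x)) \<longlonglongrightarrow> 0"
    proof (rule Lim_null_comparison)
      show "\<forall>\<^sub>F n in sequentially. norm (l2_norm (\<lambda>x. F n x - f x)) \<le> 2 * (1/4) ^ n"
        using lim(2) by (subst l2_norm_minus_commute) simp
      show "(\<lambda>n. 2 * (1/4::real) ^ n) \<longlonglongrightarrow> 0" by (intro tendsto_eq_intros LIMSEQ_power_zero) auto
    qed
  qed
qed


section \<open>Completeness of the Hermite functions and Parseval identity\<close>

inductive hspan :: "complex poly \<Rightarrow> bool" where
  hspan_base: "hspan (hpoly k)"
| hspan_add: "hspan p \<Longrightarrow> hspan q \<Longrightarrow> hspan (p + q)"
| hspan_smult: "hspan p \<Longrightarrow> hspan (smult c p)"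

text \<open>This uses the three-term recursion, read as an expression for \<open>X\<close> times a Hermite polynomial.\<close>

lemma hspan_times_X: "hspan p \<Longrightarrow> hspan ([:0, 1:] * p)"
proof (induction rule: hspan.induct)
  case (hspan_base k)
  have "[:0, 1:] * hpoly k = smult (1/2) (hpoly (Suc k) + smult (of_nat (2 * k)) (hpoly (k - 1) :: complex poly))"
    by (subst poly_eq_poly_eq_iff[symmetric])
       (auto simp: hpoly_Suc pderiv_hpoly[of k] fun_eq_iff algebra_simps simp del: hpoly.simps)
  then show ?case by (metis hspan.intros)
next
  case (hspan_add p q)
  then show ?case using hspan.hspan_add by (metis distrib_left)
next
  case (hspan_smult p c)
  then show ?case using hspan.hspan_smult by (metis mult_smult_right)
qed

lemma hspan_all: "hspan p"
proof (induction p)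
  case 0
  have "hspan (smult 0 (hpoly 0))" by (intro hspan.intros)
  then show ?case by simp
next
  case (pCons a p)
  have "pCons a p = smult a (hpoly 0) + [:0, 1:] * p" by simp
  then show ?case using pCons hspan_times_X hspan.intros by metis
qed

lemma poly_bound_exp:
  obtains C where "C \<ge> 0" "\<And>x::real. cmod (poly p (of_real x)) \<le> C * exp \<bar>x\<bar>"
proof
  let ?C = "\<Sum>i\<le>degree p. cmod (coeff p i) * fact i"
  show "?C \<ge> 0" by (intro sum_nonneg) auto
  fix x :: real
  have "cmod (poly p (of_real x)) \<le> (\<Sum>i\<le>degree p. cmod (coeff p i) * \<bar>x\<bar> ^ i)"
    unfolding poly_altdef by (intro sum_norm_le) (simp add: norm_mult norm_power)
  also have "\<dots> \<le> (\<Sum>i\<le>degree p. cmod (coeff p i) * (fact i * exp \<bar>x\<bar>))"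
    by (intro sum_mono mult_left_mono power_le_exp_abs) auto
  also have "\<dots> = ?C * exp \<bar>x\<bar>" by (simp add: sum_distrib_right mult.assoc)
  finally show "cmod (poly p (of_real x)) \<le> ?C * exp \<bar>x\<bar>" .
qed

lemma lebesgue_measurable_borel [measurable (raw)]:
  "f \<in> borel_measurable borel \<Longrightarrow> f \<in> borel_measurable (lebesgue :: 'a::euclidean_space measure)"
  by (rule measurable_completion) simp

lemma poly_vec_measurable [measurable]:
  "(\<lambda>x::real^'n. \<Prod>j\<in>UNIV. poly (p j) (complex_of_real (x $ j))) \<in> borel_measurable borel"
  unfolding poly_altdef by measurable

text \<open>Every polynomial is a combination of Hermite polynomials, one coordinate at a time, so \<open>h\<close> times
  the Gaussian is orthogonal to all products of polynomials in the single coordinates. The partial sums of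
  the exponential series are such polynomials, and the integrability hypothesis dominates them; so the
  Fourier transform of \<open>h\<close> times the Gaussian vanishes. The hypothesis is weaker than square
  integrability: the lemma is also applied to differences of a bounded function and an \<open>L\<^sup>2\<close>
  function.\<close>

lemma hermite_complete:
  fixes h :: "real ^ 'n \<Rightarrow> complex"
  assumes hm: "h \<in> borel_measurable lebesgue"
    and hi: "\<And>r. integrable lebesgue (\<lambda>x. h x * of_real (exp (- (norm x)\<^sup>2 / 2 + r * norm x)))"
    and orth: "\<And>\<alpha>. (LINT x|lebesgue. h x * hermite_fun \<alpha> x) = 0"
  shows "AE x in lebesgue. h x = 0"
proof -
  define g where "g x = h x * gaussian x" for x
  have gm [measurable]: "g \<in> borel_measurable lebesgue"
    unfolding g_def using hm by measurable
  have gr: "integrable lebesgue (\<lambda>x. g x * of_real (exp (r * norm x)))" for r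
    using hi[of r] by (simp only: g_def exp_add of_real_mult mult.assoc)
  have ai: "integrable lebesgue (\<lambda>x. g x * (\<Prod>j\<in>UNIV. poly (p j) (of_real (x $ j))))" for p
  proof -
    have "\<exists>C. C \<ge> 0 \<and> (\<forall>x::real. cmod (poly (p j) (of_real x)) \<le> C * exp \<bar>x\<bar>)" for j
      using poly_bound_exp[of "p j"] by metis
    then obtain C where C: "\<And>j. C j \<ge> 0" "\<And>j x. cmod (poly (p j) (of_real x)) \<le> C j * exp \<bar>x\<bar>"
      by metis
    have b: "cmod (\<Prod>j\<in>UNIV. poly (p j) (of_real (x $ j))) \<le> (\<Prod>j\<in>UNIV. C j) * exp (real CARD('n) * norm x)" for x :: "real ^ 'n"
    proof -
      have "cmod (\<Prod>j\<in>UNIV. poly (p j) (of_real (x $ j))) \<le> (\<Prod>j\<in>UNIV. C j * exp (norm x))"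
        unfolding prod_norm[symmetric]
      proof (rule prod_mono, safe)
        fix j
        have "cmod (poly (p j) (of_real (x $ j))) \<le> C j * exp \<bar>x $ j\<bar>" by (rule C)
        also have "\<dots> \<le> C j * exp (norm x)"
          by (intro mult_left_mono C) (simp add: component_le_norm_cart)
        finally show "cmod (poly (p j) (of_real (x $ j))) \<le> C j * exp (norm x)" .
      qed simp
      also have "\<dots> = (\<Prod>j\<in>UNIV. C j) * exp (real CARD('n) * norm x)"
        by (simp add: prod.distrib exp_of_nat_mult)
      finally show ?thesis .
    qed
    have P: "(\<Prod>j\<in>UNIV. C j) \<ge> 0" by (intro prod_nonneg) (use C in auto)
    show ?thesis
    proof (rule Bochner_Integration.integrable_bound)
      show "integrable lebesgue (\<lambda>x. (\<Prod>j\<in>UNIV. C j) * cmod (g x * of_real (exp (real CARD('n) * norm x))))"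
        using gr by (intro integrable_mult_right integrable_norm)
      show "(\<lambda>x. g x * (\<Prod>j\<in>UNIV. poly (p j) (of_real (x $ j)))) \<in> borel_measurable lebesgue"
        by measurable
      show "AE x in lebesgue. norm (g x * (\<Prod>j\<in>UNIV. poly (p j) (of_real (x $ j))))
          \<le> norm ((\<Prod>j\<in>UNIV. C j) * cmod (g x * of_real (exp (real CARD('n) * norm x))))"
      proof (rule AE_I2)
        fix x :: "real ^ 'n"
        have "cmod (g x) * cmod (\<Prod>j\<in>UNIV. poly (p j) (of_real (x $ j))) \<le> cmod (g x) * ((\<Prod>j\<in>UNIV. C j) * exp (real CARD('n) * norm x))"
          by (intro mult_left_mono b) auto
        then show "norm (g x * (\<Prod>j\<in>UNIV. poly (p j) (of_real (x $ j))))
          \<le> norm ((\<Prod>j\<in>UNIV. C j) * cmod (g x * of_real (exp (real CARD('n) * norm x))))"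
          using P by (simp add: norm_mult mult_ac)
      qed
    qed
  qed
  \<comment> \<open>Induction over the set of coordinates in which an arbitrary polynomial is allowed.\<close>
  have pz: "finite J \<Longrightarrow> (\<And>j. j \<notin> J \<Longrightarrow> \<exists>k. p j = hpoly k)
      \<Longrightarrow> (LINT x|lebesgue. g x * (\<Prod>j\<in>UNIV. poly (p j) (of_real (x $ j)))) = 0" for J and p :: "'n \<Rightarrow> complex poly"
  proof (induction J arbitrary: p rule: finite_induct)
    case empty
    then obtain a where a: "\<And>j. p j = hpoly (a j)" by (metis empty_iff)
    define \<alpha> where "\<alpha> = (\<chi> j. a j)"
    have "g x * (\<Prod>j\<in>UNIV. poly (p j) (of_real (x $ j))) = of_real (\<Prod>j\<in>UNIV. hermite_norm (a j)) * (h x * hermite_fun \<alpha> x)" for x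
    proof -
      have "of_real (hermite_norm (a j)) * of_real (hermite_fun1 (a j) (x $ j))
          = poly (hpoly (a j)) (of_real (x $ j)) * exp (- (complex_of_real (x $ j))\<^sup>2 / 2)" for j
        using hermite_norm_pos[of "a j"] by (simp add: hermite_fun1_eq')
      then have "of_real (\<Prod>j\<in>UNIV. hermite_norm (a j)) * hermite_fun \<alpha> x
         = (\<Prod>j\<in>UNIV. poly (hpoly (a j)) (of_real (x $ j)) * exp (- (complex_of_real (x $ j))\<^sup>2 / 2))"
        by (simp add: hermite_fun_def \<alpha>_def prod.distrib[symmetric])
      also have "\<dots> = (\<Prod>j\<in>UNIV. poly (p j) (of_real (x $ j))) * gaussian x"
        unfolding exp_gauss_vec by (simp add: a prod.distrib)
      finally show ?thesis by (simp add: g_def mult_ac)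
    qed
    then show ?case by (simp add: orth)
  next
    case (insert i J)
    have *: "(\<Prod>j\<in>UNIV. poly ((p(i := q)) j) (of_real (x $ j)))
       = poly q (of_real (x $ i)) * (\<Prod>j\<in>UNIV - {i}. poly (p j) (of_real (x $ j)))" for q and x :: "real ^ 'n"
      by (subst prod.remove[of _ i]) auto
    define I where "I q = (LINT x|lebesgue. g x * (\<Prod>j\<in>UNIV. poly ((p(i := q)) j) (of_real (x $ j))))" for q
    have "I q = 0" for q
      using hspan_all[of q]
    proof (induction rule: hspan.induct)
      case (hspan_base k)
      show ?case unfolding I_def
        by (rule insert.IH) (use insert.prems in auto)
    next
      case (hspan_add q r)
      have "I (q + r) = I q + I r"
        unfolding I_def
        by (subst Bochner_Integration.integral_add[symmetric, OF ai ai])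
           (unfold *, simp add: algebra_simps)
      then show ?case using hspan_add by simp
    next
      case (hspan_smult q c)
      have "I (smult c q) = c * I q"
        unfolding I_def
        by (subst integral_mult_right_zero[symmetric])
           (unfold *, simp add: algebra_simps)
      then show ?case using hspan_smult by simp
    qed
    from this[of "p i"] show ?case by (simp add: I_def)
  qed
  have "AE x in lebesgue. g x = 0"
  proof (rule fourier_injective_L1)
    show "integrable lebesgue g" using gr[of 0] by simp
    fix y :: "real ^ 'n"
    define p where "p N j = (\<Sum>k\<le>N. monom ((\<i> * of_real (y $ j)) ^ k / fact k) k)" for N :: nat and j
    have pp: "poly (p N j) w = (\<Sum>k\<le>N. (\<i> * of_real (y $ j) * w) ^ k / fact k)" for N j w
      by (simp add: p_def poly_sum poly_monom power_mult_distrib)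
    have lim: "(\<lambda>N. poly (p N j) w) \<longlonglongrightarrow> exp (\<i> * of_real (y $ j) * w)" for j w
      using exp_converges[of "\<i> * of_real (y $ j) * w"]
      unfolding pp sums_def_le by (simp add: scaleR_conv_of_real divide_inverse mult.commute)
    have bd: "cmod (poly (p N j) (of_real t)) \<le> exp (\<bar>y $ j\<bar> * \<bar>t\<bar>)" for N j and t :: real
    proof -
      have e: "(\<lambda>n. (\<bar>y $ j\<bar> * \<bar>t\<bar>) ^ n / fact n) sums exp (\<bar>y $ j\<bar> * \<bar>t\<bar>)"
        using exp_converges[of "\<bar>y $ j\<bar> * \<bar>t\<bar>"] by (simp add: divide_inverse mult.commute)
      have "cmod (poly (p N j) (of_real t)) \<le> (\<Sum>k\<le>N. (\<bar>y $ j\<bar> * \<bar>t\<bar>) ^ k / fact k)"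
        unfolding pp by (intro sum_norm_le) (simp add: norm_mult norm_divide norm_power)
      also have "\<dots> \<le> exp (\<bar>y $ j\<bar> * \<bar>t\<bar>)"
        unfolding sums_unique[OF e] by (intro sum_le_suminf sums_summable[OF e]) auto
      finally show ?thesis .
    qed
    have "(\<lambda>N. LINT x|lebesgue. g x * (\<Prod>j\<in>UNIV. poly (p N j) (of_real (x $ j)))) \<longlonglongrightarrow> (LINT x|lebesgue. fourier_char x y * g x)"
    proof (rule integral_dominated_convergence)
      show "(\<lambda>x. fourier_char x y * g x) \<in> borel_measurable lebesgue" by measurable
      show "(\<lambda>x. g x * (\<Prod>j\<in>UNIV. poly (p N j) (of_real (x $ j)))) \<in> borel_measurable lebesgue" for N
        by measurable
      show "integrable lebesgue (\<lambda>x. cmod (g x * of_real (exp ((real CARD('n) * norm y) * norm x))))"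
        by (intro integrable_norm gr)
      show "AE x in lebesgue. (\<lambda>N. g x * (\<Prod>j\<in>UNIV. poly (p N j) (of_real (x $ j)))) \<longlonglongrightarrow> fourier_char x y * g x"
      proof (rule AE_I2)
        fix x :: "real ^ 'n"
        have "(\<lambda>N. g x * (\<Prod>j\<in>UNIV. poly (p N j) (of_real (x $ j)))) \<longlonglongrightarrow> g x * (\<Prod>j\<in>UNIV. exp (\<i> * of_real (y $ j) * of_real (x $ j)))"
          by (intro tendsto_mult tendsto_const tendsto_prod lim)
        also have "(\<Prod>j\<in>UNIV. exp (\<i> * of_real (y $ j) * of_real (x $ j))) = fourier_char x y"
          by (simp add: exp_sum[symmetric] inner_vec_def sum_distrib_left mult_ac)
        finally show "(\<lambda>N. g x * (\<Prod>j\<in>UNIV. poly (p N j) (of_real (x $ j)))) \<longlonglongrightarrow> fourier_char x y * g x"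
          by (simp add: mult.commute)
      qed
      show "AE x in lebesgue. norm (g x * (\<Prod>j\<in>UNIV. poly (p N j) (of_real (x $ j)))) \<le> cmod (g x * of_real (exp ((real CARD('n) * norm y) * norm x)))" for N
      proof (rule AE_I2)
        fix x :: "real ^ 'n"
        have "cmod (\<Prod>j\<in>UNIV. poly (p N j) (of_real (x $ j))) \<le> (\<Prod>j\<in>(UNIV::'n set). exp (norm y * norm x))"
          unfolding prod_norm[symmetric]
        proof (rule prod_mono, safe)
          fix j
          have "cmod (poly (p N j) (of_real (x $ j))) \<le> exp (\<bar>y $ j\<bar> * \<bar>x $ j\<bar>)" by (rule bd)
          also have "\<dots> \<le> exp (norm y * norm x)"
            by (simp add: component_le_norm_cart mult_mono)
          finally show "cmod (poly (p N j) (of_real (x $ j))) \<le> exp (norm y * norm x)" .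
        qed simp
        also have "\<dots> = exp ((real CARD('n) * norm y) * norm x)"
          by (simp add: exp_of_nat_mult[symmetric] mult.assoc)
        finally show "norm (g x * (\<Prod>j\<in>UNIV. poly (p N j) (of_real (x $ j)))) \<le> cmod (g x * of_real (exp ((real CARD('n) * norm y) * norm x)))"
          by (simp add: norm_mult mult_left_mono)
      qed
    qed
    moreover have "(LINT x|lebesgue. g x * (\<Prod>j\<in>UNIV. poly (p N j) (of_real (x $ j)))) = 0" for N
      by (rule pz[of UNIV]) auto
    ultimately show "(LINT x|lebesgue. fourier_char x y * g x) = 0"
      by (simp add: LIMSEQ_const_iff)
  qed
  then show ?thesis by eventually_elim (simp add: g_def)
qed

text \<open>Half of the quadratic term absorbs the linear one.\<close>

lemma gauss_norm_bound: "- a * t\<^sup>2 + r * t \<le> - (a / 2) * t\<^sup>2 + r\<^sup>2 / (2 * a)" if "a > 0" for a r t :: real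
proof -
  have "0 \<le> (a * t - r)\<^sup>2 / (2 * a)" using that by simp
  also have "\<dots> = - (a / 2) * t\<^sup>2 + r\<^sup>2 / (2 * a) - (- a * t\<^sup>2 + r * t)"
    using that by (simp add: power2_eq_square field_simps)
  finally show ?thesis by simp
qed

lemma gauss_norm_integrable:
  assumes a: "a > 0"
  shows "integrable lebesgue (\<lambda>x::real^'n. exp (- a * (norm x)\<^sup>2 + r * norm x))"
proof -
  have "integrable lborel (\<lambda>x::real^'n. exp (r\<^sup>2 / (2 * a)) * exp (- (a / 2) * (norm x)\<^sup>2))"
    using gauss_vec_real_integrable[of "a / 2" "0::real^'n"] a by simp
  then have "integrable lborel (\<lambda>x::real^'n. exp (- a * (norm x)\<^sup>2 + r * norm x))"
    by (rule Bochner_Integration.integrable_bound)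
       (use gauss_norm_bound[OF a] in \<open>auto simp: mult_exp_exp add.commute\<close>)
  then show ?thesis by (subst integrable_completion) auto
qed

lemma gauss_norm_L2: "(\<lambda>x::real^'n. complex_of_real (exp (- (norm x)\<^sup>2 / 2 + r * norm x))) \<in> L2"
proof (rule L2_I)
  have e: "(cmod (complex_of_real (exp (- (norm x)\<^sup>2 / 2 + r * norm x))))\<^sup>2 = exp (- 1 * (norm x)\<^sup>2 + (2 * r) * norm x)" for x :: "real ^ 'n"
    by (simp add: exp_double[symmetric] algebra_simps)
  show "integrable lebesgue (\<lambda>x::real^'n. (cmod (complex_of_real (exp (- (norm x)\<^sup>2 / 2 + r * norm x))))\<^sup>2)"
    unfolding e by (rule gauss_norm_integrable) simp
qed measurable

lemma hermite_fun_L2 [simp, intro]: "hermite_fun \<alpha> \<in> L2"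
proof (rule L2_I)
  have "integrable lborel (\<lambda>x. hermite_fun \<alpha> x * cnj (hermite_fun \<alpha> x))"
  proof (rule ccontr)
    assume "\<not> ?thesis"
    then have "(LINT x|lborel. hermite_fun \<alpha> x * cnj (hermite_fun \<alpha> x)) = 0" by (rule not_integrable_integral_eq)
    then show False using hermite_fun_orthonormal_borel[of \<alpha> \<alpha>] by simp
  qed
  then have "integrable lborel (\<lambda>x. Re (hermite_fun \<alpha> x * cnj (hermite_fun \<alpha> x)))" by (rule integrable_Re)
  then have "integrable lborel (\<lambda>x. (cmod (hermite_fun \<alpha> x))\<^sup>2)"
    by (simp only: complex_norm_square[symmetric] Re_complex_of_real)
  then show "integrable lebesgue (\<lambda>x. (cmod (hermite_fun \<alpha> x))\<^sup>2)"
    by (subst integrable_completion) auto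
qed measurable

lemma hermite_fun_orthonormal: "l2_inner (hermite_fun \<alpha>) (hermite_fun \<beta>) = (if \<alpha> = \<beta> then 1 else 0)"
  unfolding l2_inner_def using hermite_fun_orthonormal_borel[of \<alpha> \<beta>]
  by (subst integral_completion) auto

definition coef :: "(real ^ 'n \<Rightarrow> complex) \<Rightarrow> nat ^ 'n \<Rightarrow> complex" where
  "coef f \<alpha> = l2_inner f (hermite_fun \<alpha>)"

definition hsum :: "(nat ^ 'n) set \<Rightarrow> (nat ^ 'n \<Rightarrow> complex) \<Rightarrow> real ^ 'n \<Rightarrow> complex" where
  "hsum A c x = (\<Sum>\<alpha>\<in>A. c \<alpha> * hermite_fun \<alpha> x)"

lemma hsum_L2 [simp, intro]: "hsum A c \<in> L2"
  unfolding hsum_def by (intro L2_sum L2_cmult hermite_fun_L2)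

lemma l2_inner_hsum_left: "f \<in> L2 \<Longrightarrow> l2_inner (hsum A c) f = (\<Sum>\<alpha>\<in>A. c \<alpha> * cnj (coef f \<alpha>))"
  unfolding hsum_def coef_def
  by (subst l2_inner_sum_left) (auto simp: l2_inner_cmult_left l2_inner_commute[of "hermite_fun _"])

lemma coef_hsum: "finite A \<Longrightarrow> coef (hsum A c) \<alpha> = (if \<alpha> \<in> A then c \<alpha> else 0)"
  unfolding coef_def
  by (subst l2_inner_hsum_left) (auto simp: coef_def hermite_fun_orthonormal if_distrib cong: if_cong)

lemma l2_norm_hsum: "finite A \<Longrightarrow> (l2_norm (hsum A c))\<^sup>2 = (\<Sum>\<alpha>\<in>A. (cmod (c \<alpha>))\<^sup>2)"
proof -
  assume A: "finite A"
  have "complex_of_real ((l2_norm (hsum A c))\<^sup>2) = (\<Sum>\<alpha>\<in>A. c \<alpha> * cnj (c \<alpha>))"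
    by (subst l2_inner_self[symmetric]) (auto simp: l2_inner_hsum_left coef_hsum[OF A])
  also have "\<dots> = of_real (\<Sum>\<alpha>\<in>A. (cmod (c \<alpha>))\<^sup>2)"
    by (simp add: complex_norm_square flip: of_real_power)
  finally show ?thesis by (simp only: of_real_eq_iff)
qed

lemma coef_add: "f \<in> L2 \<Longrightarrow> g \<in> L2 \<Longrightarrow> coef (\<lambda>x. f x + g x) \<alpha> = coef f \<alpha> + coef g \<alpha>"
  by (simp add: coef_def l2_inner_add_left)

lemma coef_diff: "f \<in> L2 \<Longrightarrow> g \<in> L2 \<Longrightarrow> coef (\<lambda>x. f x - g x) \<alpha> = coef f \<alpha> - coef g \<alpha>"
  by (simp add: coef_def l2_inner_diff_left)

lemma coef_cmult: "coef (\<lambda>x. c * f x) \<alpha> = c * coef f \<alpha>"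
  by (simp add: coef_def l2_inner_cmult_left)

lemma coef_cong_AE: "f \<in> L2 \<Longrightarrow> AE x in lebesgue. f x = g x \<Longrightarrow> coef f \<alpha> = coef g \<alpha>"
  unfolding coef_def by (rule l2_inner_cong_AE) auto

lemma L2_coef_zero:
  assumes f: "f \<in> L2" and z: "\<And>\<alpha>. coef f \<alpha> = 0"
  shows "AE x in lebesgue. f x = 0"
proof (rule hermite_complete)
  show "f \<in> borel_measurable lebesgue" using f by (rule L2_measurable)
  show "integrable lebesgue (\<lambda>x. f x * of_real (exp (- (norm x)\<^sup>2 / 2 + r * norm x)))" for r
    by (rule L2_mult_integrable[OF f gauss_norm_L2])
  show "(LINT x|lebesgue. f x * hermite_fun \<alpha> x) = 0" for \<alpha>
    using z[of \<alpha>] by (simp add: coef_def l2_inner_def)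
qed

lemma L2_coef_eq:
  assumes f: "f \<in> L2" and g: "g \<in> L2" and "\<And>\<alpha>. coef f \<alpha> = coef g \<alpha>"
  shows "AE x in lebesgue. f x = g x"
  using L2_coef_zero[OF L2_diff[OF f g]] assms by (simp add: coef_diff)

lemma l2_norm_diff_sq:
  assumes f: "f \<in> L2" and g: "g \<in> L2"
  shows "(l2_norm (\<lambda>x. f x - g x))\<^sup>2 = (l2_norm f)\<^sup>2 - 2 * Re (l2_inner f g) + (l2_norm g)\<^sup>2"
proof -
  have "complex_of_real ((l2_norm (\<lambda>x. f x - g x))\<^sup>2) = l2_inner (\<lambda>x. f x - g x) (\<lambda>x. f x - g x)"
    using L2_diff[OF f g] by (simp only: l2_inner_self)
  also have "\<dots> = l2_inner f (\<lambda>x. f x - g x) - l2_inner g (\<lambda>x. f x - g x)"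
    using f g by (intro l2_inner_diff_left L2_diff)
  also have "\<dots> = cnj (l2_inner f f - l2_inner g f) - cnj (l2_inner f g - l2_inner g g)"
    using f g by (simp add: l2_inner_commute[of _ "\<lambda>x. f x - g x"] l2_inner_diff_left L2_diff)
  finally have "Re (complex_of_real ((l2_norm (\<lambda>x. f x - g x))\<^sup>2)) = Re (l2_inner f f) - Re (l2_inner g f) - Re (l2_inner f g) + Re (l2_inner g g)"
    by simp
  moreover have "Re (l2_inner g f) = Re (l2_inner f g)" by (simp add: l2_inner_commute[of g f])
  ultimately show ?thesis using f g by (simp add: l2_inner_self)
qed

lemma l2_norm_diff_hsum:
  assumes f: "f \<in> L2" and A: "finite A"
  shows "(l2_norm (\<lambda>x. f x - hsum A (coef f) x))\<^sup>2 = (l2_norm f)\<^sup>2 - (\<Sum>\<alpha>\<in>A. (cmod (coef f \<alpha>))\<^sup>2)"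
proof -
  have "l2_inner f (hsum A (coef f)) = (\<Sum>\<alpha>\<in>A. of_real ((cmod (coef f \<alpha>))\<^sup>2))"
    using f by (simp add: l2_inner_commute[of f] l2_inner_hsum_left complex_norm_square mult.commute del: of_real_power)
  then have "Re (l2_inner f (hsum A (coef f))) = (\<Sum>\<alpha>\<in>A. (cmod (coef f \<alpha>))\<^sup>2)"
    by (simp del: of_real_power flip: of_real_sum)
  then show ?thesis using f A by (simp add: l2_norm_diff_sq l2_norm_hsum)
qed

lemma coef_bessel:
  assumes f: "f \<in> L2"
  shows "(\<lambda>\<alpha>. (cmod (coef f \<alpha>))\<^sup>2) summable_on UNIV"
proof (rule nonneg_bdd_above_summable_on)
  show "bdd_above (sum (\<lambda>\<alpha>. (cmod (coef f \<alpha>))\<^sup>2) ` {F. F \<subseteq> UNIV \<and> finite F})"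
  proof (rule bdd_aboveI2)
    fix A :: "(nat ^ 'a) set" assume "A \<in> {F. F \<subseteq> UNIV \<and> finite F}"
    then show "(\<Sum>\<alpha>\<in>A. (cmod (coef f \<alpha>))\<^sup>2) \<le> (l2_norm f)\<^sup>2"
      using l2_norm_diff_hsum[OF f, of A] zero_le_power2[of "l2_norm (\<lambda>x. f x - hsum A (coef f) x)"] by simp
  qed
qed auto

lemma l2_tendsto_inner:
  assumes h: "l2_tendsto h g F" and k: "k \<in> L2"
  shows "((\<lambda>a. l2_inner (h a) k) \<longlongrightarrow> l2_inner g k) F"
proof -
  have g: "g \<in> L2" and ev: "\<forall>\<^sub>F a in F. h a \<in> L2" and lim: "((\<lambda>a. l2_norm (\<lambda>x. h a x - g x)) \<longlongrightarrow> 0) F"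
    using h by (auto simp: l2_tendsto_def)
  have "((\<lambda>a. l2_inner (h a) k - l2_inner g k) \<longlongrightarrow> 0) F"
  proof (rule Lim_null_comparison)
    show "\<forall>\<^sub>F a in F. norm (l2_inner (h a) k - l2_inner g k) \<le> l2_norm (\<lambda>x. h a x - g x) * l2_norm k"
      using ev
    proof eventually_elim
      case (elim a)
      then show ?case
        using l2_inner_Cauchy_Schwarz[OF L2_diff[OF elim g] k] g k by (simp add: l2_inner_diff_left)
    qed
    show "((\<lambda>a. l2_norm (\<lambda>x. h a x - g x) * l2_norm k) \<longlongrightarrow> 0) F"
      using tendsto_mult_right[OF lim, of "l2_norm k"] by simp
  qed
  then show ?thesis by (simp add: LIM_zero_iff)
qed

lemma l2_tendsto_hsum_coef:
  assumes t: "l2_tendsto (\<lambda>A. hsum A c) g (finite_subsets_at_top UNIV)"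
  shows "coef g \<alpha> = c \<alpha>"
proof -
  have "((\<lambda>A. coef (hsum A c) \<alpha>) \<longlongrightarrow> coef g \<alpha>) (finite_subsets_at_top UNIV)"
    unfolding coef_def by (rule l2_tendsto_inner[OF t]) auto
  moreover have "((\<lambda>A. coef (hsum A c) \<alpha>) \<longlongrightarrow> c \<alpha>) (finite_subsets_at_top UNIV)"
  proof (rule tendsto_eventually)
    show "\<forall>\<^sub>F A in finite_subsets_at_top UNIV. coef (hsum A c) \<alpha> = c \<alpha>"
      unfolding eventually_finite_subsets_at_top
      by (rule exI[of _ "{\<alpha>}"]) (auto simp: coef_hsum)
  qed
  ultimately show ?thesis by (rule tendsto_unique[OF finite_subsets_at_top_neq_bot])
qed

text \<open>The partial sums over a suitable increasing sequence of finite index sets form a rapidly Cauchy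
  sequence; the tails are small over every larger finite set, which turns convergence along the sequence
  into convergence along the net of all finite sets.\<close>

lemma hermite_Riesz_Fischer:
  fixes c :: "nat ^ 'n \<Rightarrow> complex"
  assumes c: "(\<lambda>\<alpha>. (cmod (c \<alpha>))\<^sup>2) summable_on UNIV"
  obtains f where "f \<in> L2" "\<And>\<alpha>. coef f \<alpha> = c \<alpha>" "l2_tendsto (\<lambda>A. hsum A c) f (finite_subsets_at_top UNIV)"
proof -
  let ?s = "\<lambda>A. \<Sum>\<alpha>\<in>A. (cmod (c \<alpha>))\<^sup>2"
  obtain S where S: "((\<lambda>\<alpha>. (cmod (c \<alpha>))\<^sup>2) has_sum S) UNIV" using c by (auto simp: summable_on_def)
  have le: "?s A \<le> S" if "finite A" for A
    using has_sum_mono_neutral[OF has_sum_finite[OF that] S] by simp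
  have "\<exists>A. finite A \<and> S - ((1/4) ^ n)\<^sup>2 < ?s A" for n
  proof -
    have "(?s \<longlongrightarrow> S) (finite_subsets_at_top UNIV)" using S by (simp add: has_sum_def)
    then have "\<forall>\<^sub>F A in finite_subsets_at_top UNIV. S - ((1/4) ^ n)\<^sup>2 < ?s A"
      by (rule order_tendstoD) simp
    then show ?thesis unfolding eventually_finite_subsets_at_top by blast
  qed
  then obtain A where A: "\<And>n. finite (A n)" "\<And>n. S - ((1/4) ^ n)\<^sup>2 < ?s (A n)" by metis
  define B where "B n = (\<Union>k\<le>n. A k)" for n
  have B: "finite (B n)" "B n \<subseteq> B (Suc n)" for n
    using A by (auto simp: B_def atMost_Suc)
  have tail: "l2_norm (\<lambda>x. hsum D c x - hsum (B n) c x) \<le> (1/4) ^ n" if D: "finite D" "B n \<subseteq> D" for D n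
  proof (rule power2_le_imp_le)
    have "(\<lambda>x. hsum D c x - hsum (B n) c x) = hsum (D - B n) c"
      unfolding hsum_def using sum.subset_diff[OF D(2,1), of "\<lambda>\<alpha>. c \<alpha> * hermite_fun \<alpha> _"] by (simp add: fun_eq_iff)
    then have "(l2_norm (\<lambda>x. hsum D c x - hsum (B n) c x))\<^sup>2 = ?s (D - B n)"
      using D by (simp add: l2_norm_hsum)
    also have "\<dots> = ?s D - ?s (B n)" using sum.subset_diff[OF D(2,1), of "\<lambda>\<alpha>. (cmod (c \<alpha>))\<^sup>2"] by simp
    also have "\<dots> \<le> S - ?s (A n)"
    proof -
      have "?s (A n) \<le> ?s (B n)" by (rule sum_mono2[OF B(1)]) (auto simp: B_def)
      then show ?thesis using le[OF D(1)] by simp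
    qed
    also have "\<dots> \<le> ((1/4) ^ n)\<^sup>2" using A(2)[of n] by simp
    finally show "(l2_norm (\<lambda>x. hsum D c x - hsum (B n) c x))\<^sup>2 \<le> ((1/4) ^ n)\<^sup>2" .
  qed simp
  obtain f where f: "f \<in> L2" and lim: "(\<lambda>n. l2_norm (\<lambda>x. hsum (B n) c x - f x)) \<longlonglongrightarrow> 0"
  proof (rule L2_Riesz_Fischer[of "\<lambda>n. hsum (B n) c"])
    show "hsum (B n) c \<in> L2" for n by simp
    show "l2_norm (\<lambda>x. hsum (B (Suc n)) c x - hsum (B n) c x) \<le> (1/4) ^ n" for n
      by (rule tail[OF B])
  qed
  have t: "l2_tendsto (\<lambda>A. hsum A c) f (finite_subsets_at_top UNIV)"
    unfolding l2_tendsto_def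
  proof (intro conjI f)
    show "\<forall>\<^sub>F A in finite_subsets_at_top UNIV. hsum A c \<in> L2" by simp
    show "((\<lambda>A. l2_norm (\<lambda>x. hsum A c x - f x)) \<longlongrightarrow> 0) (finite_subsets_at_top UNIV)"
    proof (rule tendstoI)
      fix e :: real assume e: "e > 0"
      have "(\<lambda>n. (1/4) ^ n + l2_norm (\<lambda>x. hsum (B n) c x - f x)) \<longlonglongrightarrow> 0 + 0"
        by (intro tendsto_add lim LIMSEQ_power_zero) simp
      then have "\<forall>\<^sub>F n in sequentially. (1/4) ^ n + l2_norm (\<lambda>x. hsum (B n) c x - f x) < e"
        using e by (intro order_tendstoD(2)[of _ 0]) auto
      then obtain n where n: "(1/4) ^ n + l2_norm (\<lambda>x. hsum (B n) c x - f x) < e"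
        unfolding eventually_sequentially by blast
      have "l2_norm (\<lambda>x. hsum D c x - f x) < e" if "finite D" "B n \<subseteq> D" for D
      proof -
        have "l2_norm (\<lambda>x. hsum D c x - f x) \<le> l2_norm (\<lambda>x. hsum D c x - hsum (B n) c x) + l2_norm (\<lambda>x. hsum (B n) c x - f x)"
          by (rule l2_norm_diff_triangle) (use f in auto)
        then show ?thesis using tail[OF that] n by simp
      qed
      then show "\<forall>\<^sub>F A in finite_subsets_at_top UNIV. dist (l2_norm (\<lambda>x. hsum A c x - f x)) 0 < e"
        unfolding eventually_finite_subsets_at_top
        by (intro exI[of _ "B n"]) (use B in auto)
    qed
  qed
  show ?thesis by (rule that[OF f l2_tendsto_hsum_coef[OF t] t])
qed

lemma l2_tendsto_cong_AE:
  assumes "l2_tendsto h f F" "AE x in lebesgue. f x = g x"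
  shows "l2_tendsto h g F"
proof -
  have h: "\<forall>\<^sub>F a in F. h a \<in> L2" and f: "f \<in> L2" and l: "((\<lambda>a. l2_norm (\<lambda>x. h a x - f x)) \<longlongrightarrow> 0) F"
    using assms(1) by (auto simp: l2_tendsto_def)
  have "((\<lambda>a. l2_norm (\<lambda>x. h a x - g x)) \<longlongrightarrow> 0) F"
  proof (rule tendsto_cong[THEN iffD1, OF _ l])
    show "\<forall>\<^sub>F a in F. l2_norm (\<lambda>x. h a x - f x) = l2_norm (\<lambda>x. h a x - g x)"
      using h
    proof eventually_elim
      case (elim a)
      have "AE x in lebesgue. h a x - f x = h a x - g x" using assms(2) by eventually_elim simp
      then show ?case by (rule l2_norm_cong_AE[OF L2_diff[OF elim f]])
    qed
  qed
  then show ?thesis using h L2_cong_AE[OF f assms(2)] by (simp add: l2_tendsto_def)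
qed

text \<open>Convergence of a Hermite series is equivalent to a statement about coefficients. For the direction
  from right to left the series converges to some function by the Riesz-Fischer theorem, and this
  function is \<open>g\<close> by completeness.\<close>

lemma l2_tendsto_hsum_iff:
  "l2_tendsto (\<lambda>A. hsum A c) g (finite_subsets_at_top UNIV) \<longleftrightarrow> g \<in> L2 \<and> (\<forall>\<alpha>. coef g \<alpha> = c \<alpha>)"
proof
  assume t: "l2_tendsto (\<lambda>A. hsum A c) g (finite_subsets_at_top UNIV)"
  then show "g \<in> L2 \<and> (\<forall>\<alpha>. coef g \<alpha> = c \<alpha>)"
    using l2_tendsto_hsum_coef[OF t] by (simp add: l2_tendsto_def)
next
  assume "g \<in> L2 \<and> (\<forall>\<alpha>. coef g \<alpha> = c \<alpha>)"
  then have g: "g \<in> L2" "\<forall>\<alpha>. coef g \<alpha> = c \<alpha>" by auto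
  then have "(\<lambda>\<alpha>. (cmod (c \<alpha>))\<^sup>2) summable_on UNIV" using coef_bessel[OF g(1)] by simp
  then obtain f where f: "f \<in> L2" "\<And>\<alpha>. coef f \<alpha> = c \<alpha>" "l2_tendsto (\<lambda>A. hsum A c) f (finite_subsets_at_top UNIV)"
    by (rule hermite_Riesz_Fischer) blast
  have "AE x in lebesgue. f x = g x" using f g by (intro L2_coef_eq) auto
  with f(3) show "l2_tendsto (\<lambda>A. hsum A c) g (finite_subsets_at_top UNIV)" by (rule l2_tendsto_cong_AE)
qed

lemma l2_inner_has_sum:
  assumes f: "f \<in> L2" and g: "g \<in> L2"
  shows "((\<lambda>\<alpha>. coef f \<alpha> * cnj (coef g \<alpha>)) has_sum l2_inner f g) UNIV"
proof -
  have "l2_tendsto (\<lambda>A. hsum A (coef f)) f (finite_subsets_at_top UNIV)"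
    using f by (simp add: l2_tendsto_hsum_iff)
  from l2_tendsto_inner[OF this g] show ?thesis
    by (simp add: has_sum_def l2_inner_hsum_left[OF g])
qed

lemma l2_norm_has_sum:
  assumes f: "f \<in> L2"
  shows "((\<lambda>\<alpha>. (cmod (coef f \<alpha>))\<^sup>2) has_sum (l2_norm f)\<^sup>2) UNIV"
proof -
  have "((\<lambda>\<alpha>. complex_of_real ((cmod (coef f \<alpha>))\<^sup>2)) has_sum of_real ((l2_norm f)\<^sup>2)) UNIV"
    using l2_inner_has_sum[OF f f] f by (simp add: l2_inner_self complex_norm_square del: of_real_power)
  then show ?thesis by (simp only: has_sum_of_real_iff)
qed


section \<open>Hermite-Sobolev spaces through Hermite coefficients\<close>

lemma hermite_eigenvalue_ge1: "hermite_eigenvalue (\<alpha> :: nat ^ 'n) \<ge> 1"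
proof -
  have "real CARD('n) \<ge> 1" by (simp add: Suc_leI)
  then show ?thesis unfolding hermite_eigenvalue_def by (simp add: add_increasing del: of_nat_sum)
qed

lemma has_hermite_power_iff:
  "has_hermite_power \<sigma> f g \<longleftrightarrow> g \<in> L2 \<and> (\<forall>\<alpha>. coef g \<alpha> = of_real (hermite_eigenvalue \<alpha> powr \<sigma>) * coef f \<alpha>)"
  unfolding has_hermite_power_def l2_tendsto_hsum_iff[symmetric]
  by (simp add: hsum_def[abs_def] coef_def)

definition sobolev_weight :: "real \<Rightarrow> nat ^ 'n \<Rightarrow> real" where
  "sobolev_weight s \<alpha> = hermite_eigenvalue \<alpha> powr s"

lemma sobolev_weight_pos: "sobolev_weight s \<alpha> > 0"
  using hermite_eigenvalue_ge1[of \<alpha>] by (simp add: sobolev_weight_def)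

lemma sobolev_weight_ge1: "s \<ge> 0 \<Longrightarrow> sobolev_weight s \<alpha> \<ge> 1"
  using hermite_eigenvalue_ge1[of \<alpha>] by (simp add: sobolev_weight_def ge_one_powr_ge_zero)

lemma sobolev_weight_half: "(cmod (of_real (hermite_eigenvalue \<alpha> powr (s / 2)) * c))\<^sup>2 = sobolev_weight s \<alpha> * (cmod c)\<^sup>2"
proof -
  have "(hermite_eigenvalue \<alpha> powr (s / 2))\<^sup>2 = sobolev_weight s \<alpha>"
    unfolding sobolev_weight_def power2_eq_square powr_add[symmetric] by simp
  then show ?thesis by (simp add: norm_mult power_mult_distrib)
qed

lemma hermite_sobolev_iff:
  "f \<in> hermite_sobolev s \<longleftrightarrow> f \<in> L2 \<and> (\<lambda>\<alpha>. sobolev_weight s \<alpha> * (cmod (coef f \<alpha>))\<^sup>2) summable_on UNIV"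
proof (cases "f \<in> L2")
  case True
  have "(\<exists>g. has_hermite_power (s / 2) f g) \<longleftrightarrow> (\<lambda>\<alpha>. sobolev_weight s \<alpha> * (cmod (coef f \<alpha>))\<^sup>2) summable_on UNIV"
  proof
    assume "\<exists>g. has_hermite_power (s / 2) f g"
    then obtain g where "g \<in> L2" "\<And>\<alpha>. coef g \<alpha> = of_real (hermite_eigenvalue \<alpha> powr (s / 2)) * coef f \<alpha>"
      by (auto simp: has_hermite_power_iff)
    with coef_bessel[of g] show "(\<lambda>\<alpha>. sobolev_weight s \<alpha> * (cmod (coef f \<alpha>))\<^sup>2) summable_on UNIV"
      by (simp only: sobolev_weight_half)
  next
    assume "(\<lambda>\<alpha>. sobolev_weight s \<alpha> * (cmod (coef f \<alpha>))\<^sup>2) summable_on UNIV"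
    then have "(\<lambda>\<alpha>. (cmod (of_real (hermite_eigenvalue \<alpha> powr (s / 2)) * coef f \<alpha>))\<^sup>2) summable_on UNIV"
      by (simp only: sobolev_weight_half)
    then obtain g where "g \<in> L2" "\<And>\<alpha>. coef g \<alpha> = of_real (hermite_eigenvalue \<alpha> powr (s / 2)) * coef f \<alpha>"
      by (rule hermite_Riesz_Fischer) blast
    then show "\<exists>g. has_hermite_power (s / 2) f g" by (auto simp: has_hermite_power_iff)
  qed
  then show ?thesis using True by (simp add: hermite_sobolev_def)
qed (simp add: hermite_sobolev_def)

lemma hermite_sobolev_L2: "f \<in> hermite_sobolev s \<Longrightarrow> f \<in> L2"
  by (simp add: hermite_sobolev_iff)

lemma hermite_sobolev_norm_nonneg [simp]: "hermite_sobolev_norm s f \<ge> 0"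
  by (simp add: hermite_sobolev_norm_def)

lemma hermite_sobolev_norm_has_sum:
  assumes f: "f \<in> hermite_sobolev s"
  shows "((\<lambda>\<alpha>. sobolev_weight s \<alpha> * (cmod (coef f \<alpha>))\<^sup>2) has_sum (hermite_sobolev_norm s f)\<^sup>2) UNIV"
proof -
  have "\<exists>g. has_hermite_power (s / 2) f g" using f by (simp add: hermite_sobolev_def)
  then have "has_hermite_power (s / 2) f (hermite_power (s / 2) f)"
    unfolding hermite_power_def by (rule someI_ex)
  then have g: "hermite_power (s / 2) f \<in> L2"
    "\<And>\<alpha>. coef (hermite_power (s / 2) f) \<alpha> = of_real (hermite_eigenvalue \<alpha> powr (s / 2)) * coef f \<alpha>"
    by (auto simp: has_hermite_power_iff)
  show ?thesis
    using l2_norm_has_sum[OF g(1)] unfolding g(2) sobolev_weight_half hermite_sobolev_norm_def .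
qed

lemma hermite_sobolev_norm_eqI:
  assumes f: "f \<in> hermite_sobolev s"
    and "((\<lambda>\<alpha>. sobolev_weight s \<alpha> * (cmod (coef f \<alpha>))\<^sup>2) has_sum c\<^sup>2) UNIV" "c \<ge> 0"
  shows "hermite_sobolev_norm s f = c"
proof -
  have "(hermite_sobolev_norm s f)\<^sup>2 = c\<^sup>2"
    using hermite_sobolev_norm_has_sum[OF f] assms(2) by (rule has_sum_unique)
  then show ?thesis using assms(3) by (simp add: power2_eq_iff_nonneg)
qed

lemma hermite_sobolev_cong:
  assumes f: "f \<in> hermite_sobolev s" and g: "g \<in> L2" and c: "\<And>\<alpha>. coef g \<alpha> = coef f \<alpha>"
  shows "g \<in> hermite_sobolev s" "hermite_sobolev_norm s g = hermite_sobolev_norm s f"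
proof -
  show 1: "g \<in> hermite_sobolev s" using f g by (simp add: hermite_sobolev_iff c)
  show "hermite_sobolev_norm s g = hermite_sobolev_norm s f"
    by (rule hermite_sobolev_norm_eqI[OF 1]) (use hermite_sobolev_norm_has_sum[OF f] in \<open>auto simp: c\<close>)
qed

lemma hermite_sobolev_cmult:
  assumes f: "f \<in> hermite_sobolev s"
  shows "(\<lambda>x. c * f x) \<in> hermite_sobolev s"
    "hermite_sobolev_norm s (\<lambda>x. c * f x) = cmod c * hermite_sobolev_norm s f"
proof -
  have h: "((\<lambda>\<alpha>. sobolev_weight s \<alpha> * (cmod (coef (\<lambda>x. c * f x) \<alpha>))\<^sup>2) has_sum (cmod c * hermite_sobolev_norm s f)\<^sup>2) UNIV"
    using has_sum_cmult_right[OF hermite_sobolev_norm_has_sum[OF f], of "(cmod c)\<^sup>2"]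
    by (simp add: coef_cmult norm_mult power_mult_distrib mult_ac)
  then show 1: "(\<lambda>x. c * f x) \<in> hermite_sobolev s"
    using f by (auto simp: hermite_sobolev_iff summable_on_def)
  show "hermite_sobolev_norm s (\<lambda>x. c * f x) = cmod c * hermite_sobolev_norm s f"
    by (rule hermite_sobolev_norm_eqI[OF 1 h]) auto
qed

lemma hermite_sobolev_add:
  assumes f: "f \<in> hermite_sobolev s" and g: "g \<in> hermite_sobolev s"
  shows "(\<lambda>x. f x + g x) \<in> hermite_sobolev s"
  unfolding hermite_sobolev_iff
proof
  have fg: "f \<in> L2" "g \<in> L2" using f g by (auto intro: hermite_sobolev_L2)
  then show "(\<lambda>x. f x + g x) \<in> L2" by (rule L2_add)
  have "(\<lambda>\<alpha>. 2 * (sobolev_weight s \<alpha> * (cmod (coef f \<alpha>))\<^sup>2) + 2 * (sobolev_weight s \<alpha> * (cmod (coef g \<alpha>))\<^sup>2)) summable_on UNIV"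
    using f g by (intro summable_on_add summable_on_cmult_right) (auto simp: hermite_sobolev_iff)
  then show "(\<lambda>\<alpha>. sobolev_weight s \<alpha> * (cmod (coef (\<lambda>x. f x + g x) \<alpha>))\<^sup>2) summable_on UNIV"
  proof (rule summable_on_comparison_test)
    fix \<alpha>
    have "(cmod (coef f \<alpha> + coef g \<alpha>))\<^sup>2 \<le> (cmod (coef f \<alpha>) + cmod (coef g \<alpha>))\<^sup>2"
      by (intro power_mono norm_triangle_ineq) auto
    also have "\<dots> \<le> 2 * (cmod (coef f \<alpha>))\<^sup>2 + 2 * (cmod (coef g \<alpha>))\<^sup>2"
      using sum_squares_bound[of "cmod (coef f \<alpha>)" "cmod (coef g \<alpha>)"] by (simp add: power2_sum)
    finally have "sobolev_weight s \<alpha> * (cmod (coef f \<alpha> + coef g \<alpha>))\<^sup>2 \<le> sobolev_weight s \<alpha> * (2 * (cmod (coef f \<alpha>))\<^sup>2 + 2 * (cmod (coef g \<alpha>))\<^sup>2)"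
      using sobolev_weight_pos[of s \<alpha>] by (intro mult_left_mono) auto
    then show "sobolev_weight s \<alpha> * (cmod (coef (\<lambda>x. f x + g x) \<alpha>))\<^sup>2 \<le> 2 * (sobolev_weight s \<alpha> * (cmod (coef f \<alpha>))\<^sup>2) + 2 * (sobolev_weight s \<alpha> * (cmod (coef g \<alpha>))\<^sup>2)"
      using fg by (simp add: coef_add algebra_simps)
    show "0 \<le> sobolev_weight s \<alpha> * (cmod (coef (\<lambda>x. f x + g x) \<alpha>))\<^sup>2"
      using sobolev_weight_pos[of s \<alpha>] by simp
  qed
qed

lemma hermite_sobolev_diff:
  assumes "f \<in> hermite_sobolev s" "g \<in> hermite_sobolev s"
  shows "(\<lambda>x. f x - g x) \<in> hermite_sobolev s"
  using hermite_sobolev_add[OF assms(1) hermite_sobolev_cmult(1)[OF assms(2), of "-1"]] by simp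

lemma hsum_sobolev [simp]:
  assumes "finite A" shows "hsum A c \<in> hermite_sobolev s"
proof -
  have "(\<lambda>\<alpha>. sobolev_weight s \<alpha> * (cmod (coef (hsum A c) \<alpha>))\<^sup>2) summable_on UNIV"
    using summable_on_finite[OF assms, of "\<lambda>\<alpha>. sobolev_weight s \<alpha> * (cmod (coef (hsum A c) \<alpha>))\<^sup>2"]
    by (rule summable_on_cong_neutral[THEN iffD1, rotated -1]) (auto simp: coef_hsum assms)
  then show ?thesis by (simp add: hermite_sobolev_iff)
qed

lemma l2_norm_le_sobolev:
  assumes s: "s \<ge> 0" and f: "f \<in> hermite_sobolev s"
  shows "l2_norm f \<le> hermite_sobolev_norm s f"
proof (rule power2_le_imp_le)
  show "(l2_norm f)\<^sup>2 \<le> (hermite_sobolev_norm s f)\<^sup>2"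
  proof (rule has_sum_mono[OF l2_norm_has_sum hermite_sobolev_norm_has_sum[OF f]])
    show "f \<in> L2" using f by (rule hermite_sobolev_L2)
    show "(cmod (coef f \<alpha>))\<^sup>2 \<le> sobolev_weight s \<alpha> * (cmod (coef f \<alpha>))\<^sup>2" for \<alpha>
      using mult_right_mono[OF sobolev_weight_ge1[OF s, of \<alpha>], of "(cmod (coef f \<alpha>))\<^sup>2"] by simp
  qed
qed simp

lemma sobolev_approx:
  assumes f: "f \<in> hermite_sobolev s" and e: "e > 0"
  obtains A where "finite A" "hermite_sobolev_norm s (\<lambda>x. f x - hsum A (coef f) x) < e"
proof -
  let ?w = "\<lambda>\<alpha>. sobolev_weight s \<alpha> * (cmod (coef f \<alpha>))\<^sup>2"
  have fL: "f \<in> L2" using f by (rule hermite_sobolev_L2)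
  have hs: "(?w has_sum (hermite_sobolev_norm s f)\<^sup>2) UNIV" by (rule hermite_sobolev_norm_has_sum[OF f])
  then have "(sum ?w \<longlongrightarrow> (hermite_sobolev_norm s f)\<^sup>2) (finite_subsets_at_top UNIV)" by (simp add: has_sum_def)
  then have "\<forall>\<^sub>F A in finite_subsets_at_top UNIV. (hermite_sobolev_norm s f)\<^sup>2 - e\<^sup>2 < sum ?w A"
    by (rule order_tendstoD) (use e in simp)
  then obtain A where A: "finite A" "(hermite_sobolev_norm s f)\<^sup>2 - e\<^sup>2 < sum ?w A"
    unfolding eventually_finite_subsets_at_top by blast
  let ?g = "\<lambda>x. f x - hsum A (coef f) x"
  have g: "?g \<in> hermite_sobolev s" using f A by (intro hermite_sobolev_diff) auto
  have "((\<lambda>\<alpha>. sobolev_weight s \<alpha> * (cmod (coef ?g \<alpha>))\<^sup>2) has_sum ((hermite_sobolev_norm s f)\<^sup>2 - sum ?w A)) UNIV"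
  proof -
    have "(?w has_sum ((hermite_sobolev_norm s f)\<^sup>2 - sum ?w A)) (UNIV - A)"
      by (rule has_sum_Diff[OF hs has_sum_finite[OF A(1)]]) simp
    then show ?thesis
      by (rule has_sum_cong_neutral[THEN iffD1, rotated -1]) (use fL in \<open>auto simp: coef_diff coef_hsum A(1)\<close>)
  qed
  with hermite_sobolev_norm_has_sum[OF g] have "(hermite_sobolev_norm s ?g)\<^sup>2 = (hermite_sobolev_norm s f)\<^sup>2 - sum ?w A"
    by (rule has_sum_unique)
  also have "\<dots> < e\<^sup>2" using A by simp
  finally have "hermite_sobolev_norm s ?g < e" using e by (simp add: power2_less_imp_less)
  with A(1) show ?thesis by (rule that)
qed

section \<open>The Fourier transform through Hermite coefficients\<close>

lemma l2_norm_eq_of_coef: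
  assumes "f \<in> L2" "g \<in> L2" "\<And>\<alpha>. cmod (coef f \<alpha>) = cmod (coef g \<alpha>)"
  shows "l2_norm f = l2_norm g"
proof -
  have "(l2_norm f)\<^sup>2 = (l2_norm g)\<^sup>2"
    using l2_norm_has_sum[OF assms(1)] l2_norm_has_sum[OF assms(2)] unfolding assms(3) by (rule has_sum_unique)
  then show ?thesis by (simp add: power2_eq_iff_nonneg)
qed

definition fourier_L1 :: "real \<Rightarrow> (real ^ 'n \<Rightarrow> complex) \<Rightarrow> real ^ 'n \<Rightarrow> complex" where
  "fourier_L1 \<epsilon> f y = complex_of_real ((2 * pi) powr (- real CARD('n) / 2))
      * (LINT x|lebesgue. exp (\<i> * complex_of_real (\<epsilon> * (x \<bullet> y))) * f x)"

definition fourier_phase :: "real \<Rightarrow> nat ^ 'n \<Rightarrow> complex" where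
  "fourier_phase \<epsilon> \<alpha> = (\<i> * of_real \<epsilon>) ^ multi_degree \<alpha>"

lemma cmod_fourier_phase: "\<epsilon>\<^sup>2 = 1 \<Longrightarrow> cmod (fourier_phase \<epsilon> \<alpha>) = 1"
  by (auto simp: fourier_phase_def norm_mult norm_power power2_eq_1_iff)

text \<open>Fubini and the eigenvalue equation for the Hermite functions show that the Fourier integral of
  \<open>f\<close> has the same products with Hermite functions as the \<open>L\<^sup>2\<close> function with
  coefficients \<open>fourier_phase \<epsilon> \<alpha> * coef f \<alpha>\<close>. The difference of the two is
  not known to be square integrable, but the first is bounded, and \<open>hermite_complete\<close> applies.\<close>

lemma fourier_L1_L2:
  fixes f :: "real ^ 'n \<Rightarrow> complex"
  assumes e: "\<epsilon>\<^sup>2 = 1" and f1: "integrable lebesgue f" and f2: "f \<in> L2"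
  shows "fourier_L1 \<epsilon> f \<in> L2" "coef (fourier_L1 \<epsilon> f) \<alpha> = fourier_phase \<epsilon> \<alpha> * coef f \<alpha>"
proof -
  let ?k = "complex_of_real ((2 * pi) powr (- real CARD('n) / 2))"
  have fm: "f \<in> borel_measurable lebesgue" using f1 by simp
  then obtain g where g[measurable]: "g \<in> borel_measurable borel" and fg: "AE x in lborel. f x = g x"
    by (rule lebesgue_borel_version)
  have gi: "integrable lborel g" using integrable_lebesgue_iff(1)[OF fm g fg] f1 by simp
  have eq: "fourier_L1 \<epsilon> f y = ?k * (LINT x|lborel. exp (\<i> * of_real (\<epsilon> * (x \<bullet> y))) * g x)" for y
  proof -
    have "(\<lambda>x. exp (\<i> * complex_of_real (\<epsilon> * (x \<bullet> y)))) \<in> borel_measurable lebesgue" by measurable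
    then have "(LINT x|lebesgue. exp (\<i> * complex_of_real (\<epsilon> * (x \<bullet> y))) * f x) = (LINT x|lborel. exp (\<i> * of_real (\<epsilon> * (x \<bullet> y))) * g x)"
      using fm fg by (intro integrable_lebesgue_iff(2)) auto
    then show ?thesis by (simp add: fourier_L1_def)
  qed
  have Fm [measurable]: "fourier_L1 \<epsilon> f \<in> borel_measurable borel"
    unfolding eq[abs_def] by measurable
  have Fb: "cmod (fourier_L1 \<epsilon> f y) \<le> cmod ?k * (LINT x|lborel. cmod (g x))" for y
    unfolding eq norm_mult
    by (intro mult_left_mono order_trans[OF integral_norm_bound]) (auto simp: norm_mult)
  have "(\<lambda>\<alpha>. (cmod (fourier_phase \<epsilon> \<alpha> * coef f \<alpha>))\<^sup>2) summable_on UNIV"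
    using coef_bessel[OF f2] by (simp add: norm_mult cmod_fourier_phase[OF e])
  then obtain U where U: "U \<in> L2" "\<And>\<alpha>. coef U \<alpha> = fourier_phase \<epsilon> \<alpha> * coef f \<alpha>"
    by (rule hermite_Riesz_Fischer) blast
  have Um [measurable]: "U \<in> borel_measurable lebesgue" using U(1) by (rule L2_measurable)
  have FH: "(LINT y|lborel. fourier_L1 \<epsilon> f y * hermite_fun \<alpha> y) = fourier_phase \<epsilon> \<alpha> * coef f \<alpha>" for \<alpha>
  proof -
    have Hi: "integrable lborel (\<lambda>y. cmod (hermite_fun \<alpha> y))"
      using hermite_fun_norm_exp_integrable_borel[of \<alpha> 0] by simp
    define F where "F x y = exp (\<i> * of_real (\<epsilon> * (x \<bullet> y))) * g x * hermite_fun \<alpha> y" for x y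
    have iF: "integrable (lborel \<Otimes>\<^sub>M lborel) (case_prod F)"
    proof (rule integrable_pair_dominated)
      show "case_prod F \<in> borel_measurable (lborel \<Otimes>\<^sub>M lborel)"
        unfolding F_def case_prod_beta by measurable
      show "integrable lborel (\<lambda>y. cmod (g x) * cmod (hermite_fun \<alpha> y))" for x
        using Hi by simp
      show "cmod (F x y) \<le> cmod (g x) * cmod (hermite_fun \<alpha> y)" for x y
        by (simp add: F_def norm_mult)
      show "integrable lborel (\<lambda>x. cmod (g x) * (LINT y|lborel. cmod (hermite_fun \<alpha> y)))"
        using gi by simp
    qed simp
    have F1: "(LINT x|lborel. F x y) = (LINT x|lborel. exp (\<i> * of_real (\<epsilon> * (x \<bullet> y))) * g x) * hermite_fun \<alpha> y" for y
      unfolding F_def by (rule integral_mult_left_zero)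
    have "(LINT y|lborel. fourier_L1 \<epsilon> f y * hermite_fun \<alpha> y) = ?k * (LINT y|lborel. LINT x|lborel. F x y)"
      unfolding eq F1 by (simp add: mult.assoc)
    also have "(LINT y|lborel. LINT x|lborel. F x y) = (LINT x|lborel. LINT y|lborel. F x y)"
      by (rule lborel_pair.Fubini_integral[OF iF])
    also have "\<dots> = (LINT x|lborel. (of_real ((2 * pi) powr (real CARD('n) / 2)) * fourier_phase \<epsilon> \<alpha>) * (g x * hermite_fun \<alpha> x))"
    proof (rule Bochner_Integration.integral_cong[OF refl])
      fix x :: "real ^ 'n"
      have "(LINT y|lborel. F x y) = g x * (LINT y|lborel. exp (\<i> * of_real (\<epsilon> * (y \<bullet> x))) * hermite_fun \<alpha> y)"
        unfolding F_def by (subst integral_mult_right_zero[symmetric]) (simp add: mult_ac inner_commute)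
      then show "(LINT y|lborel. F x y) = (of_real ((2 * pi) powr (real CARD('n) / 2)) * fourier_phase \<epsilon> \<alpha>) * (g x * hermite_fun \<alpha> x)"
        unfolding hermite_fun_fourier_borel[OF e] fourier_phase_def by simp
    qed
    also have "\<dots> = (of_real ((2 * pi) powr (real CARD('n) / 2)) * fourier_phase \<epsilon> \<alpha>) * (LINT x|lborel. g x * hermite_fun \<alpha> x)"
      by (rule integral_mult_right_zero)
    also have "(LINT x|lborel. g x * hermite_fun \<alpha> x) = coef f \<alpha>"
      unfolding coef_def l2_inner_def cnj_hermite_fun
    proof (rule integrable_lebesgue_iff(2)[symmetric])
      show "(\<lambda>x. f x * hermite_fun \<alpha> x) \<in> borel_measurable lebesgue" using fm by measurable
      show "AE x in lborel. f x * hermite_fun \<alpha> x = g x * hermite_fun \<alpha> x" using fg by eventually_elim simp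
    qed measurable
    also have "?k * (of_real ((2 * pi) powr (real CARD('n) / 2)) * fourier_phase \<epsilon> \<alpha> * coef f \<alpha>) = fourier_phase \<epsilon> \<alpha> * coef f \<alpha>"
      by (simp add: powr_minus field_simps flip: of_real_mult)
    finally show ?thesis .
  qed
  have "AE x in lebesgue. fourier_L1 \<epsilon> f x - U x = 0"
  proof (rule hermite_complete)
    show "(\<lambda>x. fourier_L1 \<epsilon> f x - U x) \<in> borel_measurable lebesgue" by measurable
    fix r
    have "integrable lebesgue (\<lambda>x. fourier_L1 \<epsilon> f x * of_real (exp (- (norm x)\<^sup>2 / 2 + r * norm x)))"
    proof (rule Bochner_Integration.integrable_bound)
      show "integrable lebesgue (\<lambda>x::real^'n. (cmod ?k * (LINT x|lborel. cmod (g x))) * exp (- (1/2) * (norm x)\<^sup>2 + r * norm x))"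
        by (intro integrable_mult_right gauss_norm_integrable) simp
      show "AE x in lebesgue. norm (fourier_L1 \<epsilon> f x * of_real (exp (- (norm x)\<^sup>2 / 2 + r * norm x)))
          \<le> norm ((cmod ?k * (LINT x|lborel. cmod (g x))) * exp (- (1/2) * (norm x)\<^sup>2 + r * norm x))"
        using Fb by (auto simp: norm_mult intro!: mult_right_mono intro: order_trans[OF _ abs_ge_self])
    qed measurable
    moreover have "integrable lebesgue (\<lambda>x. U x * of_real (exp (- (norm x)\<^sup>2 / 2 + r * norm x)))"
      by (rule L2_mult_integrable[OF U(1) gauss_norm_L2])
    ultimately show "integrable lebesgue (\<lambda>x. (fourier_L1 \<epsilon> f x - U x) * of_real (exp (- (norm x)\<^sup>2 / 2 + r * norm x)))"
      unfolding left_diff_distrib by (rule Bochner_Integration.integrable_diff)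
  next
    fix \<alpha>
    have i1: "integrable lebesgue (\<lambda>y. fourier_L1 \<epsilon> f y * hermite_fun \<alpha> y)"
    proof (rule Bochner_Integration.integrable_bound)
      have "integrable lborel (\<lambda>y. cmod (hermite_fun \<alpha> y))"
        using hermite_fun_norm_exp_integrable_borel[of \<alpha> 0] by simp
      then have "integrable lebesgue (\<lambda>y. cmod (hermite_fun \<alpha> y))"
        by (subst integrable_completion) auto
      then show "integrable lebesgue (\<lambda>y. (cmod ?k * (LINT x|lborel. cmod (g x))) * cmod (hermite_fun \<alpha> y))"
        by (rule integrable_mult_right)
      show "AE x in lebesgue. norm (fourier_L1 \<epsilon> f x * hermite_fun \<alpha> x) \<le> norm ((cmod ?k * (LINT x|lborel. cmod (g x))) * cmod (hermite_fun \<alpha> x))"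
        using Fb by (auto simp: norm_mult intro!: mult_right_mono intro: order_trans[OF _ abs_ge_self])
    qed measurable
    have i2: "integrable lebesgue (\<lambda>y. U y * hermite_fun \<alpha> y)"
      by (rule L2_mult_integrable[OF U(1) hermite_fun_L2])
    have "(LINT y|lebesgue. (fourier_L1 \<epsilon> f y - U y) * hermite_fun \<alpha> y)
       = (LINT y|lebesgue. fourier_L1 \<epsilon> f y * hermite_fun \<alpha> y) - (LINT y|lebesgue. U y * hermite_fun \<alpha> y)"
      unfolding left_diff_distrib by (rule Bochner_Integration.integral_diff[OF i1 i2])
    also have "(LINT y|lebesgue. fourier_L1 \<epsilon> f y * hermite_fun \<alpha> y) = fourier_phase \<epsilon> \<alpha> * coef f \<alpha>"
      unfolding FH[symmetric] by (rule integral_completion) measurable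
    also have "(LINT y|lebesgue. U y * hermite_fun \<alpha> y) = fourier_phase \<epsilon> \<alpha> * coef f \<alpha>"
      using U(2)[of \<alpha>] by (simp add: coef_def l2_inner_def)
    finally show "(LINT y|lebesgue. (fourier_L1 \<epsilon> f y - U y) * hermite_fun \<alpha> y) = 0" by simp
  qed
  then have ae: "AE x in lebesgue. U x = fourier_L1 \<epsilon> f x" by eventually_elim simp
  show "fourier_L1 \<epsilon> f \<in> L2" by (rule L2_cong_AE[OF U(1) ae])
  show "coef (fourier_L1 \<epsilon> f) \<alpha> = fourier_phase \<epsilon> \<alpha> * coef f \<alpha>"
    using coef_cong_AE[OF U(1) ae] U(2) by simp
qed

lemma L2_truncate:
  fixes f :: "real ^ 'n \<Rightarrow> complex"
  assumes f: "f \<in> L2"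
  shows "(\<lambda>x. indicator (cball 0 R) x * f x) \<in> L2" "integrable lebesgue (\<lambda>x. indicator (cball 0 R) x * f x)"
    "((\<lambda>R. l2_norm (\<lambda>x. indicator (cball 0 R) x * f x - f x)) \<longlongrightarrow> 0) at_top"
proof -
  have fm [measurable]: "f \<in> borel_measurable lebesgue" using f by (rule L2_measurable)
  have im [measurable]: "(\<lambda>x::real^'n. indicator (cball 0 R) x :: complex) \<in> borel_measurable lebesgue" for R
  proof -
    have "(\<lambda>x::real^'n. indicator (cball 0 R) x :: complex) = (\<lambda>x. of_real (indicator (cball 0 R) x))"
      by (auto simp: indicator_def)
    moreover have [measurable]: "cball (0::real^'n) R \<in> sets borel" by simp
    then have "(\<lambda>x::real^'n. complex_of_real (indicator (cball 0 R) x)) \<in> borel_measurable borel"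
      by measurable
    ultimately show ?thesis by (simp only: lebesgue_measurable_borel)
  qed
  show t: "(\<lambda>x. indicator (cball 0 R) x * f x) \<in> L2" for R
    by (rule L2_mult_bounded[OF f im, of _ 1]) (auto simp: indicator_def)
  have "(\<lambda>x::real^'n. indicator (cball 0 R) x :: complex) \<in> L2"
  proof (rule L2_I[OF im])
    have "integrable lborel (\<lambda>x::real^'n. indicator (cball 0 R) x :: real)"
      by (intro integrable_real_indicator) (use emeasure_bounded_finite[OF bounded_cball, of "0::real^'n" R] in auto)
    then have "integrable lebesgue (\<lambda>x::real^'n. indicator (cball 0 R) x :: real)"
      by (subst integrable_completion) auto
    moreover have "(\<lambda>x::real^'n. (cmod (indicator (cball 0 R) x))\<^sup>2) = indicator (cball 0 R)"
      by (auto simp: indicator_def)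
    ultimately show "integrable lebesgue (\<lambda>x::real^'n. (cmod (indicator (cball 0 R) x))\<^sup>2)" by simp
  qed
  from L2_mult_integrable[OF this f] show "integrable lebesgue (\<lambda>x. indicator (cball 0 R) x * f x)" .
  have "((\<lambda>R. LINT x|lebesgue. (cmod (indicator (cball 0 R) x * f x - f x))\<^sup>2) \<longlongrightarrow> (LINT x|(lebesgue::(real^'n) measure). 0)) at_top"
  proof (rule integral_dominated_convergence_at_top)
    show "integrable lebesgue (\<lambda>x. (cmod (f x))\<^sup>2)" using f by (rule L2_sq_integrable)
    show "\<forall>\<^sub>F R in at_top. AE x in lebesgue. norm ((cmod (indicator (cball 0 R) x * f x - f x))\<^sup>2) \<le> (cmod (f x))\<^sup>2"
      by (intro always_eventually allI AE_I2) (auto simp: indicator_def)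
    show "AE x in lebesgue. ((\<lambda>R. (cmod (indicator (cball 0 R) x * f x - f x))\<^sup>2) \<longlongrightarrow> 0) at_top"
    proof (rule AE_I2, rule tendsto_eventually)
      fix x
      show "\<forall>\<^sub>F R in at_top. (cmod (indicator (cball 0 R) x * f x - f x))\<^sup>2 = 0"
        using eventually_ge_at_top[of "norm x"] by eventually_elim simp
    qed
  qed measurable
  then have "((\<lambda>R. sqrt (LINT x|lebesgue. (cmod (indicator (cball 0 R) x * f x - f x))\<^sup>2)) \<longlongrightarrow> sqrt 0) at_top"
    by (intro tendsto_real_sqrt) simp
  then show "((\<lambda>R. l2_norm (\<lambda>x. indicator (cball 0 R) x * f x - f x)) \<longlongrightarrow> 0) at_top"
    by (simp add: l2_norm_def)
qed

text \<open>Both the truncated integrals and the candidate limit are known through their coefficients, and by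
  Parseval's identity their distance equals the distance of \<open>f\<close> from its truncation.\<close>

lemma has_fourier_iff:
  fixes f :: "real ^ 'n \<Rightarrow> complex"
  assumes e: "\<epsilon>\<^sup>2 = 1" and f: "f \<in> L2"
  shows "has_fourier \<epsilon> f g \<longleftrightarrow> g \<in> L2 \<and> (\<forall>\<alpha>. coef g \<alpha> = fourier_phase \<epsilon> \<alpha> * coef f \<alpha>)"
proof -
  define t where "t R x = indicator (cball 0 R) x * f x" for R x
  have t: "t R \<in> L2" "integrable lebesgue (t R)" for R
    using L2_truncate[OF f] by (auto simp: t_def[abs_def])
  have tl: "((\<lambda>R. l2_norm (\<lambda>x. t R x - f x)) \<longlongrightarrow> 0) at_top"
    using L2_truncate(3)[OF f] by (simp add: t_def)
  have hf: "has_fourier \<epsilon> f g \<longleftrightarrow> l2_tendsto (\<lambda>R. fourier_L1 \<epsilon> (t R)) g at_top" for g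
  proof -
    have "(LINT x:cball 0 R|lebesgue. exp (\<i> * complex_of_real (\<epsilon> * (x \<bullet> y))) * f x)
       = (LINT x|lebesgue. exp (\<i> * complex_of_real (\<epsilon> * (x \<bullet> y))) * t R x)" for R and y :: "real ^ 'n"
      unfolding set_lebesgue_integral_def t_def
      by (intro Bochner_Integration.integral_cong) (auto simp: indicator_def)
    then show ?thesis unfolding has_fourier_def fourier_L1_def[abs_def] by simp
  qed
  note F = fourier_L1_L2[OF e t(2) t(1)]
  have main: "has_fourier \<epsilon> f g" if g: "g \<in> L2" and c: "\<And>\<alpha>. coef g \<alpha> = fourier_phase \<epsilon> \<alpha> * coef f \<alpha>" for g
  proof -
    have "l2_norm (\<lambda>x. fourier_L1 \<epsilon> (t R) x - g x) = l2_norm (\<lambda>x. t R x - f x)" for R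
    proof (rule l2_norm_eq_of_coef)
      show "cmod (coef (\<lambda>x. fourier_L1 \<epsilon> (t R) x - g x) \<alpha>) = cmod (coef (\<lambda>x. t R x - f x) \<alpha>)" for \<alpha>
        using F t g f by (simp add: coef_diff c norm_mult cmod_fourier_phase[OF e] flip: right_diff_distrib)
    qed (use F t g f in auto)
    then show ?thesis unfolding hf l2_tendsto_def using F g tl by simp
  qed
  have "(\<lambda>\<alpha>. (cmod (fourier_phase \<epsilon> \<alpha> * coef f \<alpha>))\<^sup>2) summable_on UNIV"
    using coef_bessel[OF f] by (simp add: norm_mult cmod_fourier_phase[OF e])
  then obtain U where U: "U \<in> L2" "\<And>\<alpha>. coef U \<alpha> = fourier_phase \<epsilon> \<alpha> * coef f \<alpha>"
    by (rule hermite_Riesz_Fischer) blast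
  show ?thesis
  proof safe
    assume h: "has_fourier \<epsilon> f g"
    show "g \<in> L2" using h by (simp add: hf l2_tendsto_def)
    fix \<alpha>
    have "((\<lambda>R. coef (fourier_L1 \<epsilon> (t R)) \<alpha>) \<longlongrightarrow> coef g \<alpha>) at_top"
      unfolding coef_def using h by (intro l2_tendsto_inner) (auto simp: hf)
    moreover have "((\<lambda>R. coef (fourier_L1 \<epsilon> (t R)) \<alpha>) \<longlongrightarrow> coef U \<alpha>) at_top"
      unfolding coef_def using main[OF U] by (intro l2_tendsto_inner) (auto simp: hf)
    ultimately have "coef g \<alpha> = coef U \<alpha>" by (rule tendsto_unique[OF trivial_limit_at_top_linorder])
    then show "coef g \<alpha> = fourier_phase \<epsilon> \<alpha> * coef f \<alpha>" by (simp add: U)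
  qed (use main in blast)
qed

lemma has_fourier_exists:
  fixes f :: "real ^ 'n \<Rightarrow> complex"
  assumes e: "\<epsilon>\<^sup>2 = 1" and f: "f \<in> L2"
  shows "\<exists>g. has_fourier \<epsilon> f g"
proof -
  have "(\<lambda>\<alpha>. (cmod (fourier_phase \<epsilon> \<alpha> * coef f \<alpha>))\<^sup>2) summable_on UNIV"
    using coef_bessel[OF f] by (simp add: norm_mult cmod_fourier_phase[OF e])
  then obtain U where U: "U \<in> L2" "\<And>\<alpha>. coef U \<alpha> = fourier_phase \<epsilon> \<alpha> * coef f \<alpha>"
    by (rule hermite_Riesz_Fischer) blast
  then show ?thesis by (auto simp: has_fourier_iff[OF e f])
qed

lemma fourier_L2:
  assumes f: "f \<in> L2"
  shows "fourier f \<in> L2" "coef (fourier f) \<alpha> = fourier_phase (-1) \<alpha> * coef f \<alpha>"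
  using someI_ex[OF has_fourier_exists[OF _ f, of "-1"]] unfolding fourier_def[symmetric]
  by (auto simp: has_fourier_iff[OF _ f])

lemma inv_fourier_L2:
  assumes f: "f \<in> L2"
  shows "inv_fourier f \<in> L2" "coef (inv_fourier f) \<alpha> = fourier_phase 1 \<alpha> * coef f \<alpha>"
  using someI_ex[OF has_fourier_exists[OF _ f, of "1"]] unfolding inv_fourier_def[symmetric]
  by (auto simp: has_fourier_iff[OF _ f])

lemma fourier_phase_inverse: "fourier_phase 1 \<alpha> * fourier_phase (-1) \<alpha> = 1"
  by (simp add: fourier_phase_def flip: power_mult_distrib)


section \<open>The Bargmann transform is isometric\<close>

definition bargmann_kernel :: "complex ^ 'n \<Rightarrow> real ^ 'n \<Rightarrow> complex" where
  "bargmann_kernel z u = gaussian u * exp (cdot (cvec u) z)"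

definition bargmann_const :: "complex ^ 'n \<Rightarrow> complex" where
  "bargmann_const z = complex_of_real (pi powr (- real CARD('n) / 4)) * exp (- cdot z z / 4)"

lemma bargmann_eq: "bargmann f z = bargmann_const z * (LINT u|lebesgue. f u * bargmann_kernel z u)"
  by (simp add: bargmann_def bargmann_const_def bargmann_kernel_def mult.assoc)

lemma measurable_bargmann_kernel [measurable]: "bargmann_kernel z \<in> borel_measurable borel"
  unfolding bargmann_kernel_def by measurable

lemma norm_exp_cdot: "cmod (exp (cdot (cvec u) z)) = exp (u \<bullet> (\<chi> j. Re (z $ j)))"
  by (simp add: cdot_def cvec_def inner_vec_def)

lemma norm_exp_cdot_le: "cmod (exp (cdot (cvec u) z)) \<le> exp (norm (\<chi> j. Re (z $ j)) * norm u)"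
  unfolding norm_exp_cdot by (simp add: norm_cauchy_schwarz mult.commute)

lemma bargmann_kernel_L2: "bargmann_kernel z \<in> L2"
proof (rule L2_dominated)
  let ?r = "norm (\<chi> j. Re (z $ j))"
  show "integrable lebesgue (\<lambda>u::real^'a. exp (- 1 * (norm u)\<^sup>2 + (2 * ?r) * norm u))"
    by (rule gauss_norm_integrable) simp
  show "AE u in lebesgue. (cmod (bargmann_kernel z u))\<^sup>2 \<le> exp (- 1 * (norm u)\<^sup>2 + (2 * ?r) * norm u)"
  proof (rule AE_I2)
    fix u
    have "cmod (bargmann_kernel z u) \<le> exp (- (norm u)\<^sup>2 / 2) * exp (?r * norm u)"
      unfolding bargmann_kernel_def norm_mult by (intro mult_mono norm_exp_cdot_le) auto
    then have "(cmod (bargmann_kernel z u))\<^sup>2 \<le> (exp (- (norm u)\<^sup>2 / 2) * exp (?r * norm u))\<^sup>2"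
      by (intro power_mono) auto
    also have "\<dots> = exp (- 1 * (norm u)\<^sup>2 + (2 * ?r) * norm u)"
      by (simp add: mult_exp_exp exp_double[symmetric] algebra_simps)
    finally show "(cmod (bargmann_kernel z u))\<^sup>2 \<le> exp (- 1 * (norm u)\<^sup>2 + (2 * ?r) * norm u)" .
  qed
qed measurable

lemma bargmann_integrable: "f \<in> L2 \<Longrightarrow> integrable lebesgue (\<lambda>u. f u * bargmann_kernel z u)"
  by (rule L2_mult_integrable[OF _ bargmann_kernel_L2])

lemma bargmann_add: "f \<in> L2 \<Longrightarrow> g \<in> L2 \<Longrightarrow> bargmann (\<lambda>x. f x + g x) z = bargmann f z + bargmann g z"
  by (simp add: bargmann_eq distrib_right distrib_left bargmann_integrable)

lemma bargmann_diff: "f \<in> L2 \<Longrightarrow> g \<in> L2 \<Longrightarrow> bargmann (\<lambda>x. f x - g x) z = bargmann f z - bargmann g z"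
  by (simp add: bargmann_eq left_diff_distrib right_diff_distrib bargmann_integrable)

lemma bargmann_cmult: "bargmann (\<lambda>x. c * f x) z = c * bargmann f z"
  by (simp add: bargmann_eq mult.assoc mult.left_commute)

text \<open>Parseval's identity for \<open>f\<close> and the kernel of the transform, whose Hermite coefficients are
  the conjugates of the normalized monomials.\<close>

lemma bargmann_has_sum:
  assumes f: "f \<in> L2"
  shows "((\<lambda>\<alpha>. coef f \<alpha> * fock_monomial \<alpha> z) has_sum bargmann f z) UNIV"
proof -
  let ?k = "\<lambda>u. cnj (bargmann_kernel z u)"
  have k: "?k \<in> L2" by (rule L2_cnj[OF bargmann_kernel_L2])
  have c: "cnj (coef ?k \<alpha>) = (LINT u|lebesgue. hermite_fun \<alpha> u * bargmann_kernel z u)" for \<alpha>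
    by (simp add: coef_def l2_inner_commute[of ?k] ) (simp add: l2_inner_def)
  have "((\<lambda>\<alpha>. bargmann_const z * (coef f \<alpha> * cnj (coef ?k \<alpha>))) has_sum (bargmann_const z * l2_inner f ?k)) UNIV"
    by (intro has_sum_cmult_right l2_inner_has_sum f k)
  moreover have "bargmann_const z * (coef f \<alpha> * cnj (coef ?k \<alpha>)) = coef f \<alpha> * fock_monomial \<alpha> z" for \<alpha>
    unfolding c bargmann_hermite_fun[symmetric] bargmann_eq by simp
  moreover have "bargmann_const z * l2_inner f ?k = bargmann f z"
    by (simp add: bargmann_eq l2_inner_def)
  ultimately show ?thesis by simp
qed

lemma bargmann_cong_coef:
  assumes "f \<in> L2" "g \<in> L2" "\<And>\<alpha>. coef f \<alpha> = coef g \<alpha>"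
  shows "bargmann f = bargmann g"
proof
  fix z
  show "bargmann f z = bargmann g z"
    using bargmann_has_sum[OF assms(1), of z] bargmann_has_sum[OF assms(2), of z]
    unfolding assms(3) by (rule has_sum_unique)
qed

lemma fock_monomial_ii: "fock_monomial \<alpha> (\<i> *s z) = fourier_phase 1 \<alpha> * fock_monomial \<alpha> z"
  by (simp add: fock_monomial_def fourier_phase_def multi_degree_def power_mult_distrib prod.distrib prod_dividef power_sum)

lemma bargmann_inv_fourier:
  assumes g: "g \<in> L2"
  shows "bargmann (inv_fourier g) z = bargmann g (\<i> *s z)"
proof -
  note F = inv_fourier_L2[OF g]
  have "((\<lambda>\<alpha>. coef g \<alpha> * fock_monomial \<alpha> (\<i> *s z)) has_sum bargmann (inv_fourier g) z) UNIV"
    using bargmann_has_sum[OF F(1), of z] by (simp add: F(2) fock_monomial_ii mult_ac)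
  then show ?thesis using bargmann_has_sum[OF g] by (rule has_sum_unique)
qed

lemma bargmann_fourier:
  assumes f: "f \<in> L2"
  shows "bargmann (fourier f) (\<i> *s z) = bargmann f z"
proof -
  note F = fourier_L2[OF f]
  have c: "fourier_phase (-1) \<alpha> * coef f \<alpha> * (fourier_phase 1 \<alpha> * b) = coef f \<alpha> * b" for \<alpha> b
    using fourier_phase_inverse[of \<alpha>] by (metis mult.assoc mult.commute mult.left_commute mult_1)
  have "((\<lambda>\<alpha>. coef f \<alpha> * fock_monomial \<alpha> z) has_sum bargmann (fourier f) (\<i> *s z)) UNIV"
    using bargmann_has_sum[OF F(1), of "\<i> *s z"] by (simp add: F(2) fock_monomial_ii c)
  then show ?thesis using bargmann_has_sum[OF f] by (rule has_sum_unique)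
qed

lemma gauss_vec_real_integral:
  fixes b :: "real ^ 'n"
  assumes a: "a > 0"
  shows "(LINT x|lborel. exp (- a * (norm x)\<^sup>2 + (x::real^'n) \<bullet> b)) = sqrt (pi / a) ^ CARD('n) * exp ((norm b)\<^sup>2 / (4 * a))"
proof -
  have 1: "complex_of_real (exp (- a * (norm x)\<^sup>2 + x \<bullet> b)) = exp (- of_real (a * (norm x)\<^sup>2) + cdot (cvec x) (cvec b))" for x :: "real ^ 'n"
    by (simp add: cdot_def cvec_def inner_vec_def exp_of_real[symmetric])
  have 2: "cdot (cvec b) (cvec b) = of_real ((norm b)\<^sup>2)"
    unfolding norm_real_vec_sq by (simp add: cdot_def cvec_def power2_eq_square)
  have "complex_of_real (LINT x|lborel. exp (- a * (norm x)\<^sup>2 + (x::real^'n) \<bullet> b)) = (LINT x|lborel. of_real (exp (- a * (norm x)\<^sup>2 + (x::real^'n) \<bullet> b)))"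
    by (rule integral_complex_of_real[symmetric])
  also have "\<dots> = of_real (sqrt (pi / a) ^ CARD('n) * exp ((norm b)\<^sup>2 / (4 * a)))"
    unfolding 1 gauss_vec_integral[OF a] 2 by (simp add: exp_of_real[symmetric])
  finally show ?thesis by (simp only: of_real_eq_iff)
qed

lemma nn_integral_fock_measure:
  fixes F :: "complex ^ 'n \<Rightarrow> ennreal"
  assumes [measurable]: "F \<in> borel_measurable borel"
  shows "(\<integral>\<^sup>+z. F z \<partial>fock_measure) = (\<integral>\<^sup>+x. \<integral>\<^sup>+y. ennreal ((2 * pi) powr (- real CARD('n)) * exp (- ((norm x)\<^sup>2 + (norm y)\<^sup>2) / 2))
      * F (complex_vec (x, y)) \<partial>lborel \<partial>lborel)"
proof -
  have "(\<integral>\<^sup>+z. F z \<partial>fock_measure) = (\<integral>\<^sup>+z. ennreal ((2 * pi) powr (- real CARD('n)) * exp (- (norm z)\<^sup>2 / 2)) * F z \<partial>lborel)"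
    unfolding fock_measure_def by (subst nn_integral_density) auto
  also have "\<dots> = (\<integral>\<^sup>+p. ennreal ((2 * pi) powr (- real CARD('n)) * exp (- (norm (complex_vec p))\<^sup>2 / 2)) * F (complex_vec p) \<partial>(lborel \<Otimes>\<^sub>M lborel))"
    unfolding lborel_complex_vec[symmetric] by (subst nn_integral_distr) (auto simp: lborel_prod)
  also have "\<dots> = (\<integral>\<^sup>+x. \<integral>\<^sup>+y. ennreal ((2 * pi) powr (- real CARD('n)) * exp (- (norm (complex_vec (x, y)))\<^sup>2 / 2)) * F (complex_vec (x, y)) \<partial>lborel \<partial>lborel)"
    by (rule lborel.nn_integral_fst[symmetric, where f="\<lambda>p. ennreal ((2 * pi) powr (- real CARD('n)) * exp (- (norm (complex_vec p))\<^sup>2 / 2)) * F (complex_vec p)"])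
       (simp add: lborel_prod)
  finally show ?thesis by (simp add: norm_complex_vec norm_prod_def)
qed

lemma cvec_complex_vec: "cdot (cvec u) (complex_vec (x, y)) = of_real (u \<bullet> x) + \<i> * of_real (u \<bullet> y)"
  by (simp add: cdot_def cvec_def inner_vec_def complex_eq_iff)

lemma cmod_bargmann_const_complex_vec:
  "(cmod (bargmann_const (complex_vec (x, y) :: complex ^ 'n)))\<^sup>2 = pi powr (- real CARD('n) / 2) * exp (- ((norm x)\<^sup>2 - (norm y)\<^sup>2) / 2)"
proof -
  have "Re (cdot (complex_vec (x, y)) (complex_vec (x, y))) = (norm x)\<^sup>2 - (norm y)\<^sup>2"
    unfolding norm_real_vec_sq by (simp add: cdot_def sum_subtractf power2_eq_square)
  then have "(cmod (exp (- cdot (complex_vec (x, y)) (complex_vec (x, y)) / 4)))\<^sup>2 = exp (- ((norm x)\<^sup>2 - (norm y)\<^sup>2) / 2)"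
    by (simp add: exp_double[symmetric] field_simps)
  moreover have "(pi powr (- real CARD('n) / 4))\<^sup>2 = pi powr (- real CARD('n) / 2)"
    by (simp add: power2_eq_square powr_add[symmetric])
  ultimately show ?thesis by (simp add: bargmann_const_def norm_mult power_mult_distrib)
qed

text \<open>For fixed real part \<open>x\<close> of \<open>z\<close> the Bargmann transform is a Fourier transform in the
  imaginary part. Plancherel's theorem in the imaginary part and a Gaussian integral over \<open>x\<close> give
  the norm of \<open>f\<close>.\<close>

lemma bargmann_isometry:
  fixes f :: "real ^ 'n \<Rightarrow> complex"
  assumes f: "f \<in> L2"
  shows "integrable fock_measure (\<lambda>z. (cmod (bargmann f z))\<^sup>2)"
    "(LINT z|fock_measure. (cmod (bargmann f z))\<^sup>2) = (l2_norm f)\<^sup>2"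
proof -
  have fm: "f \<in> borel_measurable lebesgue" using f by (rule L2_measurable)
  then obtain g where g[measurable]: "g \<in> borel_measurable borel" and fg: "AE x in lborel. f x = g x"
    by (rule lebesgue_borel_version)
  have ae: "AE x in lebesgue. f x = g x" using fg by (rule AE_completion)
  have gL: "g \<in> L2" by (rule L2_cong_AE[OF f ae])
  have Bfg: "bargmann f = bargmann g"
    by (rule bargmann_cong_coef[OF f gL coef_cong_AE[OF f ae]])
  have nfg: "l2_norm f = l2_norm g" by (rule l2_norm_cong_AE[OF f ae])
  have Bm [measurable]: "bargmann g \<in> borel_measurable borel"
    unfolding bargmann_borel[OF g, abs_def] by measurable
  let ?N = "real CARD('n)"
  have inner: "(\<integral>\<^sup>+y. ennreal ((2 * pi) powr (- ?N) * exp (- ((norm x)\<^sup>2 + (norm y)\<^sup>2) / 2)) * ennreal ((cmod (bargmann g (complex_vec (x, y))))\<^sup>2) \<partial>lborel)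
      = (\<integral>\<^sup>+u. ennreal (pi powr (- ?N / 2) * ((cmod (g u))\<^sup>2 * (exp (- (norm u)\<^sup>2) * exp (- (norm x)\<^sup>2 + x \<bullet> (2 *\<^sub>R u))))) \<partial>lborel)" for x :: "real ^ 'n"
  proof -
    \<comment> \<open>The function of which \<open>bargmann g\<close>, for fixed real part \<open>x\<close>, is the Fourier transform.\<close>
    define k where "k u = g u * of_real (exp (- (norm u)\<^sup>2 / 2 + u \<bullet> x))" for u
    have km [measurable]: "k \<in> borel_measurable borel" unfolding k_def by measurable
    have kb: "k u = g u * bargmann_kernel (cvec x) u" for u
      by (simp only: k_def bargmann_kernel_def exp_add of_real_mult) (simp add: exp_of_real[symmetric] cdot_def cvec_def inner_vec_def)
    have kk: "k u = g u * (gaussian u * exp (of_real (u \<bullet> x)))" for u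
      by (simp only: k_def exp_add of_real_mult exp_of_real)
    have k1: "integrable lebesgue k"
      unfolding kb[abs_def] by (rule bargmann_integrable[OF gL])
    have k2: "k \<in> L2"
    proof (rule L2_dominated)
      show "integrable lebesgue (\<lambda>u. exp ((norm x)\<^sup>2) * (cmod (g u))\<^sup>2)"
        using gL by (simp add: L2_sq_integrable)
      show "AE u in lebesgue. (cmod (k u))\<^sup>2 \<le> exp ((norm x)\<^sup>2) * (cmod (g u))\<^sup>2"
      proof (rule AE_I2)
        fix u
        have "0 \<le> (norm (u - x))\<^sup>2" by simp
        then have "2 * (- (norm u)\<^sup>2 / 2 + u \<bullet> x) \<le> (norm x)\<^sup>2"
          by (simp add: power2_norm_eq_inner inner_diff inner_commute)
        then have "(exp (- (norm u)\<^sup>2 / 2 + u \<bullet> x))\<^sup>2 \<le> exp ((norm x)\<^sup>2)"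
          by (simp add: exp_double[symmetric])
        then show "(cmod (k u))\<^sup>2 \<le> exp ((norm x)\<^sup>2) * (cmod (g u))\<^sup>2"
          unfolding k_def norm_mult power_mult_distrib by (simp add: mult.commute mult_left_mono)
      qed
    qed measurable
    note F = fourier_L1_L2[of 1, OF _ k1 k2, simplified]
    have Bk: "bargmann g (complex_vec (x, y)) = bargmann_const (complex_vec (x, y)) * (of_real ((2 * pi) powr (?N / 2)) * fourier_L1 1 k y)" for y
    proof -
      have "of_real ((2 * pi) powr (?N / 2)) * fourier_L1 1 k y = (LINT u|lebesgue. fourier_char u y * k u)"
        by (simp add: fourier_L1_def powr_minus field_simps flip: of_real_mult)
      also have "\<dots> = (LINT u|lebesgue. g u * bargmann_kernel (complex_vec (x, y)) u)"
        by (intro Bochner_Integration.integral_cong)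
           (auto simp: kk bargmann_kernel_def cvec_complex_vec exp_add mult_ac)
      finally show ?thesis by (simp add: bargmann_eq)
    qed
    have "(2 * pi) powr (- ?N) * exp (- ((norm x)\<^sup>2 + (norm y)\<^sup>2) / 2) * (cmod (bargmann g (complex_vec (x, y))))\<^sup>2
       = pi powr (- ?N / 2) * exp (- (norm x)\<^sup>2) * (cmod (fourier_L1 1 k y))\<^sup>2" for y
    proof -
      have "(cmod (bargmann g (complex_vec (x, y))))\<^sup>2 = pi powr (- ?N / 2) * exp (- ((norm x)\<^sup>2 - (norm y)\<^sup>2) / 2) * (((2 * pi) powr (?N / 2))\<^sup>2 * (cmod (fourier_L1 1 k y))\<^sup>2)"
        unfolding Bk norm_mult power_mult_distrib cmod_bargmann_const_complex_vec by simp
      also have "((2 * pi) powr (?N / 2))\<^sup>2 = (2 * pi) powr ?N"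
        by (simp add: power2_eq_square powr_add[symmetric])
      finally have "(2 * pi) powr (- ?N) * exp (- ((norm x)\<^sup>2 + (norm y)\<^sup>2) / 2) * (cmod (bargmann g (complex_vec (x, y))))\<^sup>2
        = ((2 * pi) powr (- ?N) * (2 * pi) powr ?N) * (exp (- ((norm x)\<^sup>2 + (norm y)\<^sup>2) / 2) * exp (- ((norm x)\<^sup>2 - (norm y)\<^sup>2) / 2)) * (pi powr (- ?N / 2) * (cmod (fourier_L1 1 k y))\<^sup>2)"
        by (simp only: mult_ac)
      also have "(2 * pi) powr (- ?N) * (2 * pi) powr ?N = 1" by (simp add: powr_add[symmetric])
      also have "exp (- ((norm x)\<^sup>2 + (norm y)\<^sup>2) / 2) * exp (- ((norm x)\<^sup>2 - (norm y)\<^sup>2) / 2) = exp (- (norm x)\<^sup>2)"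
        unfolding mult_exp_exp by (simp add: field_simps)
      finally show ?thesis by (simp add: mult_ac)
    qed
    then have "(\<integral>\<^sup>+y. ennreal ((2 * pi) powr (- ?N) * exp (- ((norm x)\<^sup>2 + (norm y)\<^sup>2) / 2)) * ennreal ((cmod (bargmann g (complex_vec (x, y))))\<^sup>2) \<partial>lborel)
       = (\<integral>\<^sup>+y. ennreal (pi powr (- ?N / 2) * exp (- (norm x)\<^sup>2)) * ennreal ((cmod (fourier_L1 1 k y))\<^sup>2) \<partial>lebesgue)"
      unfolding nn_integral_completion by (simp flip: ennreal_mult)
    also have "\<dots> = ennreal (pi powr (- ?N / 2) * exp (- (norm x)\<^sup>2)) * ennreal ((l2_norm (fourier_L1 1 k))\<^sup>2)"
      using L2_measurable[OF F(1)] by (subst nn_integral_cmult) (auto simp: l2_norm_nn[OF F(1)])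
    also have "l2_norm (fourier_L1 1 k) = l2_norm k"
      by (rule l2_norm_eq_of_coef[OF F(1) k2]) (simp add: F(2) norm_mult cmod_fourier_phase)
    also have "ennreal ((l2_norm k)\<^sup>2) = (\<integral>\<^sup>+u. ennreal ((cmod (k u))\<^sup>2) \<partial>lborel)"
      unfolding l2_norm_nn[OF k2, symmetric] by (rule nn_integral_completion)
    also have "ennreal (pi powr (- ?N / 2) * exp (- (norm x)\<^sup>2)) * (\<integral>\<^sup>+u. ennreal ((cmod (k u))\<^sup>2) \<partial>lborel)
      = (\<integral>\<^sup>+u. ennreal (pi powr (- ?N / 2) * exp (- (norm x)\<^sup>2)) * ennreal ((cmod (k u))\<^sup>2) \<partial>lborel)"
      by (rule nn_integral_cmult[symmetric]) measurable
    also have "\<dots> = (\<integral>\<^sup>+u. ennreal (pi powr (- ?N / 2) * ((cmod (g u))\<^sup>2 * (exp (- (norm u)\<^sup>2) * exp (- (norm x)\<^sup>2 + x \<bullet> (2 *\<^sub>R u))))) \<partial>lborel)"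
    proof (rule nn_integral_cong)
      fix u
      have "exp (- (norm x)\<^sup>2) * (exp (- (norm u)\<^sup>2 / 2 + u \<bullet> x))\<^sup>2 = exp (- (norm u)\<^sup>2) * exp (- (norm x)\<^sup>2 + x \<bullet> (2 *\<^sub>R u))"
        by (simp add: exp_double[symmetric] mult_exp_exp inner_commute algebra_simps)
      then have "(pi powr (- ?N / 2) * exp (- (norm x)\<^sup>2)) * (cmod (k u))\<^sup>2 = pi powr (- ?N / 2) * ((cmod (g u))\<^sup>2 * (exp (- (norm u)\<^sup>2) * exp (- (norm x)\<^sup>2 + x \<bullet> (2 *\<^sub>R u))))"
        by (simp add: k_def norm_mult power_mult_distrib mult_ac)
      then show "ennreal (pi powr (- ?N / 2) * exp (- (norm x)\<^sup>2)) * ennreal ((cmod (k u))\<^sup>2)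
          = ennreal (pi powr (- ?N / 2) * ((cmod (g u))\<^sup>2 * (exp (- (norm u)\<^sup>2) * exp (- (norm x)\<^sup>2 + x \<bullet> (2 *\<^sub>R u)))))"
        by (simp flip: ennreal_mult)
    qed
    finally show ?thesis .
  qed
  have nn: "(\<integral>\<^sup>+z. ennreal ((cmod (bargmann g z))\<^sup>2) \<partial>fock_measure) = ennreal ((l2_norm g)\<^sup>2)"
  proof -
    have "(\<integral>\<^sup>+z. ennreal ((cmod (bargmann g z))\<^sup>2) \<partial>fock_measure)
      = (\<integral>\<^sup>+x. \<integral>\<^sup>+u. ennreal (pi powr (- ?N / 2) * ((cmod (g u))\<^sup>2 * (exp (- (norm u)\<^sup>2) * exp (- (norm x)\<^sup>2 + x \<bullet> (2 *\<^sub>R u))))) \<partial>lborel \<partial>(lborel :: (real ^ 'n) measure))"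
    proof -
      have m: "(\<lambda>z. ennreal ((cmod (bargmann g z))\<^sup>2)) \<in> borel_measurable borel" by measurable
      show ?thesis unfolding nn_integral_fock_measure[OF m] inner ..
    qed
    also have "\<dots> = (\<integral>\<^sup>+u. \<integral>\<^sup>+x. ennreal (pi powr (- ?N / 2) * ((cmod (g u))\<^sup>2 * (exp (- (norm u)\<^sup>2) * exp (- (norm x)\<^sup>2 + x \<bullet> (2 *\<^sub>R u))))) \<partial>(lborel :: (real ^ 'n) measure) \<partial>lborel)"
      by (rule lborel_pair.Fubini') measurable
    also have "\<dots> = (\<integral>\<^sup>+u. ennreal ((cmod (g u))\<^sup>2) \<partial>lborel)"
    proof (rule nn_integral_cong)
      fix u :: "real ^ 'n"
      have G: "(\<integral>\<^sup>+x. ennreal (exp (- (norm x)\<^sup>2 + x \<bullet> (2 *\<^sub>R u))) \<partial>(lborel :: (real ^ 'n) measure)) = ennreal (sqrt pi ^ CARD('n) * exp ((norm u)\<^sup>2))"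
        using gauss_vec_real_integral[of 1 "2 *\<^sub>R u"] gauss_vec_real_integrable[of 1 "2 *\<^sub>R u"]
        by (subst nn_integral_eq_integral) (auto simp: power_mult_distrib)
      have "(\<integral>\<^sup>+x. ennreal (pi powr (- ?N / 2) * ((cmod (g u))\<^sup>2 * (exp (- (norm u)\<^sup>2) * exp (- (norm x)\<^sup>2 + x \<bullet> (2 *\<^sub>R u))))) \<partial>(lborel :: (real ^ 'n) measure))
         = (\<integral>\<^sup>+x. ennreal (pi powr (- ?N / 2) * (cmod (g u))\<^sup>2 * exp (- (norm u)\<^sup>2)) * ennreal (exp (- (norm x)\<^sup>2 + x \<bullet> (2 *\<^sub>R u))) \<partial>(lborel :: (real ^ 'n) measure))"
        by (intro nn_integral_cong) (simp add: mult.assoc flip: ennreal_mult)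
      also have "\<dots> = ennreal (pi powr (- ?N / 2) * (cmod (g u))\<^sup>2 * exp (- (norm u)\<^sup>2)) * ennreal (sqrt pi ^ CARD('n) * exp ((norm u)\<^sup>2))"
        unfolding G[symmetric] by (rule nn_integral_cmult) measurable
      also have "\<dots> = ennreal ((pi powr (- ?N / 2) * sqrt pi ^ CARD('n)) * (exp (- (norm u)\<^sup>2) * exp ((norm u)\<^sup>2)) * (cmod (g u))\<^sup>2)"
        by (subst ennreal_mult[symmetric]) (auto simp: mult_ac)
      also have "pi powr (- ?N / 2) * sqrt pi ^ CARD('n) = 1"
        by (simp add: powr_half_sqrt[symmetric] powr_powr powr_realpow[symmetric] powr_add[symmetric])
      also have "exp (- (norm u)\<^sup>2) * exp ((norm u)\<^sup>2) = 1" by (simp add: mult_exp_exp)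
      finally show "(\<integral>\<^sup>+x. ennreal (pi powr (- ?N / 2) * ((cmod (g u))\<^sup>2 * (exp (- (norm u)\<^sup>2) * exp (- (norm x)\<^sup>2 + x \<bullet> (2 *\<^sub>R u))))) \<partial>(lborel :: (real ^ 'n) measure))
         = ennreal ((cmod (g u))\<^sup>2)" by simp
    qed
    also have "\<dots> = ennreal ((l2_norm g)\<^sup>2)"
      unfolding l2_norm_nn[OF gL, symmetric] by (rule nn_integral_completion[symmetric])
    finally show ?thesis .
  qed
  have fmeas: "(\<lambda>z. (cmod (bargmann g z))\<^sup>2) \<in> borel_measurable fock_measure"
    unfolding fock_measure_def by measurable
  show i: "integrable fock_measure (\<lambda>z. (cmod (bargmann f z))\<^sup>2)"
    unfolding Bfg using nn fmeas by (intro integrableI_bounded) auto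
  have "ennreal (LINT z|fock_measure. (cmod (bargmann g z))\<^sup>2) = ennreal ((l2_norm g)\<^sup>2)"
    unfolding nn[symmetric] using i by (intro nn_integral_eq_integral[symmetric]) (auto simp: Bfg)
  then show "(LINT z|fock_measure. (cmod (bargmann f z))\<^sup>2) = (l2_norm f)\<^sup>2"
    unfolding Bfg nfg by simp
qed

lemma polarization: "a * cnj b = (of_real ((cmod (a + b))\<^sup>2) - of_real ((cmod (a - b))\<^sup>2) + \<i> * of_real ((cmod (a + \<i> * b))\<^sup>2) - \<i> * of_real ((cmod (a - \<i> * b))\<^sup>2)) / 4"
  unfolding complex_norm_square by (simp add: algebra_simps)

lemma integral_polarization:
  fixes a b c d :: "'a \<Rightarrow> complex"
  assumes "integrable M a" "integrable M b" "integrable M c" "integrable M d"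
  shows "(LINT x|M. (a x - b x + \<i> * c x - \<i> * d x) / 4)
    = (integral\<^sup>L M a - integral\<^sup>L M b + \<i> * integral\<^sup>L M c - \<i> * integral\<^sup>L M d) / 4"
  using assms by simp

text \<open>Polarization of the isometry on both sides.\<close>

lemma bargmann_inner:
  assumes f: "f \<in> L2" and g: "g \<in> L2"
  shows "l2_inner f g = (LINT z|fock_measure. bargmann f z * cnj (bargmann g z))"
proof -
  have ig: "(\<lambda>x. \<i> * g x) \<in> L2" using g by auto
  note L = L2_add[OF f g] L2_diff[OF f g] L2_add[OF f ig] L2_diff[OF f ig]
  have B: "bargmann f z * cnj (bargmann g z) = (of_real ((cmod (bargmann (\<lambda>x. f x + g x) z))\<^sup>2)
     - of_real ((cmod (bargmann (\<lambda>x. f x - g x) z))\<^sup>2) + \<i> * of_real ((cmod (bargmann (\<lambda>x. f x + \<i> * g x) z))\<^sup>2)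
     - \<i> * of_real ((cmod (bargmann (\<lambda>x. f x - \<i> * g x) z))\<^sup>2)) / 4" for z
    unfolding bargmann_add[OF f g] bargmann_diff[OF f g] bargmann_add[OF f ig] bargmann_diff[OF f ig] bargmann_cmult
    by (rule polarization)
  have I: "integrable fock_measure (\<lambda>z. complex_of_real ((cmod (bargmann h z))\<^sup>2))"
    "(LINT z|fock_measure. complex_of_real ((cmod (bargmann h z))\<^sup>2)) = of_real ((l2_norm h)\<^sup>2)" if "h \<in> L2" for h :: "real ^ 'a \<Rightarrow> complex"
    using bargmann_isometry[OF that] by (auto simp del: of_real_power)
  have "(LINT z|fock_measure. bargmann f z * cnj (bargmann g z))
    = (of_real ((l2_norm (\<lambda>x. f x + g x))\<^sup>2) - of_real ((l2_norm (\<lambda>x. f x - g x))\<^sup>2)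
      + \<i> * of_real ((l2_norm (\<lambda>x. f x + \<i> * g x))\<^sup>2) - \<i> * of_real ((l2_norm (\<lambda>x. f x - \<i> * g x))\<^sup>2)) / 4"
    unfolding B integral_polarization[OF I(1)[OF L(1)] I(1)[OF L(2)] I(1)[OF L(3)] I(1)[OF L(4)]]
      I(2)[OF L(1)] I(2)[OF L(2)] I(2)[OF L(3)] I(2)[OF L(4)] ..
  also have "\<dots> = l2_inner f g"
  proof -
    have J: "integrable lebesgue (\<lambda>x. complex_of_real ((cmod (h x))\<^sup>2))"
      "(LINT x|lebesgue. complex_of_real ((cmod (h x))\<^sup>2)) = of_real ((l2_norm h)\<^sup>2)" if "h \<in> L2" for h :: "real ^ 'a \<Rightarrow> complex"
      using L2_sq_integrable[OF that] by (auto simp: l2_norm_sq simp del: of_real_power)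
    show ?thesis
      unfolding l2_inner_def polarization integral_polarization[OF J(1)[OF L(1)] J(1)[OF L(2)] J(1)[OF L(3)] J(1)[OF L(4)]]
        J(2)[OF L(1)] J(2)[OF L(2)] J(2)[OF L(3)] J(2)[OF L(4)] ..
  qed
  finally show ?thesis ..
qed

text \<open>By isometry \<open>f\<close> itself satisfies the condition that defines the adjoint, and testing with the
  Hermite functions shows that any two solutions have the same coefficients.\<close>

lemma bargmann_adjoint_bargmann:
  assumes f: "f \<in> L2"
  shows "bargmann_adjoint (bargmann f) \<in> L2" "coef (bargmann_adjoint (bargmann f)) \<alpha> = coef f \<alpha>"
proof -
  let ?P = "\<lambda>h. h \<in> L2 \<and> (\<forall>g\<in>L2. l2_inner h g = (LINT z|fock_measure. bargmann f z * cnj (bargmann g z)))"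
  have "?P f" using f bargmann_inner[OF f] by auto
  then have *: "?P (bargmann_adjoint (bargmann f))"
    unfolding bargmann_adjoint_def by (rule someI[of ?P])
  then show "bargmann_adjoint (bargmann f) \<in> L2" by blast
  show "coef (bargmann_adjoint (bargmann f)) \<alpha> = coef f \<alpha>"
    unfolding coef_def using * bargmann_inner[OF f] by auto
qed


section \<open>Mean value property in the Fock space\<close>

lemma holomorphic_circle_mean:
  fixes f :: "complex \<Rightarrow> complex"
  assumes f: "f holomorphic_on UNIV"
  shows "set_integrable lborel {0..2 * pi} (\<lambda>t. f (cis t))" (is ?A)
    "(LBINT t:{0..2 * pi}. f (cis t)) = 2 * pi * f 0" (is ?B)
proof -
  have c: "continuous_on {0..2 * pi} (\<lambda>t. f (cis t))"
  proof -
    have 1: "continuous_on {0..2 * pi} cis" by (intro continuous_intros)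
    have "continuous_on (cis ` {0..2 * pi}) f"
      using holomorphic_on_imp_continuous_on[OF f] by (rule continuous_on_subset) simp
    from continuous_on_compose[OF 1 this] show ?thesis by (simp add: o_def)
  qed
  show i: ?A by (rule borel_integrable_atLeastAtMost'[OF c])
  have "((\<lambda>u. f u / (u - 0)) has_contour_integral (2 * of_real pi * \<i> * f 0)) (circlepath 0 1)"
    by (rule Cauchy_integral_circlepath_simple) (use f in \<open>auto intro: holomorphic_on_subset\<close>)
  then have "((\<lambda>t. f (cis t) / cis t * \<i> * cis t) has_integral (2 * of_real pi * \<i> * f 0)) {0..2 * pi}"
    unfolding circlepath_def by (subst (asm) has_contour_integral_part_circlepath_iff) auto
  moreover have "f (cis t) / cis t * \<i> * cis t = \<i> * f (cis t)" for t
    by simp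
  ultimately have "((\<lambda>t. \<i> * f (cis t)) has_integral (2 * of_real pi * \<i> * f 0)) {0..2 * pi}" by (simp add: mult.commute)
  from has_integral_mult_right[OF this, of "- \<i>"]
  have "((\<lambda>t. f (cis t)) has_integral (2 * pi * f 0)) {0..2 * pi}" by (simp add: mult_ac)
  then show ?B using set_borel_integral_eq_integral(2)[OF i] by (simp add: integral_unique)
qed

lemma entire_along_line:
  assumes H: "entire H"
  shows "(\<lambda>t. H (t *s z)) holomorphic_on UNIV"
proof -
  have "\<exists>d. ((\<lambda>t. H (t *s z)) has_field_derivative d) (at t)" for t
  proof -
    obtain D where D: "(H has_derivative D) (at (t *s z))" "\<And>c v. D (c *s v) = c * D v"
      using H unfolding entire_def by blast
    have "((\<lambda>t. t *s z) has_derivative (\<lambda>t. t *s z)) (at t)"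
      by (rule bounded_linear_imp_has_derivative)
         (auto simp: linear_conv_bounded_linear[symmetric] vec_eq_iff algebra_simps intro!: linearI)
    from has_derivative_compose[OF this D(1)]
    have "((\<lambda>t. H (t *s z)) has_derivative (\<lambda>h. D (h *s z))) (at t)" .
    then show ?thesis
      unfolding D(2) by (auto simp: has_field_derivative_def mult.commute[of _ "D z"] intro!: exI[of _ "D z"])
  qed
  then show ?thesis by (auto simp: holomorphic_on_def field_differentiable_def)
qed

lemma entire_continuous: "entire H \<Longrightarrow> continuous_on UNIV H"
  unfolding entire_def continuous_on_eq_continuous_at[OF open_UNIV]
  using has_derivative_continuous by blast

lemma entire_measurable [measurable_dest]: "entire H \<Longrightarrow> H \<in> borel_measurable borel"
  by (rule borel_measurable_continuous_onI[OF entire_continuous])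

lemma integral_complex_isometry:
  fixes R :: "complex ^ 'n \<Rightarrow> complex ^ 'n" and H :: "complex ^ 'n \<Rightarrow> 'b::{banach, second_countable_topology}"
  assumes "linear R" "\<And>z. norm (R z) = norm z" "surj R"
    and [measurable]: "H \<in> borel_measurable borel"
  shows "integrable lborel (\<lambda>w. H (R w)) \<longleftrightarrow> integrable lborel H"
    "(LINT w|lborel. H (R w)) = (LINT w|lborel. H w)"
proof -
  have R: "R \<in> borel_measurable borel"
    by (intro borel_measurable_continuous_onI linear_continuous_on)
       (simp add: assms linear_conv_bounded_linear[symmetric])
  have "(LINT w|distr lborel borel R. H w) = (LINT w|lborel. H (R w))"
    using R by (subst integral_distr) auto
  then show "(LINT w|lborel. H (R w)) = (LINT w|lborel. H w)" using lborel_distr_linear_isometry[OF assms(1-3)] by simp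
  have "integrable (distr lborel borel R) H \<longleftrightarrow> integrable lborel (\<lambda>w. H (R w))"
    using R by (subst integrable_distr_eq) auto
  then show "integrable lborel (\<lambda>w. H (R w)) \<longleftrightarrow> integrable lborel H" using lborel_distr_linear_isometry[OF assms(1-3)] by simp
qed

lemma rotation_isometry:
  fixes z :: "complex ^ 'n"
  assumes "cmod c = 1"
  shows "linear (\<lambda>z::complex^'n. c *s z)" "norm (c *s z) = norm z" "surj (\<lambda>z::complex^'n. c *s z)"
proof -
  show "linear (\<lambda>z::complex^'n. c *s z)" by (rule linearI) (auto simp: vec_eq_iff algebra_simps)
  show "norm (c *s z) = norm z"
    by (rule power2_eq_imp_eq) (auto simp: norm_complex_vec_sq norm_mult assms)
  show "surj (\<lambda>z::complex^'n. c *s z)"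
  proof (rule surjI)
    have "c \<noteq> 0" using assms by auto
    then show "c *s (inverse c *s z) = z" for z :: "complex ^ 'n" by (simp add: vec_eq_iff)
  qed
qed

lemma vcnj_isometry:
  shows "linear (vcnj :: complex ^ 'n \<Rightarrow> _)" "norm (vcnj z) = norm z" "surj (vcnj :: complex ^ 'n \<Rightarrow> _)"
proof -
  show "linear (vcnj :: complex ^ 'n \<Rightarrow> _)" by (rule linearI) (auto simp: vcnj_def vec_eq_iff)
  show "norm (vcnj z) = norm z"
    by (rule power2_eq_imp_eq) (auto simp: norm_complex_vec_sq vcnj_def)
  show "surj (vcnj :: complex ^ 'n \<Rightarrow> _)"
    by (rule surjI[of _ vcnj]) (simp add: vcnj_def vec_eq_iff)
qed

definition fock_density :: "complex ^ 'n \<Rightarrow> real" where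
  "fock_density z = (2 * pi) powr (- real CARD('n)) * exp (- (norm z)\<^sup>2 / 2)"

lemma fock_density_nonneg: "fock_density z \<ge> 0"
  by (simp add: fock_density_def)

lemma measurable_fock_density [measurable]: "fock_density \<in> borel_measurable borel"
  unfolding fock_density_def by measurable

lemma fock_measure_eq: "fock_measure = density lborel (\<lambda>z. ennreal (fock_density z))"
  by (simp add: fock_measure_def fock_density_def)

lemma fock_integral:
  fixes F :: "complex ^ 'n \<Rightarrow> complex"
  assumes [measurable]: "F \<in> borel_measurable borel"
  shows "(LINT z|fock_measure. F z) = (LINT z|lborel. of_real (fock_density z) * F z)"
    "integrable fock_measure F \<longleftrightarrow> integrable lborel (\<lambda>z. of_real (fock_density z) * F z)"
  unfolding fock_measure_eq
  by (auto simp: integral_density integrable_density fock_density_nonneg scaleR_conv_of_real)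

lemma fock_integrable_real:
  fixes F :: "complex ^ 'n \<Rightarrow> real"
  assumes [measurable]: "F \<in> borel_measurable borel"
  shows "integrable fock_measure F \<longleftrightarrow> integrable lborel (\<lambda>z. fock_density z * F z)"
  unfolding fock_measure_eq
  by (auto simp: integrable_density fock_density_nonneg)

text \<open>The constant function \<open>1\<close> is the Bargmann transform of the normalized ground state, so its norm
  is \<open>1\<close> by isometry.\<close>

lemma fock_density_integral: "integrable lborel (fock_density :: complex ^ 'n \<Rightarrow> real)" "(LINT z|lborel. fock_density (z :: complex ^ 'n)) = 1"
proof -
  have n1: "l2_norm (hermite_fun (0 :: nat ^ 'n)) = 1"
    using l2_inner_self[OF hermite_fun_L2, of "0 :: nat ^ 'n"] hermite_fun_orthonormal[of 0 "0 :: nat ^ 'n"]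
    by (simp del: of_real_power) (metis l2_norm_nonneg of_real_eq_1_iff power2_eq_1_iff real_sqrt_abs abs_of_nonneg real_sqrt_one)
  have b: "bargmann (hermite_fun (0 :: nat ^ 'n)) z = 1" for z
    by (simp add: bargmann_hermite_fun fock_monomial_def)
  have i: "integrable fock_measure (\<lambda>z::complex^'n. 1::real)" "(LINT z|(fock_measure :: (complex ^ 'n) measure). (1::real)) = 1"
    using bargmann_isometry[OF hermite_fun_L2, of "0 :: nat ^ 'n"] unfolding b n1 by auto
  then show "integrable lborel (fock_density :: complex ^ 'n \<Rightarrow> real)"
    by (simp add: fock_integrable_real)
  have eq: "(LINT z|(fock_measure :: (complex ^ 'n) measure). (1::real)) = (LINT z|lborel. fock_density (z :: complex ^ 'n))"
    unfolding fock_measure_eq by (subst integral_density) (auto simp: fock_density_nonneg)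
  show "(LINT z|lborel. fock_density (z :: complex ^ 'n)) = 1" by (rule trans[OF eq[symmetric] i(2)])
qed

text \<open>The Fock measure is invariant under the rotations \<open>w \<mapsto> cis t *s w\<close>. Averaging the
  integral over \<open>t\<close> and exchanging the integrals leaves the mean of \<open>H\<close> over a circle in a
  complex line through \<open>0\<close>, which is \<open>H 0\<close> by Cauchy's formula.\<close>

lemma fock_mean_value:
  fixes H :: "complex ^ 'n \<Rightarrow> complex"
  assumes H: "entire H" and i: "integrable fock_measure H"
  shows "(LINT w|fock_measure. H w) = H 0"
proof -
  have [measurable]: "H \<in> borel_measurable borel" using H by (rule entire_measurable)
  define G where "G w = of_real (fock_density w) * H w" for w
  have [measurable]: "G \<in> borel_measurable borel" unfolding G_def by measurable
  have Gi: "integrable lborel G" using i by (simp add: fock_integral G_def[abs_def])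
  note rot = rotation_isometry[of "cis t" for t, simplified]
  have dr: "fock_density (cis t *s w) = fock_density w" for t and w :: "complex ^ 'n"
    by (simp add: fock_density_def rot(2))
  define F where "F t w = indicator {0..2 * pi} t * G (cis t *s w)" for t :: real and w
  have Fm: "case_prod F \<in> borel_measurable (lborel \<Otimes>\<^sub>M lborel)"
  proof -
    have "continuous_on UNIV (\<lambda>p::real \<times> (complex ^ 'n). cis (fst p) *s snd p)"
      unfolding vector_scalar_mult_def by (intro continuous_intros continuous_on_vec_lambda)
    then have "(\<lambda>p::real \<times> (complex ^ 'n). cis (fst p) *s snd p) \<in> borel_measurable borel"
      by (rule borel_measurable_continuous_onI)
    then have [measurable]: "(\<lambda>p::real \<times> (complex ^ 'n). cis (fst p) *s snd p) \<in> borel_measurable (lborel \<Otimes>\<^sub>M lborel)"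
      by (simp add: lborel_prod)
    show ?thesis unfolding F_def case_prod_beta by measurable
  qed
  have Gr: "integrable lborel (\<lambda>w. G (cis t *s w))" "(LINT w|lborel. G (cis t *s w)) = (LINT w|lborel. G w)"
     "(LINT w|lborel. cmod (G (cis t *s w))) = (LINT w|lborel. cmod (G w))" for t
    using integral_complex_isometry[OF rot, of G t] integral_complex_isometry[OF rot, of "\<lambda>w. cmod (G w)" t] Gi by auto
  have iF: "integrable (lborel \<Otimes>\<^sub>M lborel) (case_prod F)"
  proof (rule integrable_pair_dominated[OF Fm])
    show "integrable lborel (\<lambda>w. indicator {0..2 * pi} t * cmod (G (cis t *s w)))" for t
      using Gr by simp
    show "cmod (F t w) \<le> indicator {0..2 * pi} t * cmod (G (cis t *s w))" for t w
      by (simp add: F_def norm_mult indicator_def)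
    show "integrable lborel (\<lambda>t. indicator {0..2 * pi} t * (LINT w|lborel. cmod (G w)))"
      by (intro integrable_mult_left integrable_real_indicator) auto
    show "(LINT w|lborel. indicator {0..2 * pi} t * cmod (G (cis t *s w))) \<le> indicator {0..2 * pi} t * (LINT w|lborel. cmod (G w))" for t
      using Gr(3)[of t] by simp
  qed
  have "(LINT t|lborel. LINT w|lborel. F t w) = (LINT w|lborel. LINT t|lborel. F t w)"
    by (rule lborel_pair.Fubini_integral[OF iF, symmetric])
  moreover have "(LINT w|lborel. F t w) = indicator {0..2 * pi} t * (LINT w|lborel. G w)" for t
    unfolding F_def by (simp add: Gr)
  moreover have "(LINT t|lborel. F t w) = (2 * pi * H 0) * of_real (fock_density w)" for w
  proof -
    have "F t w = of_real (fock_density w) * (indicator {0..2 * pi} t *\<^sub>R H (cis t *s w))" for t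
      by (auto simp: F_def G_def dr indicator_def)
    then have "(LINT t|lborel. F t w) = of_real (fock_density w) * (LBINT t:{0..2 * pi}. H (cis t *s w))"
      by (simp only: set_lebesgue_integral_def integral_mult_right_zero)
    also have "(LBINT t:{0..2 * pi}. H (cis t *s w)) = 2 * pi * H 0"
      using holomorphic_circle_mean(2)[OF entire_along_line[OF H, of w]] by simp
    finally show ?thesis by simp
  qed
  ultimately have "(LINT t|lborel. indicator {0..2 * pi} t * (LINT w|lborel. G w)) = (LINT w|lborel. (2 * pi * H 0) * of_real (fock_density (w :: complex ^ 'n)))"
    by simp
  also have "\<dots> = 2 * pi * H 0"
    using fock_density_integral(2)[where 'n='n] by (simp del: integral_mult_right_zero add: integral_mult_right_zero)
  also have "(LINT t|lborel. indicator {0..2 * pi} t * (LINT w|lborel. G w)) = 2 * pi * (LINT w|lborel. G w)"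
  proof -
    have "(LINT t|lborel. indicator {0..2 * pi} t * (LINT w|lborel. G w)) = (LINT t|lborel. of_real (indicator {0..2 * pi} t) * (LINT w|lborel. G w))"
      by (intro Bochner_Integration.integral_cong) (auto simp: indicator_def)
    then show ?thesis by simp
  qed
  finally have "(LINT w|lborel. G w) = H 0" by simp
  then show ?thesis by (simp add: fock_integral G_def)
qed

lemma fock_exp_integrable:
  assumes a: "a > 0"
  shows "integrable lborel (\<lambda>w::complex^'n. exp (- a * (norm w)\<^sup>2 + r * norm w))"
proof -
  let ?h = "\<lambda>x::real^'n. exp (- (a / 2) * (norm x)\<^sup>2)"
  have h: "integrable lborel ?h" using gauss_vec_real_integrable[of "a / 2" "0::real^'n"] a by simp
  have "(\<integral>\<^sup>+w. ennreal (exp (- (a / 2) * (norm w)\<^sup>2)) \<partial>(lborel :: (complex ^ 'n) measure))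
     = (\<integral>\<^sup>+p. ennreal (exp (- (a / 2) * (norm (complex_vec p))\<^sup>2)) \<partial>((lborel :: (real ^ 'n) measure) \<Otimes>\<^sub>M lborel))"
    unfolding lborel_complex_vec[symmetric] by (subst nn_integral_distr) (auto simp: lborel_prod)
  also have "\<dots> = (\<integral>\<^sup>+x. \<integral>\<^sup>+y. ennreal (exp (- (a / 2) * (norm (complex_vec (x, y)))\<^sup>2)) \<partial>lborel \<partial>(lborel :: (real ^ 'n) measure))"
    by (rule lborel.nn_integral_fst[symmetric, where f="\<lambda>p. ennreal (exp (- (a / 2) * (norm (complex_vec p))\<^sup>2))"])
       (simp add: lborel_prod)
  also have "\<dots> = (\<integral>\<^sup>+x. \<integral>\<^sup>+y. ennreal (?h x) * ennreal (?h y) \<partial>lborel \<partial>lborel)"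
    by (intro nn_integral_cong) (simp add: norm_complex_vec norm_prod_def mult_exp_exp algebra_simps flip: ennreal_mult)
  also have "\<dots> < \<infinity>"
    using h by (simp add: nn_integral_cmult nn_integral_multc nn_integral_eq_integral ennreal_mult_less_top)
  finally have i: "integrable lborel (\<lambda>w::complex^'n. exp (- (a / 2) * (norm w)\<^sup>2))"
    by (intro integrableI_bounded) auto
  show ?thesis
    by (rule Bochner_Integration.integrable_bound[OF integrable_mult_right[OF i, of "exp (r\<^sup>2 / (2 * a))"]])
       (use gauss_norm_bound[OF a] in \<open>auto simp: mult_exp_exp add.commute\<close>)
qed

lemma norm_cdot_le: "cmod (cdot z w) \<le> norm z * norm w"
proof -
  have "cmod (cdot z w) \<le> (\<Sum>j\<in>UNIV. \<bar>cmod (z $ j)\<bar> * \<bar>cmod (w $ j)\<bar>)"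
    unfolding cdot_def by (intro sum_norm_le) (simp add: norm_mult)
  also have "\<dots> \<le> norm z * norm w"
    unfolding norm_vec_def by (rule L2_set_mult_ineq)
  finally show ?thesis .
qed

lemma entire_translate_exp:
  assumes \<phi>: "entire \<phi>"
  shows "entire (\<lambda>w. \<phi> (z - w) * exp (cdot z w / 2))"
  unfolding entire_def
proof
  fix w
  obtain D where D: "(\<phi> has_derivative D) (at (z - w))" "\<And>c v. D (c *s v) = c * D v"
    using \<phi> unfolding entire_def by blast
  have lin: "bounded_linear D" using D(1) by (rule has_derivative_bounded_linear)
  have 1: "((\<lambda>w. \<phi> (z - w)) has_derivative (\<lambda>v. D (- v))) (at w)"
  proof -
    have "((\<lambda>w. z - w) has_derivative (\<lambda>v. 0 - v)) (at w)"
      by (intro has_derivative_diff has_derivative_const has_derivative_ident)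
    from has_derivative_compose[OF this, of \<phi> D] D(1) show ?thesis by simp
  qed
  have bl: "bounded_linear (\<lambda>w. cdot z w / 2)"
    by (auto simp: linear_conv_bounded_linear[symmetric] cdot_def sum.distrib scaleR_sum_right algebra_simps
        add_divide_distrib intro!: linearI)
  have 2: "((\<lambda>w. exp (cdot z w / 2)) has_derivative (\<lambda>v. exp (cdot z w / 2) * (cdot z v / 2))) (at w)"
    using has_derivative_compose[OF bounded_linear_imp_has_derivative[OF bl] DERIV_exp[unfolded has_field_derivative_def]] .
  have "((\<lambda>w. \<phi> (z - w) * exp (cdot z w / 2)) has_derivative
     (\<lambda>v. \<phi> (z - w) * (exp (cdot z w / 2) * (cdot z v / 2)) + D (- v) * exp (cdot z w / 2))) (at w)"
    by (rule has_derivative_mult[OF 1 2])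
  moreover have "D (- (c *s v)) = c * D (- v)" for c v
    using D(2)[of c "- v"] by (simp add: vector_smult_rneg)
  moreover have "cdot z (c *s v) = c * cdot z v" for c v
    by (simp add: cdot_def sum_distrib_left mult_ac)
  ultimately show "\<exists>D. ((\<lambda>w. \<phi> (z - w) * exp (cdot z w / 2)) has_derivative D) (at w) \<and> (\<forall>c v. D (c *s v) = c * D v)"
    by (intro exI[of _ "\<lambda>v. \<phi> (z - w) * (exp (cdot z w / 2) * (cdot z v / 2)) + D (- v) * exp (cdot z w / 2)"])
       (simp add: algebra_simps)
qed

text \<open>After the substitution of \<open>w\<close> for its conjugate, the integrand is entire in \<open>w\<close> with value
  \<open>\<phi> z\<close> at \<open>0\<close>. It is integrable because \<open>\<phi>\<close> is square integrable for
  the translated Gaussian measure.\<close>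

lemma S_op_one:
  fixes \<phi> :: "complex ^ 'n \<Rightarrow> complex"
  assumes \<phi>: "\<phi> \<in> fock_space"
  shows "S_op \<phi> (\<lambda>w. 1) z = \<phi> z"
proof -
  have e: "entire \<phi>" and i: "integrable fock_measure (\<lambda>z. (cmod (\<phi> z))\<^sup>2)"
    using \<phi> by (auto simp: fock_space_def)
  have [measurable]: "\<phi> \<in> borel_measurable borel" using e by (rule entire_measurable)
  define H where "H w = \<phi> (z - w) * exp (cdot z w / 2)" for w
  have He: "entire H" unfolding H_def[abs_def] by (rule entire_translate_exp[OF e])
  have [measurable]: "H \<in> borel_measurable borel" using He by (rule entire_measurable)
  have v [measurable]: "vcnj \<in> borel_measurable (borel :: (complex ^ 'n) measure)"
    by (intro borel_measurable_continuous_onI linear_continuous_on)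
       (simp add: vcnj_isometry linear_conv_bounded_linear[symmetric])
  have "S_op \<phi> (\<lambda>w. 1) z = (LINT w|fock_measure. H (vcnj w))"
    by (simp add: S_op_def H_def)
  also have "\<dots> = (LINT w|lborel. of_real (fock_density w) * H (vcnj w))"
    by (rule fock_integral) measurable
  also have "\<dots> = (LINT w|lborel. of_real (fock_density (vcnj w)) * H (vcnj w))"
    by (simp add: fock_density_def vcnj_isometry(2))
  also have "\<dots> = (LINT w|lborel. of_real (fock_density w) * H w)"
    by (rule integral_complex_isometry(2)[OF vcnj_isometry, where H="\<lambda>w. of_real (fock_density w) * H w"]) measurable
  also have "\<dots> = (LINT w|fock_measure. H w)"
    by (rule fock_integral[symmetric]) measurable
  also have "\<dots> = H 0"
  proof (rule fock_mean_value[OF He])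
    define A where "A v = fock_density v * (cmod (\<phi> v))\<^sup>2" for v
    have "integrable lborel (\<lambda>v. fock_density v * (cmod (\<phi> v))\<^sup>2)"
      using i by (subst fock_integrable_real[symmetric]) auto
    then have "integrable lborel (\<lambda>v. complex_of_real (A v))" by (simp add: A_def del: of_real_mult)
    from lborel_integrable_affine[of "-1", OF _ this, of z]
    have "integrable lborel (\<lambda>w. complex_of_real (A (z - w)))" by simp
    from integrable_Re[OF this] have A: "integrable lborel (\<lambda>w. A (z - w))" by simp
    define K where "K = (2 * pi) powr (- real CARD('n)) * exp ((norm z)\<^sup>2 / 2)"
    have iB: "integrable lborel (\<lambda>w::complex^'n. K * exp (- (1/2) * (norm w)\<^sup>2 + (2 * norm z) * norm w))"
      by (intro integrable_mult_right fock_exp_integrable) simp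
    show "integrable fock_measure H"
      unfolding fock_integral(2)[OF \<open>H \<in> borel_measurable borel\<close>]
    proof (rule Bochner_Integration.integrable_bound[OF Bochner_Integration.integrable_add[OF A iB]])
      show "AE w in lborel. norm (of_real (fock_density w) * H w) \<le> norm (A (z - w) + K * exp (- (1/2) * (norm w)\<^sup>2 + (2 * norm z) * norm w))"
      proof (rule AE_I2)
        fix w :: "complex ^ 'n"
        let ?p = "(2 * pi) powr (- real CARD('n))"
        \<comment> \<open>The integrand is split as a product of two square integrable factors.\<close>
        define X where "X = exp (- (norm (z - w))\<^sup>2 / 4) * cmod (\<phi> (z - w))"
        define Y where "Y = exp ((norm (z - w))\<^sup>2 / 4 + norm z * norm w / 2 - (norm w)\<^sup>2 / 2)"
        have "cmod (exp (cdot z w / 2)) \<le> exp (norm z * norm w / 2)"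
          using norm_cdot_le[of z w] complex_Re_le_cmod[of "cdot z w"] by simp
        then have "cmod (of_real (fock_density w) * H w) \<le> ?p * exp (- (norm w)\<^sup>2 / 2) * (cmod (\<phi> (z - w)) * exp (norm z * norm w / 2))"
          unfolding H_def norm_mult fock_density_def by (intro mult_mono) (auto simp: norm_mult)
        also have "\<dots> = ?p * (X * Y)"
          by (simp add: X_def Y_def mult_exp_exp mult_ac)
        also have "\<dots> \<le> ?p * (X\<^sup>2 + Y\<^sup>2)"
          using sum_squares_bound[of X Y] by (intro mult_left_mono) (auto simp: X_def Y_def intro: order_trans[rotated])
        also have "\<dots> \<le> A (z - w) + K * exp (- (1/2) * (norm w)\<^sup>2 + (2 * norm z) * norm w)"
        proof -
          have "X\<^sup>2 = exp (- (norm (z - w))\<^sup>2 / 2) * (cmod (\<phi> (z - w)))\<^sup>2"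
            by (simp add: X_def power_mult_distrib exp_double[symmetric])
          then have "?p * X\<^sup>2 = A (z - w)" by (simp add: A_def fock_density_def)
          moreover have "Y\<^sup>2 \<le> exp ((norm z)\<^sup>2 / 2) * exp (- (1/2) * (norm w)\<^sup>2 + (2 * norm z) * norm w)"
          proof -
            have "(norm (z - w))\<^sup>2 \<le> (norm z + norm w)\<^sup>2"
              by (intro power_mono norm_triangle_ineq4) auto
            then have "2 * ((norm (z - w))\<^sup>2 / 4 + norm z * norm w / 2 - (norm w)\<^sup>2 / 2) \<le> (norm z)\<^sup>2 / 2 + (- (1/2) * (norm w)\<^sup>2 + (2 * norm z) * norm w)"
              by (simp add: power2_sum algebra_simps)
            then show ?thesis unfolding Y_def mult_exp_exp exp_double[symmetric] by simp
          qed
          then have "?p * Y\<^sup>2 \<le> K * exp (- (1/2) * (norm w)\<^sup>2 + (2 * norm z) * norm w)"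
            unfolding K_def mult.assoc by (intro mult_left_mono) auto
          ultimately show ?thesis by (simp add: distrib_left)
        qed
        finally show "norm (of_real (fock_density w) * H w) \<le> norm (A (z - w) + K * exp (- (1/2) * (norm w)\<^sup>2 + (2 * norm z) * norm w))"
          unfolding real_norm_def by (rule order_trans[OF _ abs_ge_self])
      qed
    qed measurable
  qed
  also have "H 0 = \<phi> z" by (simp add: H_def cdot_def)
  finally show ?thesis .
qed


section \<open>The operator \<open>S\<close> with a Gauss-Bargmann symbol\<close>

lemma integral_pair_mult:
  fixes f :: "'a::euclidean_space \<Rightarrow> complex" and g :: "'b::euclidean_space \<Rightarrow> complex"
  assumes f: "integrable lborel f" and g: "integrable lborel g"
  shows "integrable (lborel \<Otimes>\<^sub>M lborel) (\<lambda>p. f (fst p) * g (snd p))"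
    "(LINT p|(lborel \<Otimes>\<^sub>M lborel). f (fst p) * g (snd p)) = integral\<^sup>L lborel f * integral\<^sup>L lborel g"
proof -
  have [measurable]: "f \<in> borel_measurable lborel" "g \<in> borel_measurable lborel" using f g by auto
  have i: "integrable (lborel \<Otimes>\<^sub>M lborel) (\<lambda>(x, y). f x * g y)"
  proof (rule integrable_pair_dominated)
    show "integrable lborel (\<lambda>y. cmod (f x) * cmod (g y))" for x using g by simp
    show "integrable lborel (\<lambda>x. cmod (f x) * (LINT y|lborel. cmod (g y)))" using f by simp
  qed (auto simp: norm_mult)
  then show "integrable (lborel \<Otimes>\<^sub>M lborel) (\<lambda>p. f (fst p) * g (snd p))"
    by (simp add: case_prod_unfold)
  have "(LINT x|lborel. LINT y|lborel. f x * g y) = (LINT p|(lborel \<Otimes>\<^sub>M lborel). f (fst p) * g (snd p))"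
    using lborel_pair.integral_fst[OF i] by (simp add: case_prod_unfold)
  then show "(LINT p|(lborel \<Otimes>\<^sub>M lborel). f (fst p) * g (snd p)) = integral\<^sup>L lborel f * integral\<^sup>L lborel g"
    by simp
qed

text \<open>The dependence on \<open>w\<close> of the integrand of \<open>S (B f) z\<close> with symbol \<open>G m\<close>, once the
  integrals over \<open>u\<close> (from \<open>B\<close>) and over \<open>\<xi>\<close> (from \<open>G\<close>) are written out.\<close>

definition wkern :: "real ^ 'n \<Rightarrow> real ^ 'n \<Rightarrow> complex ^ 'n \<Rightarrow> complex" where
  "wkern u \<xi> w = exp (- cdot w w / 4 + cdot (cvec u) w + cdot (vcnj w) (vcnj w) / 4
      - \<i> * cdot (cvec \<xi>) (vcnj w) - of_real ((norm w)\<^sup>2 / 2))"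

lemma measurable_vcnj [measurable]: "vcnj \<in> borel_measurable (borel :: (complex ^ 'n) measure)"
  by (intro borel_measurable_continuous_onI linear_continuous_on)
     (simp add: vcnj_isometry linear_conv_bounded_linear[symmetric])

text \<open>For \<open>w = x + \<i> y\<close> the terms \<open>- w\<^sup>2 / 4\<close> and \<open>cnj w\<^sup>2 / 4\<close> add up to
  \<open>- \<i> x \<bullet> y\<close>, so that the exponent is a Gaussian one in each of \<open>x\<close> and \<open>y\<close>.\<close>

lemma wkern_complex_vec:
  "wkern u \<xi> (complex_vec (x, y)) = exp (- of_real ((1/2) * (norm x)\<^sup>2) + cdot (cvec x) (cvec u - \<i> *s cvec \<xi> - \<i> *s cvec y))
     * exp (- of_real ((1/2) * (norm y)\<^sup>2) + cdot (cvec y) (\<i> *s cvec u - cvec \<xi>))"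
proof -
  have n: "(norm (complex_vec (x, y)))\<^sup>2 = (norm x)\<^sup>2 + (norm y)\<^sup>2"
    by (simp add: norm_complex_vec norm_prod_def)
  show ?thesis
    unfolding wkern_def mult_exp_exp n
    unfolding norm_real_vec_sq
    by (rule arg_cong[where f=exp])
       (simp add: cdot_def cvec_def vcnj_def complex_eq_iff sum.distrib[symmetric] sum_subtractf[symmetric]
         sum_negf[symmetric] sum_distrib_left sum_divide_distrib power2_eq_square field_simps,
        intro conjI sum.cong refl, simp_all add: field_simps)
qed

lemma norm_wkern:
  "cmod (wkern u \<xi> (complex_vec (x, y))) = exp (- (1/2) * (norm x)\<^sup>2 + x \<bullet> u) * exp (- (1/2) * (norm y)\<^sup>2 + y \<bullet> (- \<xi>))"
proof -
  have "Re (cdot (cvec x) (cvec u - \<i> *s cvec \<xi> - \<i> *s cvec y)) = x \<bullet> u"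
    "Re (cdot (cvec y) (\<i> *s cvec u - cvec \<xi>)) = y \<bullet> (- \<xi>)"
    by (simp_all add: cdot_def cvec_def inner_vec_def sum_negf)
  then show ?thesis unfolding wkern_complex_vec norm_mult norm_exp_eq_Re by simp
qed

lemma wkern_norm_integral:
  fixes u \<xi> :: "real ^ 'n"
  shows "integrable lborel (\<lambda>w. cmod (wkern u \<xi> w))"
    "(LINT w|lborel. cmod (wkern u \<xi> w)) = (2 * pi) ^ CARD('n) * exp (((norm u)\<^sup>2 + (norm \<xi>)\<^sup>2) / 2)"
proof -
  let ?f = "\<lambda>x::real^'n. complex_of_real (exp (- (1/2) * (norm x)\<^sup>2 + x \<bullet> u))"
  let ?g = "\<lambda>y::real^'n. complex_of_real (exp (- (1/2) * (norm y)\<^sup>2 + y \<bullet> (- \<xi>)))"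
  have f: "integrable lborel ?f" by (intro integrable_of_real gauss_vec_real_integrable) simp
  have g: "integrable lborel ?g" by (intro integrable_of_real gauss_vec_real_integrable) simp
  have m: "(\<lambda>w. cmod (wkern u \<xi> w)) \<in> borel_measurable borel" unfolding wkern_def by measurable
  have i: "integrable (lborel \<Otimes>\<^sub>M lborel) (\<lambda>p. complex_of_real (cmod (wkern u \<xi> (complex_vec p))))"
    using integral_pair_mult(1)[OF f g] by (subst prod.collapse[symmetric], subst norm_wkern) simp
  then have i': "integrable (lborel \<Otimes>\<^sub>M lborel) (\<lambda>p. cmod (wkern u \<xi> (complex_vec p)))"
    using integrable_Re by fastforce
  have cm: "complex_vec \<in> lborel \<Otimes>\<^sub>M lborel \<rightarrow>\<^sub>M borel" by (simp add: lborel_prod)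
  show "integrable lborel (\<lambda>w. cmod (wkern u \<xi> w))"
    using i' integrable_distr_eq[OF cm m] unfolding lborel_complex_vec by simp
  have "(LINT w|lborel. cmod (wkern u \<xi> w)) = (LINT p|(lborel \<Otimes>\<^sub>M lborel). cmod (wkern u \<xi> (complex_vec p)))"
    using integral_distr[OF cm m] unfolding lborel_complex_vec .
  then have "complex_of_real (LINT w|lborel. cmod (wkern u \<xi> w)) = (LINT p|(lborel \<Otimes>\<^sub>M lborel). complex_of_real (cmod (wkern u \<xi> (complex_vec p))))"
    by simp
  also have "\<dots> = (LINT p|(lborel \<Otimes>\<^sub>M lborel). ?f (fst p) * ?g (snd p))"
  proof (rule Bochner_Integration.integral_cong[OF refl])
    fix p :: "(real ^ 'n) \<times> (real ^ 'n)"
    show "complex_of_real (cmod (wkern u \<xi> (complex_vec p))) = ?f (fst p) * ?g (snd p)"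
      using norm_wkern[of u \<xi> "fst p" "snd p"] by simp
  qed
  also have "\<dots> = integral\<^sup>L lborel ?f * integral\<^sup>L lborel ?g" by (rule integral_pair_mult(2)[OF f g])
  also have "\<dots> = of_real ((2 * pi) ^ CARD('n) * exp (((norm u)\<^sup>2 + (norm \<xi>)\<^sup>2) / 2))"
  proof -
    have "(sqrt (2 * pi) ^ CARD('n) * exp ((norm u)\<^sup>2 / 2)) * (sqrt (2 * pi) ^ CARD('n) * exp ((norm \<xi>)\<^sup>2 / 2))
       = (sqrt (2 * pi) * sqrt (2 * pi)) ^ CARD('n) * (exp ((norm u)\<^sup>2 / 2) * exp ((norm \<xi>)\<^sup>2 / 2))"
      unfolding power_mult_distrib by (simp only: mult_ac)
    also have "\<dots> = (2 * pi) ^ CARD('n) * exp (((norm u)\<^sup>2 + (norm \<xi>)\<^sup>2) / 2)"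
      by (simp add: mult_exp_exp add_divide_distrib)
    finally show ?thesis
      using gauss_vec_real_integral[of "1/2" u] gauss_vec_real_integral[of "1/2" "- \<xi>"]
      unfolding integral_complex_of_real by (simp add: mult.commute[of pi 2] flip: of_real_mult)
  qed
  finally show "(LINT w|lborel. cmod (wkern u \<xi> w)) = (2 * pi) ^ CARD('n) * exp (((norm u)\<^sup>2 + (norm \<xi>)\<^sup>2) / 2)"
    by (simp only: of_real_eq_iff)
qed

lemma measurable_wkern [measurable]: "wkern u \<xi> \<in> borel_measurable borel"
  unfolding wkern_def by measurable

lemma cdot_add_left: "cdot (a + b) c = cdot a c + cdot b c"
  and cdot_diff_left: "cdot (a - b) c = cdot a c - cdot b c"
  and cdot_scale_left: "cdot (k *s a) c = k * cdot a c"
  and cdot_commute: "cdot a c = cdot c a"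
  by (simp_all add: cdot_def algebra_simps sum.distrib sum_subtractf sum_distrib_left)

lemma cdot_diff_right: "cdot c (a - b) = cdot c a - cdot c b"
  and cdot_add_right: "cdot c (a + b) = cdot c a + cdot c b"
  and cdot_scale_right: "cdot c (k *s a) = k * cdot c a"
  by (simp_all add: cdot_commute[of c] cdot_diff_left cdot_add_left cdot_scale_left)

lemma cdot_cvec: "cdot (cvec a) (cvec b) = of_real (a \<bullet> b)"
  by (simp add: cdot_def cvec_def inner_vec_def)

text \<open>Two Gaussian integrals, first over \<open>x\<close> and then over \<open>y\<close>. The outcome contains the
  Fourier kernel \<open>exp (- \<i> u \<bullet> \<xi>)\<close>: this is where the Fourier transform of \<open>f\<close> enters.\<close>

lemma wkern_integral:
  fixes u \<xi> :: "real ^ 'n"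
  shows "(LINT w|lborel. wkern u \<xi> w)
    = of_real (sqrt (2 * pi)) ^ CARD('n) * of_real (sqrt pi) ^ CARD('n)
      * exp (of_real ((norm u)\<^sup>2 / 2 + (norm \<xi>)\<^sup>2 / 2) - \<i> * of_real (u \<bullet> \<xi>))"
proof -
  have cm: "complex_vec \<in> lborel \<Otimes>\<^sub>M lborel \<rightarrow>\<^sub>M borel" by (simp add: lborel_prod)
  have m: "wkern u \<xi> \<in> borel_measurable borel" by measurable
  have "integrable lborel (wkern u \<xi>)"
    using wkern_norm_integral(1)[of u \<xi>] by (subst (asm) integrable_norm_iff) auto
  then have i: "integrable (lborel \<Otimes>\<^sub>M lborel) (\<lambda>(x, y). wkern u \<xi> (complex_vec (x, y)))"
    using integrable_distr_eq[OF cm m] unfolding lborel_complex_vec by (simp add: case_prod_unfold)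
  have "(LINT w|lborel. wkern u \<xi> w) = (LINT p|(lborel \<Otimes>\<^sub>M lborel). wkern u \<xi> (complex_vec p))"
    using integral_distr[OF cm m] unfolding lborel_complex_vec .
  also have "\<dots> = (LINT y|lborel. LINT x|lborel. wkern u \<xi> (complex_vec (x, y)))"
    using lborel_pair.integral_snd[OF i] by (simp add: case_prod_unfold)
  also have "\<dots> = (LINT y|lborel. (of_real (sqrt (2 * pi)) ^ CARD('n) * exp (of_real (((norm u)\<^sup>2 - (norm \<xi>)\<^sup>2) / 2) - \<i> * of_real (u \<bullet> \<xi>)))
      * exp (- of_real (1 * (norm y)\<^sup>2) + cdot (cvec y) (cvec ((-2) *\<^sub>R \<xi>))))"
  proof (rule Bochner_Integration.integral_cong[OF refl])
    fix y :: "real ^ 'n"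
    let ?b = "cvec u - \<i> *s cvec \<xi> - \<i> *s cvec y"
    have "(LINT x|lborel. wkern u \<xi> (complex_vec (x, y)))
      = of_real (sqrt (2 * pi)) ^ CARD('n) * exp (cdot ?b ?b / 2) * exp (- of_real ((1/2) * (norm y)\<^sup>2) + cdot (cvec y) (\<i> *s cvec u - cvec \<xi>))"
      unfolding wkern_complex_vec using gauss_vec_integral[of "1/2" ?b] by (simp add: mult.commute[of pi 2])
    also have "\<dots> = of_real (sqrt (2 * pi)) ^ CARD('n) * exp (cdot ?b ?b / 2 + (- of_real ((1/2) * (norm y)\<^sup>2) + cdot (cvec y) (\<i> *s cvec u - cvec \<xi>)))"
      by (simp only: exp_add mult.assoc)
    also have "cdot ?b ?b / 2 + (- of_real ((1/2) * (norm y)\<^sup>2) + cdot (cvec y) (\<i> *s cvec u - cvec \<xi>))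
       = (of_real (((norm u)\<^sup>2 - (norm \<xi>)\<^sup>2) / 2) - \<i> * of_real (u \<bullet> \<xi>)) + (- of_real (1 * (norm y)\<^sup>2) + cdot (cvec y) (cvec ((-2) *\<^sub>R \<xi>)))"
      by (simp add: cdot_diff_left cdot_diff_right cdot_add_left cdot_add_right cdot_scale_left cdot_scale_right cdot_cvec power2_norm_eq_inner inner_commute field_simps)
    finally show "(LINT x|lborel. wkern u \<xi> (complex_vec (x, y)))
      = (of_real (sqrt (2 * pi)) ^ CARD('n) * exp (of_real (((norm u)\<^sup>2 - (norm \<xi>)\<^sup>2) / 2) - \<i> * of_real (u \<bullet> \<xi>)))
      * exp (- of_real (1 * (norm y)\<^sup>2) + cdot (cvec y) (cvec ((-2) *\<^sub>R \<xi>)))"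
      by (simp only: exp_add mult.assoc)
  qed
  also have "\<dots> = (of_real (sqrt (2 * pi)) ^ CARD('n) * exp (of_real (((norm u)\<^sup>2 - (norm \<xi>)\<^sup>2) / 2) - \<i> * of_real (u \<bullet> \<xi>)))
      * (of_real (sqrt (pi / 1)) ^ CARD('n) * exp (cdot (cvec ((-2) *\<^sub>R \<xi>)) (cvec ((-2) *\<^sub>R \<xi>)) / (4 * of_real 1)))"
    unfolding integral_mult_right_zero by (subst gauss_vec_integral) simp_all
  also have "cdot (cvec ((-2) *\<^sub>R \<xi>)) (cvec ((-2) *\<^sub>R \<xi>)) / (4 * of_real 1) = of_real ((norm \<xi>)\<^sup>2)"
    by (simp add: cdot_cvec power2_norm_eq_inner)
  also have "(of_real (sqrt (2 * pi)) ^ CARD('n) * exp (of_real (((norm u)\<^sup>2 - (norm \<xi>)\<^sup>2) / 2) - \<i> * of_real (u \<bullet> \<xi>)))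
      * (of_real (sqrt (pi / 1)) ^ CARD('n) * exp (of_real ((norm \<xi>)\<^sup>2)))
    = of_real (sqrt (2 * pi)) ^ CARD('n) * of_real (sqrt pi) ^ CARD('n)
      * exp ((of_real (((norm u)\<^sup>2 - (norm \<xi>)\<^sup>2) / 2) - \<i> * of_real (u \<bullet> \<xi>)) + of_real ((norm \<xi>)\<^sup>2))"
    by (simp add: exp_add)
  also have "(of_real (((norm u)\<^sup>2 - (norm \<xi>)\<^sup>2) / 2) - \<i> * of_real (u \<bullet> \<xi>)) + of_real ((norm \<xi>)\<^sup>2)
    = of_real ((norm u)\<^sup>2 / 2 + (norm \<xi>)\<^sup>2 / 2) - \<i> * complex_of_real (u \<bullet> \<xi>)"
    by (simp add: field_simps)
  finally show ?thesis .
qed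

lemma gauss_bargmann_exponent:
  "exp (- cdot (cvec \<xi> - (\<i> / 2) *s z) (cvec \<xi> - (\<i> / 2) *s z))
    = exp (cdot z z / 4) * (of_real (exp (- (norm \<xi>)\<^sup>2)) * exp (\<i> * cdot (cvec \<xi>) z))"
proof -
  have "- cdot (cvec \<xi> - (\<i> / 2) *s z) (cvec \<xi> - (\<i> / 2) *s z) = cdot z z / 4 + (of_real (- (norm \<xi>)\<^sup>2) + \<i> * cdot (cvec \<xi>) z)"
    by (simp add: cdot_diff_left cdot_diff_right cdot_scale_left cdot_scale_right cdot_cvec power2_norm_eq_inner
        cdot_commute[of z "cvec \<xi>"] field_simps)
  then show ?thesis unfolding exp_of_real[symmetric] mult_exp_exp by (simp only:)
qed

lemma gauss_bargmann_eq:
  "gauss_bargmann m z = exp (cdot z z / 4) * (LINT \<xi>|lebesgue. m \<xi> * (of_real (exp (- (norm \<xi>)\<^sup>2)) * exp (\<i> * cdot (cvec \<xi>) z)))"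
  unfolding gauss_bargmann_def gauss_bargmann_exponent
  by (subst integral_mult_right_zero[symmetric]) (simp add: mult_ac)

text \<open>Half of the Gaussian in \<open>G\<close> belongs to \<open>B\<close>, the other half to the function.\<close>

lemma gauss_bargmann_bargmann:
  fixes m :: "real ^ 'n \<Rightarrow> complex"
  shows "gauss_bargmann m z = of_real (pi powr (real CARD('n) / 4)) * bargmann (\<lambda>\<xi>. m \<xi> * gaussian \<xi>) (\<i> *s z)"
proof -
  have c: "cdot (\<i> *s z) (\<i> *s z) = - cdot z z"
    by (simp add: cdot_scale_left cdot_scale_right)
  have "bargmann (\<lambda>\<xi>. m \<xi> * gaussian \<xi>) (\<i> *s z)
      = of_real (pi powr (- real CARD('n) / 4)) * gauss_bargmann m z"
  proof -
    have E: "m \<xi> * gaussian \<xi> * gaussian \<xi> * exp (cdot (cvec \<xi>) (\<i> *s z))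
       = m \<xi> * (of_real (exp (- (norm \<xi>)\<^sup>2)) * exp (\<i> * cdot (cvec \<xi>) z))" for \<xi>
    proof -
      have "gaussian \<xi> * gaussian \<xi> = complex_of_real (exp (- (norm \<xi>)\<^sup>2))"
        unfolding of_real_mult[symmetric] mult_exp_exp by simp
      then show ?thesis by (simp only: cdot_scale_right mult.assoc)
    qed
    show ?thesis unfolding bargmann_def gauss_bargmann_eq E c by (simp add: mult_ac)
  qed
  then show ?thesis by (simp add: powr_minus field_simps flip: of_real_mult)
qed

text \<open>The triple integral over \<open>u\<close>, \<open>\<xi>\<close> and \<open>w\<close> is in general not absolutely
  convergent, because \<open>m\<close> is only square integrable with a Gaussian weight and the decay of the Fourier
  transform of \<open>f\<close> would be lost. Therefore the order of integration is exchanged in two steps: first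
  for \<open>\<xi>\<close> and \<open>w\<close> with \<open>B f\<close> kept as a function of moderate growth, then for
  \<open>u\<close> and \<open>w\<close> with \<open>\<xi>\<close> fixed.\<close>

lemma S_op_gauss_bargmann_borel:
  fixes m f :: "real ^ 'n \<Rightarrow> complex"
  assumes m [measurable]: "m \<in> borel_measurable borel"
    and mi: "\<And>r. integrable lborel (\<lambda>\<xi>. m \<xi> * of_real (exp (- (5/8) * (norm \<xi>)\<^sup>2 + r * norm \<xi>)))"
    and f: "integrable lborel f"
    and growth: "\<And>w. cmod (bargmann f w) \<le> C * exp (r * norm w)"
  shows "S_op (gauss_bargmann m) (bargmann f) z
    = of_real (pi powr (real CARD('n) / 4)) * exp (cdot z z / 4)
      * (LINT \<xi>|lborel. m \<xi> * gaussian \<xi> * exp (\<i> * cdot (cvec \<xi>) z) * fourier_L1 (-1) f \<xi>)"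
proof -
  have fm [measurable]: "f \<in> borel_measurable borel" "f \<in> borel_measurable lborel" using f by auto
  let ?N = "CARD('n)"
  define a where "a u = f u * gaussian u" for u
  define b where "b \<xi> = m \<xi> * of_real (exp (- (norm \<xi>)\<^sup>2)) * exp (\<i> * cdot (cvec \<xi>) z)" for \<xi>
  have [measurable]: "a \<in> borel_measurable borel" "b \<in> borel_measurable borel"
    unfolding a_def b_def by measurable
  have Bf: "bargmann f w = of_real (pi powr (- real ?N / 4)) * (exp (- cdot w w / 4) * (LINT u|lborel. a u * exp (cdot (cvec u) w)))" for w
    by (simp add: bargmann_borel a_def mult.assoc)
  have Gm: "gauss_bargmann m (z - vcnj w) * exp (cdot z (vcnj w) / 2)
      = exp (cdot z z / 4) * (exp (cdot (vcnj w) (vcnj w) / 4) * (LINT \<xi>|lborel. b \<xi> * exp (- \<i> * cdot (cvec \<xi>) (vcnj w))))" for w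
  proof -
    have e: "exp (cdot (z - vcnj w) (z - vcnj w) / 4) * exp (cdot z (vcnj w) / 2) = exp (cdot z z / 4) * exp (cdot (vcnj w) (vcnj w) / 4)"
    proof -
      have "cdot (z - vcnj w) (z - vcnj w) / 4 + cdot z (vcnj w) / 2 = cdot z z / 4 + cdot (vcnj w) (vcnj w) / 4"
        by (simp add: cdot_diff_left cdot_diff_right cdot_commute[of "vcnj w" z] field_simps)
      then show ?thesis by (simp only: mult_exp_exp)
    qed
    have i: "m \<xi> * (of_real (exp (- (norm \<xi>)\<^sup>2)) * exp (\<i> * cdot (cvec \<xi>) (z - vcnj w))) = b \<xi> * exp (- \<i> * cdot (cvec \<xi>) (vcnj w))" for \<xi>
      by (simp add: b_def cdot_diff_right right_diff_distrib mult_exp_exp mult.assoc)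
    have "gauss_bargmann m (z - vcnj w) * exp (cdot z (vcnj w) / 2)
      = (exp (cdot (z - vcnj w) (z - vcnj w) / 4) * exp (cdot z (vcnj w) / 2)) * (LINT \<xi>|lborel. b \<xi> * exp (- \<i> * cdot (cvec \<xi>) (vcnj w)))"
      unfolding gauss_bargmann_eq i by (subst integral_completion) (auto simp: mult_ac)
    then show ?thesis unfolding e by (simp add: mult.assoc)
  qed
  have nrm_iz: "cmod (exp (\<i> * cdot (cvec \<xi>) z)) \<le> exp (norm z * norm \<xi>)" for \<xi> :: "real ^ 'n"
  proof -
    have "norm (cvec \<xi>) = norm \<xi>"
      by (rule power2_eq_imp_eq) (auto simp: norm_complex_vec_sq norm_real_vec_sq cvec_def)
    then show ?thesis
      using norm_cdot_le[of "cvec \<xi>" z] complex_Re_le_cmod[of "\<i> * cdot (cvec \<xi>) z"] by (simp add: norm_mult mult.commute)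
  qed
  have [measurable]: "bargmann f \<in> borel_measurable borel"
    unfolding Bf[abs_def] by measurable
  have C: "C \<ge> 0"
  proof -
    have "0 \<le> cmod (bargmann f 0)" by simp
    also have "\<dots> \<le> C" using growth[of 0] by simp
    finally show ?thesis .
  qed
  define E where "E w = exp (cdot (vcnj w) (vcnj w) / 4) * gaussian w" for w :: "complex ^ 'n"
  have [measurable]: "E \<in> borel_measurable borel" unfolding E_def by measurable
  define F where "F \<xi> w = b \<xi> * (exp (- \<i> * cdot (cvec \<xi>) (vcnj w)) * (bargmann f w * E w))" for \<xi> w
  \<comment> \<open>The coefficient \<open>3 / 8\<close> comes from splitting \<open>|\<xi> \<bullet> y|\<close>. It has to be less than \<open>1 / 2\<close> to leave Gaussian decay for \<open>m\<close>, and large enough that the rest \<open>2 / 3\<close> for \<open>y\<close> stays below \<open>3 / 4\<close>.\<close>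
  have EX: "cmod (exp (- \<i> * cdot (cvec \<xi>) (vcnj w)) * E w) \<le> exp (3 / 8 * (norm \<xi>)\<^sup>2) * exp (- (1/12) * (norm w)\<^sup>2)" for \<xi> w
  proof -
    obtain x y where w: "w = complex_vec (x, y)"
      using surj_complex_vec by (metis surj_def surj_pair)
    have n: "(norm w)\<^sup>2 = (norm x)\<^sup>2 + (norm y)\<^sup>2"
      by (simp add: w norm_complex_vec norm_prod_def)
    have 1: "Re (cdot (vcnj w) (vcnj w)) = (norm x)\<^sup>2 - (norm y)\<^sup>2"
      unfolding norm_real_vec_sq by (simp add: w vcnj_def cdot_def sum_subtractf power2_eq_square)
    have 2: "Re (- \<i> * cdot (cvec \<xi>) (vcnj w)) = - (\<xi> \<bullet> y)"
      by (simp add: w vcnj_def cvec_def cdot_def inner_vec_def sum_negf)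
    have "0 \<le> (norm (3 *\<^sub>R \<xi> + 4 *\<^sub>R y))\<^sup>2" by simp
    then have "- (\<xi> \<bullet> y) \<le> 3 / 8 * (norm \<xi>)\<^sup>2 + 2 / 3 * (norm y)\<^sup>2"
      by (simp add: power2_norm_eq_inner inner_add inner_commute)
    then have "- (\<xi> \<bullet> y) + ((norm x)\<^sup>2 - (norm y)\<^sup>2) / 4 - (norm w)\<^sup>2 / 2 \<le> 3 / 8 * (norm \<xi>)\<^sup>2 - (1/12) * (norm w)\<^sup>2"
    proof -
      have "t + (a - b) / 4 - (a + b) / 2 \<le> 3 / 8 * c - (1/12) * (a + b)"
        if "t \<le> 3 / 8 * c + 2 / 3 * b" "0 \<le> a" for a b c t :: real
        using that by (simp add: field_simps)
      from this[OF \<open>- (\<xi> \<bullet> y) \<le> _\<close> zero_le_power2] show ?thesis unfolding n .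
    qed
    moreover have "cmod (exp (- \<i> * cdot (cvec \<xi>) (vcnj w)) * E w) = exp (- (\<xi> \<bullet> y) + ((norm x)\<^sup>2 - (norm y)\<^sup>2) / 4 - (norm w)\<^sup>2 / 2)"
      unfolding E_def norm_mult norm_exp_eq_Re 2 by (simp add: 1 mult_exp_exp)
    ultimately show ?thesis by (simp add: mult_exp_exp)
  qed
  have iF: "integrable (lborel \<Otimes>\<^sub>M lborel) (case_prod F)"
  proof (rule integrable_pair_dominated)
    show "case_prod F \<in> borel_measurable (lborel \<Otimes>\<^sub>M lborel)"
      unfolding F_def case_prod_unfold by measurable
    define D where "D w = C * exp (- (1/12) * (norm w)\<^sup>2 + r * norm w)" for w :: "complex ^ 'n"
    have D: "integrable lborel D"
      unfolding D_def by (intro integrable_mult_right fock_exp_integrable) simp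
    let ?M = "\<lambda>\<xi>. cmod (m \<xi> * of_real (exp (- (5/8) * (norm \<xi>)\<^sup>2 + norm z * norm \<xi>)))"
    show "integrable lborel (\<lambda>w. ?M \<xi> * D w)" for \<xi> using D by simp
    show "integrable lborel (\<lambda>\<xi>. ?M \<xi> * (LINT w|lborel. D w))"
      by (intro integrable_mult_left integrable_norm mi)
    show "cmod (F \<xi> w) \<le> ?M \<xi> * D w" for \<xi> w
    proof -
      have "cmod (F \<xi> w) = (cmod (m \<xi>) * exp (- (norm \<xi>)\<^sup>2) * cmod (exp (\<i> * cdot (cvec \<xi>) z))) * (cmod (exp (- \<i> * cdot (cvec \<xi>) (vcnj w)) * E w) * cmod (bargmann f w))"
        by (simp add: F_def b_def norm_mult mult_ac)
      also have "\<dots> \<le> (cmod (m \<xi>) * exp (- (norm \<xi>)\<^sup>2) * exp (norm z * norm \<xi>)) * ((exp (3 / 8 * (norm \<xi>)\<^sup>2) * exp (- (1/12) * (norm w)\<^sup>2)) * (C * exp (r * norm w)))"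
        using C by (intro mult_mono EX growth nrm_iz order_refl) auto
      also have "\<dots> = (cmod (m \<xi>) * (exp (- (norm \<xi>)\<^sup>2) * exp (norm z * norm \<xi>) * exp (3 / 8 * (norm \<xi>)\<^sup>2))) * (C * (exp (- (1/12) * (norm w)\<^sup>2) * exp (r * norm w)))"
        by (simp only: mult_ac)
      also have "exp (- (norm \<xi>)\<^sup>2) * exp (norm z * norm \<xi>) * exp (3 / 8 * (norm \<xi>)\<^sup>2) = exp (- (5/8) * (norm \<xi>)\<^sup>2 + norm z * norm \<xi>)"
        unfolding mult_exp_exp by simp
      finally show ?thesis by (simp add: D_def norm_mult mult_exp_exp)
    qed
  qed simp
  let ?c = "exp (cdot z z / 4) * complex_of_real ((2 * pi) powr (- real ?N))"
  have Sm: "S_op (gauss_bargmann m) (bargmann f) z = ?c * (LINT w|lborel. LINT \<xi>|lborel. F \<xi> w)"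
  proof -
    have "S_op (gauss_bargmann m) (bargmann f) z = (LINT w|fock_measure. bargmann f w * (gauss_bargmann m (z - vcnj w) * exp (cdot z (vcnj w) / 2)))"
      by (simp add: S_op_def mult.assoc)
    also have "\<dots> = (LINT w|lborel. of_real (fock_density w) * (bargmann f w * (gauss_bargmann m (z - vcnj w) * exp (cdot z (vcnj w) / 2))))"
    proof (rule fock_integral)
      show "(\<lambda>w. bargmann f w * (gauss_bargmann m (z - vcnj w) * exp (cdot z (vcnj w) / 2))) \<in> borel_measurable borel"
        unfolding Gm by measurable
    qed
    also have "\<dots> = (LINT w|lborel. ?c * (LINT \<xi>|lborel. F \<xi> w))"
    proof (rule Bochner_Integration.integral_cong[OF refl])
      fix w :: "complex ^ 'n"
      have "(LINT \<xi>|lborel. F \<xi> w) = (LINT \<xi>|lborel. b \<xi> * exp (- \<i> * cdot (cvec \<xi>) (vcnj w))) * (bargmann f w * E w)"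
        unfolding F_def mult.assoc[symmetric, of "b _"] by (rule integral_mult_left_zero)
      then show "of_real (fock_density w) * (bargmann f w * (gauss_bargmann m (z - vcnj w) * exp (cdot z (vcnj w) / 2))) = ?c * (LINT \<xi>|lborel. F \<xi> w)"
        unfolding Gm fock_density_def E_def of_real_mult by (simp only: mult_ac)
    qed
    finally show ?thesis by (simp only: integral_mult_right_zero)
  qed
  also have "(LINT w|lborel. LINT \<xi>|lborel. F \<xi> w) = (LINT \<xi>|lborel. LINT w|lborel. F \<xi> w)"
    by (rule lborel_pair.Fubini_integral[OF iF])
  also have "\<dots> = (LINT \<xi>|lborel. (of_real (pi powr (- real ?N / 4)) * (of_real (sqrt (2 * pi)) ^ ?N * of_real (sqrt pi) ^ ?N * of_real ((2 * pi) powr (real ?N / 2))))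
       * (m \<xi> * gaussian \<xi> * exp (\<i> * cdot (cvec \<xi>) z) * fourier_L1 (-1) f \<xi>))"
  proof (rule Bochner_Integration.integral_cong[OF refl])
    fix \<xi> :: "real ^ 'n"
    define K where "K u w = a u * wkern u \<xi> w" for u w
    have FK: "exp (- \<i> * cdot (cvec \<xi>) (vcnj w)) * (bargmann f w * E w) = of_real (pi powr (- real ?N / 4)) * (LINT u|lborel. K u w)" for w
    proof -
      have "wkern u \<xi> w = exp (cdot (cvec u) w) * (exp (- \<i> * cdot (cvec \<xi>) (vcnj w)) * (exp (- cdot w w / 4) * (exp (cdot (vcnj w) (vcnj w) / 4) * gaussian w)))" for u
        unfolding wkern_def exp_of_real[symmetric] mult_exp_exp by (rule arg_cong[where f=exp]) (simp add: algebra_simps)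
      then have "K u w = (a u * exp (cdot (cvec u) w)) * (exp (- \<i> * cdot (cvec \<xi>) (vcnj w)) * (exp (- cdot w w / 4) * E w))" for u
        by (simp only: K_def E_def mult.assoc)
      then have "(LINT u|lborel. K u w) = (LINT u|lborel. a u * exp (cdot (cvec u) w)) * (exp (- \<i> * cdot (cvec \<xi>) (vcnj w)) * (exp (- cdot w w / 4) * E w))"
        by (simp only: integral_mult_left_zero)
      then show ?thesis unfolding Bf by (simp only: mult_ac)
    qed
    have iK: "integrable (lborel \<Otimes>\<^sub>M lborel) (case_prod K)"
    proof (rule integrable_pair_dominated)
      show "case_prod K \<in> borel_measurable (lborel \<Otimes>\<^sub>M lborel)"
        unfolding K_def case_prod_unfold wkern_def by measurable
      show "integrable lborel (\<lambda>w. cmod (a u) * cmod (wkern u \<xi> w))" for u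
        by (intro integrable_mult_right wkern_norm_integral)
      show "cmod (K u w) \<le> cmod (a u) * cmod (wkern u \<xi> w)" for u w by (simp add: K_def norm_mult)
      show "integrable lborel (\<lambda>u. cmod (f u) * ((2 * pi) ^ ?N * exp ((norm \<xi>)\<^sup>2 / 2)))"
        using f by simp
      show "(LINT w|lborel. cmod (a u) * cmod (wkern u \<xi> w)) \<le> cmod (f u) * ((2 * pi) ^ ?N * exp ((norm \<xi>)\<^sup>2 / 2))" for u
      proof -
        have e: "exp (- (norm u)\<^sup>2 / 2) * exp (((norm u)\<^sup>2 + (norm \<xi>)\<^sup>2) / 2) = exp ((norm \<xi>)\<^sup>2 / 2)"
          unfolding mult_exp_exp by (simp add: field_simps)
        have "(LINT w|lborel. cmod (a u) * cmod (wkern u \<xi> w))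
            = cmod (f u) * ((2 * pi) ^ ?N * (exp (- (norm u)\<^sup>2 / 2) * exp (((norm u)\<^sup>2 + (norm \<xi>)\<^sup>2) / 2)))"
          unfolding integral_mult_right_zero wkern_norm_integral by (simp add: a_def norm_mult)
        then show ?thesis unfolding e by simp
      qed
    qed
    let ?k = "of_real (sqrt (2 * pi)) ^ ?N * complex_of_real (sqrt pi) ^ ?N"
    let ?d = "m \<xi> * gaussian \<xi> * exp (\<i> * cdot (cvec \<xi>) z)"
    have bK: "b \<xi> * (LINT w|lborel. K u w) = (?k * ?d) * (exp (\<i> * of_real (-1 * (u \<bullet> \<xi>))) * f u)" for u
    proof -
      have e: "gaussian u * of_real (exp (- (norm \<xi>)\<^sup>2)) * exp (of_real ((norm u)\<^sup>2 / 2 + (norm \<xi>)\<^sup>2 / 2) - \<i> * of_real (u \<bullet> \<xi>))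
         = gaussian \<xi> * exp (\<i> * complex_of_real (-1 * (u \<bullet> \<xi>)))"
        unfolding exp_of_real[symmetric] mult_exp_exp by (rule arg_cong[where f=exp]) (simp add: field_simps)
      have "b \<xi> * (LINT w|lborel. K u w) = b \<xi> * (a u * (LINT w|lborel. wkern u \<xi> w))"
        unfolding K_def by simp
      also have "\<dots> = ?k * (f u * m \<xi> * exp (\<i> * cdot (cvec \<xi>) z)) * (gaussian u * of_real (exp (- (norm \<xi>)\<^sup>2)) * exp (of_real ((norm u)\<^sup>2 / 2 + (norm \<xi>)\<^sup>2 / 2) - \<i> * of_real (u \<bullet> \<xi>)))"
        unfolding wkern_integral a_def b_def by (simp only: mult_ac)
      finally show ?thesis unfolding e by (simp only: mult_ac)
    qed
    have "(LINT w|lborel. F \<xi> w) = b \<xi> * (of_real (pi powr (- real ?N / 4)) * (LINT w|lborel. LINT u|lborel. K u w))"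
      unfolding F_def FK by (simp only: integral_mult_right_zero)
    also have "(LINT w|lborel. LINT u|lborel. K u w) = (LINT u|lborel. LINT w|lborel. K u w)"
      by (rule lborel_pair.Fubini_integral[OF iK])
    also have "b \<xi> * (of_real (pi powr (- real ?N / 4)) * (LINT u|lborel. LINT w|lborel. K u w))
       = of_real (pi powr (- real ?N / 4)) * (LINT u|lborel. b \<xi> * (LINT w|lborel. K u w))"
      by simp
    also have "(LINT u|lborel. b \<xi> * (LINT w|lborel. K u w)) = (?k * ?d) * (LINT u|lborel. exp (\<i> * of_real (-1 * (u \<bullet> \<xi>))) * f u)"
      unfolding bK by (rule integral_mult_right_zero)
    also have "(LINT u|lborel. exp (\<i> * of_real (-1 * (u \<bullet> \<xi>))) * f u) = of_real ((2 * pi) powr (real ?N / 2)) * fourier_L1 (-1) f \<xi>"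
    proof -
      have "(LINT u|lebesgue. exp (\<i> * of_real (-1 * (u \<bullet> \<xi>))) * f u) = (LINT u|lborel. exp (\<i> * of_real (-1 * (u \<bullet> \<xi>))) * f u)"
        by (rule integral_completion) measurable
      then show ?thesis by (simp add: fourier_L1_def powr_minus field_simps flip: of_real_mult)
    qed
    finally show "(LINT w|lborel. F \<xi> w) = (of_real (pi powr (- real ?N / 4)) * (?k * of_real ((2 * pi) powr (real ?N / 2)))) * (?d * fourier_L1 (-1) f \<xi>)"
      by (simp only: mult_ac)
  qed
  also have "?c * \<dots> = of_real (pi powr (real ?N / 4)) * exp (cdot z z / 4)
      * (LINT \<xi>|lborel. m \<xi> * gaussian \<xi> * exp (\<i> * cdot (cvec \<xi>) z) * fourier_L1 (-1) f \<xi>)"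
  proof -
    have "pi powr (- real ?N / 4) * (2 * pi) powr (- real ?N) * (sqrt (2 * pi) ^ ?N * sqrt pi ^ ?N * (2 * pi) powr (real ?N / 2)) = pi powr (real ?N / 4)"
    proof -
      have 1: "sqrt (2 * pi) ^ ?N = (2 * pi) powr (real ?N / 2)" "sqrt pi ^ ?N = pi powr (real ?N / 2)"
        by (simp_all add: powr_half_sqrt[symmetric] powr_powr powr_realpow[symmetric])
      have "(2 * pi) powr (- real ?N) * ((2 * pi) powr (real ?N / 2) * (2 * pi) powr (real ?N / 2)) = 1"
        by (simp add: powr_add[symmetric])
      moreover have "pi powr (- real ?N / 4) * pi powr (real ?N / 2) = pi powr (real ?N / 4)"
        unfolding powr_add[symmetric] by simp
      moreover have "pi powr (- real ?N / 4) * (2 * pi) powr (- real ?N) * ((2 * pi) powr (real ?N / 2) * pi powr (real ?N / 2) * (2 * pi) powr (real ?N / 2))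
        = ((2 * pi) powr (- real ?N) * ((2 * pi) powr (real ?N / 2) * (2 * pi) powr (real ?N / 2))) * (pi powr (- real ?N / 4) * pi powr (real ?N / 2))"
        by (simp only: mult_ac)
      ultimately show ?thesis unfolding 1 by (simp only: mult_1_left)
    qed
    from arg_cong[OF this, of complex_of_real]
    have C: "of_real (pi powr (- real ?N / 4)) * of_real ((2 * pi) powr (- real ?N)) * (of_real (sqrt (2 * pi)) ^ ?N * of_real (sqrt pi) ^ ?N * of_real ((2 * pi) powr (real ?N / 2))) = complex_of_real (pi powr (real ?N / 4))"
      by (simp only: of_real_mult of_real_power)
    have "?c * ((of_real (pi powr (- real ?N / 4)) * (of_real (sqrt (2 * pi)) ^ ?N * of_real (sqrt pi) ^ ?N * of_real ((2 * pi) powr (real ?N / 2)))) * X)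
      = (of_real (pi powr (- real ?N / 4)) * of_real ((2 * pi) powr (- real ?N)) * (of_real (sqrt (2 * pi)) ^ ?N * of_real (sqrt pi) ^ ?N * of_real ((2 * pi) powr (real ?N / 2)))) * exp (cdot z z / 4) * X" for X
      by (simp only: mult_ac)
    then show ?thesis unfolding integral_mult_right_zero C .
  qed
  finally show ?thesis .
qed


section \<open>Fourier multipliers and bounded operators \<open>S\<close>\<close>

definition gauss_weighted :: "(real ^ 'n \<Rightarrow> complex) \<Rightarrow> real ^ 'n \<Rightarrow> complex" where
  "gauss_weighted m \<xi> = m \<xi> * gaussian \<xi>"

lemma integral_lebesgue_cong_AE:
  fixes f g h :: "'a::euclidean_space \<Rightarrow> complex"
  assumes "f \<in> borel_measurable lebesgue" "g \<in> borel_measurable lebesgue" "AE x in lebesgue. f x = g x"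
    and h: "h \<in> borel_measurable borel"
  shows "(LINT x|lebesgue. f x * h x) = (LINT x|lebesgue. g x * h x)"
proof (rule integral_cong_AE)
  have [measurable]: "h \<in> borel_measurable lebesgue" by (rule lebesgue_measurable_borel[OF h])
  show "(\<lambda>x. f x * h x) \<in> borel_measurable lebesgue" "(\<lambda>x. g x * h x) \<in> borel_measurable lebesgue"
    using assms(1,2) by measurable
  show "AE x in lebesgue. f x * h x = g x * h x" using assms(3) by eventually_elim simp
qed

lemma gauss_bargmann_cong_AE:
  assumes "m \<in> borel_measurable lebesgue" "m' \<in> borel_measurable lebesgue" "AE x in lebesgue. m x = m' x"
  shows "gauss_bargmann m = gauss_bargmann m'"
proof
  fix z
  show "gauss_bargmann m z = gauss_bargmann m' z"
    unfolding gauss_bargmann_eq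
    by (subst integral_lebesgue_cong_AE[OF assms]) auto
qed

lemma gauss_weighted_weight_integrable:
  assumes m: "gauss_weighted m \<in> L2"
  shows "integrable lebesgue (\<lambda>\<xi>. m \<xi> * of_real (exp (- (5/8) * (norm \<xi>)\<^sup>2 + r * norm \<xi>)))"
proof -
  have e: "m \<xi> * of_real (exp (- (5/8) * (norm \<xi>)\<^sup>2 + r * norm \<xi>)) = gauss_weighted m \<xi> * of_real (exp (- (1/8) * (norm \<xi>)\<^sup>2 + r * norm \<xi>))" for \<xi>
  proof -
    have "exp (- (norm \<xi>)\<^sup>2 / 2) * exp (- (1/8) * (norm \<xi>)\<^sup>2 + r * norm \<xi>) = exp (- (5/8) * (norm \<xi>)\<^sup>2 + r * norm \<xi>)"
      unfolding mult_exp_exp by (simp add: field_simps)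
    then show ?thesis unfolding gauss_weighted_def by (simp only: mult.assoc of_real_mult[symmetric])
  qed
  have "(\<lambda>\<xi>::real^'a. complex_of_real (exp (- (1/8) * (norm \<xi>)\<^sup>2 + r * norm \<xi>))) \<in> L2"
  proof (rule L2_I)
    have s: "(cmod (complex_of_real (exp (- (1/8) * (norm \<xi>)\<^sup>2 + r * norm \<xi>))))\<^sup>2 = exp (- (1/4) * (norm \<xi>)\<^sup>2 + (2 * r) * norm \<xi>)" for \<xi> :: "real ^ 'a"
      by (simp add: exp_double[symmetric] algebra_simps)
    show "integrable lebesgue (\<lambda>\<xi>::real^'a. (cmod (complex_of_real (exp (- (1/8) * (norm \<xi>)\<^sup>2 + r * norm \<xi>))))\<^sup>2)"
      unfolding s by (rule gauss_norm_integrable) simp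
  qed measurable
  from L2_mult_integrable[OF m this] show ?thesis unfolding e .
qed

lemma S_op_gauss_bargmann:
  fixes m f :: "real ^ 'n \<Rightarrow> complex"
  assumes m: "m \<in> borel_measurable lebesgue" and mL: "gauss_weighted m \<in> L2"
    and f1: "integrable lebesgue f" and f2: "f \<in> L2"
    and growth: "\<And>w. cmod (bargmann f w) \<le> C * exp (r * norm w)"
  shows "S_op (gauss_bargmann m) (bargmann f) z
    = of_real (pi powr (real CARD('n) / 4)) * exp (cdot z z / 4)
      * (LINT \<xi>|lebesgue. (gauss_weighted m \<xi> * fourier f \<xi>) * exp (\<i> * cdot (cvec \<xi>) z))"
proof -
  obtain m' where m' [measurable]: "m' \<in> borel_measurable borel" and mm: "AE x in lborel. m x = m' x"
    using m by (rule lebesgue_borel_version)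
  have fm: "f \<in> borel_measurable lebesgue" using f1 by simp
  obtain f' where f' [measurable]: "f' \<in> borel_measurable borel" and ff: "AE x in lborel. f x = f' x"
    using fm by (rule lebesgue_borel_version)
  have mm': "AE x in lebesgue. m x = m' x" and ff': "AE x in lebesgue. f x = f' x"
    using mm ff by (auto intro: AE_completion)
  have f'L: "f' \<in> L2" by (rule L2_cong_AE[OF f2 ff'])
  have f'1: "integrable lborel f'" using integrable_lebesgue_iff(1)[OF fm f' ff] f1 by simp
  have f'1': "integrable lebesgue f'" using f'1 by (subst integrable_completion) auto
  have G: "gauss_bargmann m = gauss_bargmann m'"
    by (rule gauss_bargmann_cong_AE[OF m _ mm']) measurable
  have B: "bargmann f = bargmann f'"
    by (rule bargmann_cong_coef[OF f2 f'L coef_cong_AE[OF f2 ff']])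
  have "gauss_weighted m' \<in> L2"
    by (rule L2_cong_AE[OF mL]) (use mm' in \<open>auto simp: gauss_weighted_def elim!: eventually_mono\<close>)
  from gauss_weighted_weight_integrable[OF this]
  have mi: "integrable lborel (\<lambda>\<xi>. m' \<xi> * of_real (exp (- (5/8) * (norm \<xi>)\<^sup>2 + r * norm \<xi>)))" for r
    by (subst (asm) integrable_completion) auto
  have "S_op (gauss_bargmann m) (bargmann f) z = of_real (pi powr (real CARD('n) / 4)) * exp (cdot z z / 4)
      * (LINT \<xi>|lborel. m' \<xi> * gaussian \<xi> * exp (\<i> * cdot (cvec \<xi>) z) * fourier_L1 (-1) f' \<xi>)"
    unfolding G B by (rule S_op_gauss_bargmann_borel[OF m' mi f'1 growth[unfolded B]])
  also have "(LINT \<xi>|lborel. m' \<xi> * gaussian \<xi> * exp (\<i> * cdot (cvec \<xi>) z) * fourier_L1 (-1) f' \<xi>)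
     = (LINT \<xi>|lebesgue. (gauss_weighted m \<xi> * fourier f \<xi>) * exp (\<i> * cdot (cvec \<xi>) z))"
  proof (rule integrable_lebesgue_iff(2)[symmetric])
    have [measurable]: "gauss_weighted m \<in> borel_measurable lebesgue" "fourier f \<in> borel_measurable lebesgue"
      using mL fourier_L2(1)[OF f2] by (auto intro: L2_measurable)
    show "(\<lambda>\<xi>. (gauss_weighted m \<xi> * fourier f \<xi>) * exp (\<i> * cdot (cvec \<xi>) z)) \<in> borel_measurable lebesgue"
      by measurable
    have "fourier_L1 (-1) f' = (\<lambda>y. complex_of_real ((2 * pi) powr (- real CARD('n) / 2))
      * (LINT x|lborel. exp (\<i> * complex_of_real (-1 * (x \<bullet> y))) * f' x))"
      unfolding fourier_L1_def by (subst integral_completion) auto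
    then have [measurable]: "fourier_L1 (-1) f' \<in> borel_measurable borel" by simp
    show "(\<lambda>\<xi>. m' \<xi> * gaussian \<xi> * exp (\<i> * cdot (cvec \<xi>) z) * fourier_L1 (-1) f' \<xi>) \<in> borel_measurable borel"
      by measurable
    have "AE x in lebesgue. fourier f x = fourier_L1 (-1) f' x"
      by (rule L2_coef_eq)
         (use fourier_L1_L2[OF _ f'1' f'L, of "-1"] fourier_L2[OF f2] coef_cong_AE[OF f2 ff'] in auto)
    then have "AE x in lborel. fourier f x = fourier_L1 (-1) f' x" by (simp add: AE_completion_iff)
    then show "AE \<xi> in lborel. (gauss_weighted m \<xi> * fourier f \<xi>) * exp (\<i> * cdot (cvec \<xi>) z)
      = m' \<xi> * gaussian \<xi> * exp (\<i> * cdot (cvec \<xi>) z) * fourier_L1 (-1) f' \<xi>"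
      using mm by eventually_elim (simp add: gauss_weighted_def mult_ac)
  qed
  finally show ?thesis .
qed

lemma hermite_fun_integrable: "integrable lebesgue (hermite_fun \<alpha>)"
proof -
  have "integrable lborel (hermite_fun \<alpha>)"
    using hermite_fun_exp_integrable_borel[of \<alpha> 0] by (simp add: cdot_def)
  then show ?thesis by (subst integrable_completion) auto
qed

lemma hsum_integrable: "integrable lebesgue (hsum A c)"
  unfolding hsum_def[abs_def] by (intro Bochner_Integration.integrable_sum integrable_mult_right hermite_fun_integrable)

lemma bargmann_hsum: "bargmann (hsum A c) z = (\<Sum>\<alpha>\<in>A. c \<alpha> * fock_monomial \<alpha> z)"
proof -
  have "bargmann (hsum A c) z = bargmann_const z * (\<Sum>\<alpha>\<in>A. c \<alpha> * (LINT u|lebesgue. hermite_fun \<alpha> u * bargmann_kernel z u))"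
    unfolding bargmann_eq hsum_def sum_distrib_right
    by (subst Bochner_Integration.integral_sum)
       (auto simp: mult.assoc intro!: integrable_mult_right bargmann_integrable hermite_fun_L2)
  also have "\<dots> = (\<Sum>\<alpha>\<in>A. c \<alpha> * bargmann (hermite_fun \<alpha>) z)"
    unfolding bargmann_eq sum_distrib_left by (simp add: mult_ac)
  finally show ?thesis by (simp add: bargmann_hermite_fun)
qed

definition fock_monomial_norm :: "nat ^ 'n \<Rightarrow> complex" where
  "fock_monomial_norm \<alpha> = (\<Prod>j\<in>UNIV. of_real (sqrt (2 ^ (\<alpha> $ j) * fact (\<alpha> $ j))))"

lemma fock_monomial_norm_nonzero: "fock_monomial_norm \<alpha> \<noteq> 0"
  by (simp add: fock_monomial_norm_def)

lemma fock_monomial_eq: "fock_monomial \<alpha> z = (\<Prod>j\<in>UNIV. (z $ j) ^ (\<alpha> $ j)) / fock_monomial_norm \<alpha>"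
  by (simp add: fock_monomial_def fock_monomial_norm_def prod_dividef)

text \<open>The Bargmann transform maps each Hermite function to a nonzero multiple of a monomial.\<close>

lemma holomorphic_polys_iff:
  "F \<in> holomorphic_polys \<longleftrightarrow> (\<exists>A c. finite A \<and> F = bargmann (hsum A c))"
proof
  assume "F \<in> holomorphic_polys"
  then obtain A c where A: "finite A" "F = (\<lambda>z. \<Sum>\<alpha>\<in>A. c \<alpha> * (\<Prod>j\<in>UNIV. (z $ j) ^ (\<alpha> $ j)))"
    by (auto simp: holomorphic_polys_def)
  have "F = bargmann (hsum A (\<lambda>\<alpha>. c \<alpha> * fock_monomial_norm \<alpha>))"
    unfolding A by (rule ext) (simp add: bargmann_hsum fock_monomial_eq fock_monomial_norm_nonzero)
  with A(1) show "\<exists>A c. finite A \<and> F = bargmann (hsum A c)" by blast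
next
  assume "\<exists>A c. finite A \<and> F = bargmann (hsum A c)"
  then obtain A c where A: "finite A" "F = bargmann (hsum A c)" by blast
  then have "F = (\<lambda>z. \<Sum>\<alpha>\<in>A. (c \<alpha> / fock_monomial_norm \<alpha>) * (\<Prod>j\<in>UNIV. (z $ j) ^ (\<alpha> $ j)))"
    by (simp add: fun_eq_iff bargmann_hsum fock_monomial_eq)
  with A(1) show "F \<in> holomorphic_polys"
    unfolding holomorphic_polys_def by (intro CollectI exI[of _ A] exI[of _ "\<lambda>\<alpha>. c \<alpha> / fock_monomial_norm \<alpha>"] conjI)
qed

lemma fock_monomial_growth: "cmod (fock_monomial \<alpha> z) \<le> (\<Prod>j\<in>UNIV. fact (\<alpha> $ j)) * exp (real CARD('n) * norm (z :: complex ^ 'n))"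
proof -
  have "cmod (fock_monomial \<alpha> z) \<le> (\<Prod>j\<in>(UNIV :: 'n set). fact (\<alpha> $ j) * exp (norm z))"
    unfolding fock_monomial_def prod_norm[symmetric]
  proof (rule prod_mono, safe)
    fix j
    have "1 \<le> sqrt (2 ^ (\<alpha> $ j) * fact (\<alpha> $ j))"
      using mult_mono[of 1 "2 ^ (\<alpha> $ j)" 1 "fact (\<alpha> $ j) :: real"] by (simp add: fact_ge_1)
    then have "cmod ((z $ j) ^ (\<alpha> $ j) / of_real (sqrt (2 ^ (\<alpha> $ j) * fact (\<alpha> $ j)))) \<le> cmod (z $ j) ^ (\<alpha> $ j)"
    proof -
      define q where "q = sqrt (2 ^ (\<alpha> $ j) * fact (\<alpha> $ j))"
      have "cmod ((z $ j) ^ (\<alpha> $ j) / of_real q) = cmod (z $ j) ^ (\<alpha> $ j) / \<bar>q\<bar>"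
        by (simp add: norm_divide norm_power)
      also have "\<dots> \<le> cmod (z $ j) ^ (\<alpha> $ j) / 1"
        using \<open>1 \<le> sqrt _\<close> by (intro divide_left_mono) (auto simp: q_def)
      finally show ?thesis by (simp add: q_def)
    qed
    also have "\<dots> \<le> fact (\<alpha> $ j) * exp (cmod (z $ j))"
      using power_le_exp_abs[of "cmod (z $ j)" "\<alpha> $ j"] by simp
    also have "\<dots> \<le> fact (\<alpha> $ j) * exp (norm z)"
      by (simp add: Finite_Cartesian_Product.norm_nth_le)
    finally show "cmod ((z $ j) ^ (\<alpha> $ j) / of_real (sqrt (2 ^ (\<alpha> $ j) * fact (\<alpha> $ j)))) \<le> fact (\<alpha> $ j) * exp (norm z)" .
  qed simp
  also have "\<dots> = (\<Prod>j\<in>UNIV. fact (\<alpha> $ j)) * exp (real CARD('n) * norm z)"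
    by (simp add: prod.distrib exp_of_nat_mult)
  finally show ?thesis .
qed

lemma bargmann_hsum_growth:
  obtains C r where "\<And>w :: complex ^ 'n. cmod (bargmann (hsum A c) w) \<le> C * exp (r * norm w)"
proof
  fix w :: "complex ^ 'n"
  have "cmod (bargmann (hsum A c) w) \<le> (\<Sum>\<alpha>\<in>A. cmod (c \<alpha>) * ((\<Prod>j\<in>UNIV. fact (\<alpha> $ j)) * exp (real CARD('n) * norm w)))"
    unfolding bargmann_hsum by (intro sum_norm_le) (simp add: norm_mult mult_left_mono fock_monomial_growth)
  then show "cmod (bargmann (hsum A c) w) \<le> (\<Sum>\<alpha>\<in>A. cmod (c \<alpha>) * (\<Prod>j\<in>UNIV. fact (\<alpha> $ j))) * exp (real CARD('n) * norm w)"
    by (simp add: sum_distrib_right mult.assoc)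
qed

lemma S_op_poly:
  fixes m :: "real ^ 'n \<Rightarrow> complex"
  assumes m: "m \<in> borel_measurable lebesgue" and mL: "gauss_weighted m \<in> L2"
  shows "S_op (gauss_bargmann m) (bargmann (hsum A c)) z
    = of_real (pi powr (real CARD('n) / 4)) * exp (cdot z z / 4)
      * (LINT \<xi>|lebesgue. (gauss_weighted m \<xi> * fourier (hsum A c) \<xi>) * exp (\<i> * cdot (cvec \<xi>) z))"
proof -
  obtain C r where "\<And>w :: complex ^ 'n. cmod (bargmann (hsum A c) w) \<le> C * exp (r * norm w)"
    by (rule bargmann_hsum_growth[of A c]) blast
  from S_op_gauss_bargmann[OF m mL hsum_integrable hsum_L2 this] show ?thesis .
qed

lemma bargmann_rotated:
  fixes g :: "real ^ 'n \<Rightarrow> complex"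
  shows "bargmann g (\<i> *s z) = of_real (pi powr (- real CARD('n) / 4)) * exp (cdot z z / 4)
      * (LINT \<xi>|lebesgue. gauss_weighted g \<xi> * exp (\<i> * cdot (cvec \<xi>) z))"
  by (simp add: bargmann_def cdot_scale_left cdot_scale_right gauss_weighted_def)

text \<open>The ratio between \<open>S\<close> with symbol \<open>G m\<close> and \<open>T\<^sub>m\<close> conjugated by the Bargmann
  transform; for \<open>m = 1\<close> it is the value of \<open>G m\<close>.\<close>

definition S_factor :: "'n::finite itself \<Rightarrow> complex" where
  "S_factor _ = of_real (pi powr (real CARD('n) / 2))"

lemma pi_powr_quarter: "complex_of_real (pi powr (real CARD('n::finite) / 4)) = S_factor TYPE('n) * of_real (pi powr (- real CARD('n) / 4))"
  unfolding S_factor_def of_real_mult[symmetric] powr_add[symmetric] by simp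

lemma S_factor_nonzero: "S_factor TYPE('n::finite) \<noteq> 0"
  by (simp add: S_factor_def)

text \<open>The ground state is a Gaussian and is its own Fourier transform, so applying the multiplier to it
  shows that \<open>m\<close> times a Gaussian is square integrable.\<close>

lemma hermite_multiplier_gw_L2:
  fixes m :: "real ^ 'n \<Rightarrow> complex"
  assumes m: "m \<in> hermite_multipliers s"
  shows "m \<in> borel_measurable lebesgue" "gauss_weighted m \<in> L2"
proof -
  show "m \<in> borel_measurable lebesgue" using m by (simp add: hermite_multipliers_def)
  let ?h = "hsum {0} (\<lambda>_. 1) :: real ^ 'n \<Rightarrow> complex"
  have h0: "?h = hermite_fun (0 :: nat ^ 'n)" by (simp add: hsum_def fun_eq_iff)
  have "hermite_fun (0 :: nat ^ 'n) \<in> hermite_sobolev s" unfolding h0[symmetric] by simp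
  then have mf: "(\<lambda>\<xi>. m \<xi> * fourier (hermite_fun (0 :: nat ^ 'n)) \<xi>) \<in> L2" using m by (simp add: hermite_multipliers_def)
  have ae: "AE x in lebesgue. fourier (hermite_fun 0) x = hermite_fun (0 :: nat ^ 'n) x"
  proof (rule L2_coef_eq)
    have c0: "coef (hermite_fun (0 :: nat ^ 'n)) \<alpha> = (if 0 = \<alpha> then 1 else 0)" for \<alpha>
      by (simp add: coef_def hermite_fun_orthonormal)
    show "coef (fourier (hermite_fun (0 :: nat ^ 'n))) \<alpha> = coef (hermite_fun 0) \<alpha>" for \<alpha>
      by (auto simp: fourier_L2 c0 fourier_phase_def multi_degree_def)
  qed (auto simp: fourier_L2)
  define k where "k = complex_of_real (\<Prod>j\<in>(UNIV :: 'n set). inverse (hermite_norm 0))"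
  have k: "k \<noteq> 0" using hermite_norm_pos[of 0] by (simp add: k_def)
  have h: "hermite_fun (0 :: nat ^ 'n) x = k * gaussian x" for x
  proof -
    have "complex_of_real (hermite_fun1 0 t) = of_real (inverse (hermite_norm 0)) * exp (- (of_real t)\<^sup>2 / 2)" for t
      using hermite_norm_pos[of 0] by (simp add: hermite_fun1_eq' field_simps)
    then show ?thesis
      unfolding hermite_fun_def of_real_prod zero_index exp_gauss_vec k_def by (simp only: prod.distrib)
  qed
  have "(\<lambda>x. inverse k * (m x * hermite_fun (0 :: nat ^ 'n) x)) \<in> L2"
  proof (rule L2_cmult, rule L2_cong_AE[OF mf])
    show "AE x in lebesgue. m x * fourier (hermite_fun 0) x = m x * hermite_fun (0 :: nat ^ 'n) x"
      using ae by eventually_elim simp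
  qed
  moreover have "(\<lambda>x. inverse k * (m x * hermite_fun (0 :: nat ^ 'n) x)) = gauss_weighted m"
    using k by (simp add: h gauss_weighted_def fun_eq_iff)
  ultimately show "gauss_weighted m \<in> L2" by simp
qed

lemma fock_sobolev_bargmann:
  assumes f: "f \<in> hermite_sobolev s"
  shows "bargmann f \<in> fock_sobolev s" "fock_sobolev_norm s (bargmann f) = hermite_sobolev_norm s f"
proof -
  show "bargmann f \<in> fock_sobolev s" using f by (simp add: fock_sobolev_def)
  show "fock_sobolev_norm s (bargmann f) = hermite_sobolev_norm s f"
    unfolding fock_sobolev_norm_def
    using hermite_sobolev_L2[OF f] by (intro hermite_sobolev_cong(2)[OF f] bargmann_adjoint_bargmann)
qed

lemma multiplier_op_props:
  assumes m: "m \<in> hermite_multipliers s" and f: "f \<in> hermite_sobolev s"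
  shows "(\<lambda>\<xi>. m \<xi> * fourier f \<xi>) \<in> L2" "multiplier_op m f \<in> hermite_sobolev s"
    "bargmann (multiplier_op m f) z = bargmann (\<lambda>\<xi>. m \<xi> * fourier f \<xi>) (\<i> *s z)"
proof -
  show mf: "(\<lambda>\<xi>. m \<xi> * fourier f \<xi>) \<in> L2" and "multiplier_op m f \<in> hermite_sobolev s"
    using m f by (auto simp: hermite_multipliers_def)
  show "bargmann (multiplier_op m f) z = bargmann (\<lambda>\<xi>. m \<xi> * fourier f \<xi>) (\<i> *s z)"
    unfolding multiplier_op_def by (rule bargmann_inv_fourier[OF mf])
qed

lemma bargmann_cong_AE:
  assumes "f \<in> L2" "AE x in lebesgue. f x = g x"
  shows "bargmann f = bargmann g"
  by (rule bargmann_cong_coef[OF assms(1) L2_cong_AE[OF assms] coef_cong_AE[OF assms]])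

lemma bargmann_multiplier_op_cong:
  assumes m: "m \<in> hermite_multipliers s" and g: "g \<in> hermite_sobolev s"
    and ae: "AE \<xi> in lebesgue. fourier g \<xi> = h \<xi>"
  shows "bargmann (multiplier_op m g) z = bargmann (\<lambda>\<xi>. m \<xi> * h \<xi>) (\<i> *s z)"
proof -
  have "bargmann (\<lambda>\<xi>. m \<xi> * fourier g \<xi>) = bargmann (\<lambda>\<xi>. m \<xi> * h \<xi>)"
    by (rule bargmann_cong_AE[OF multiplier_op_props(1)[OF m g]]) (use ae in \<open>auto elim!: eventually_mono\<close>)
  then show ?thesis using multiplier_op_props(3)[OF m g] by simp
qed

text \<open>The extension is \<open>T\<^sub>m\<close> conjugated by the Bargmann transform. The linearity of \<open>T\<close> has to hold
  pointwise although multipliers and adjoints are determined only almost everywhere; this works since the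
  Bargmann transform does not see null sets.\<close>

lemma S_bounded_of_multiplier:
  fixes m :: "real ^ 'n \<Rightarrow> complex"
  assumes m: "m \<in> hermite_multipliers s"
  shows "S_bounded s (gauss_bargmann m)"
proof -
  define T where "T F z = S_factor TYPE('n) * bargmann (multiplier_op m (bargmann_adjoint F)) z" for F and z :: "complex ^ 'n"
  have adj: "bargmann_adjoint (bargmann f) \<in> hermite_sobolev s" if f: "f \<in> hermite_sobolev s" for f :: "real ^ 'n \<Rightarrow> complex"
    using hermite_sobolev_L2[OF f] by (intro hermite_sobolev_cong(1)[OF f] bargmann_adjoint_bargmann)
  have Fae: "AE \<xi> in lebesgue. fourier (bargmann_adjoint (bargmann f)) \<xi> = g \<xi>"
    if f: "f \<in> L2" and g: "g \<in> L2" and c: "\<And>\<alpha>. coef g \<alpha> = fourier_phase (-1) \<alpha> * coef f \<alpha>" for f g :: "real ^ 'n \<Rightarrow> complex"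
    using f g by (intro L2_coef_eq) (auto simp: fourier_L2 bargmann_adjoint_bargmann c)
  have TB: "T (bargmann f) z = S_factor TYPE('n) * bargmann (\<lambda>\<xi>. m \<xi> * g \<xi>) (\<i> *s z)"
    if f: "f \<in> hermite_sobolev s" and g: "g \<in> L2" and c: "\<And>\<alpha>. coef g \<alpha> = fourier_phase (-1) \<alpha> * coef f \<alpha>" for f g z
    unfolding T_def
    using bargmann_multiplier_op_cong[OF m adj[OF f] Fae[OF hermite_sobolev_L2[OF f] g c]] by simp
  have TBf: "T (bargmann f) z = S_factor TYPE('n) * bargmann (\<lambda>\<xi>. m \<xi> * fourier f \<xi>) (\<i> *s z)"
    if f: "f \<in> hermite_sobolev s" for f z
    using hermite_sobolev_L2[OF f] by (intro TB[OF f] fourier_L2)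
  have TBm: "T (bargmann f) = bargmann (\<lambda>x. S_factor TYPE('n) * multiplier_op m (bargmann_adjoint (bargmann f)) x)" for f
    by (rule ext) (simp add: T_def bargmann_cmult)
  obtain C where C: "\<And>f. f \<in> hermite_sobolev s \<Longrightarrow> hermite_sobolev_norm s (multiplier_op m f) \<le> C * hermite_sobolev_norm s f"
    using m by (auto simp: hermite_multipliers_def)
  have "bounded_linear_op_fock_sobolev s T"
    unfolding bounded_linear_op_fock_sobolev_def
  proof (intro conjI ballI allI exI)
    fix F :: "complex ^ 'n \<Rightarrow> complex" assume F: "F \<in> fock_sobolev s"
    then obtain f where f: "f \<in> hermite_sobolev s" "F = bargmann f" by (auto simp: fock_sobolev_def)
    have mo: "multiplier_op m (bargmann_adjoint (bargmann f)) \<in> hermite_sobolev s"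
      by (rule multiplier_op_props(2)[OF m adj[OF f(1)]])
    note sc = hermite_sobolev_cmult[OF mo, of "S_factor TYPE('n)"]
    show "T F \<in> fock_sobolev s" unfolding f TBm by (rule fock_sobolev_bargmann(1)[OF sc(1)])
    have "fock_sobolev_norm s (T F) = cmod (S_factor TYPE('n)) * hermite_sobolev_norm s (multiplier_op m (bargmann_adjoint (bargmann f)))"
      unfolding f TBm fock_sobolev_bargmann(2)[OF sc(1)] sc(2) ..
    also have "\<dots> \<le> cmod (S_factor TYPE('n)) * (C * hermite_sobolev_norm s (bargmann_adjoint (bargmann f)))"
      by (intro mult_left_mono C adj f) simp
    finally show "fock_sobolev_norm s (T F) \<le> (cmod (S_factor TYPE('n)) * C) * fock_sobolev_norm s F"
      by (simp add: fock_sobolev_norm_def f(2) mult.assoc)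
    fix G :: "complex ^ 'n \<Rightarrow> complex" assume "G \<in> fock_sobolev s"
    then obtain g where g: "g \<in> hermite_sobolev s" "G = bargmann g" by (auto simp: fock_sobolev_def)
    have L: "f \<in> L2" "g \<in> L2" using f g by (auto intro: hermite_sobolev_L2)
    note Ff = fourier_L2[OF L(1)] and Fg = fourier_L2[OF L(2)]
    have FG: "(\<lambda>z. F z + G z) = bargmann (\<lambda>x. f x + g x)"
      by (simp add: f g fun_eq_iff bargmann_add[OF L])
    show "T (\<lambda>z. F z + G z) = (\<lambda>z. T F z + T G z)"
    proof
      fix z
      have "T (\<lambda>z. F z + G z) z = S_factor TYPE('n) * bargmann (\<lambda>\<xi>. m \<xi> * (fourier f \<xi> + fourier g \<xi>)) (\<i> *s z)"
        unfolding FG by (rule TB[OF hermite_sobolev_add[OF f(1) g(1)] L2_add[OF Ff(1) Fg(1)]])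
          (simp add: coef_add Ff Fg L distrib_left)
      also have "\<dots> = T F z + T G z"
        unfolding f(2) g(2) TBf[OF f(1)] TBf[OF g(1)] distrib_left[of "m _"]
        by (subst bargmann_add[OF multiplier_op_props(1)[OF m f(1)] multiplier_op_props(1)[OF m g(1)]])
           (simp add: distrib_left)
      finally show "T (\<lambda>z. F z + G z) z = T F z + T G z" .
    qed
  next
    fix c and F :: "complex ^ 'n \<Rightarrow> complex" assume F: "F \<in> fock_sobolev s"
    then obtain f where f: "f \<in> hermite_sobolev s" "F = bargmann f" by (auto simp: fock_sobolev_def)
    have L: "f \<in> L2" using f by (auto intro: hermite_sobolev_L2)
    note Ff = fourier_L2[OF L]
    have cF: "(\<lambda>z. c * F z) = bargmann (\<lambda>x. c * f x)"
      by (simp add: f fun_eq_iff bargmann_cmult)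
    show "T (\<lambda>z. c * F z) = (\<lambda>z. c * T F z)"
    proof
      fix z
      have "T (\<lambda>z. c * F z) z = S_factor TYPE('n) * bargmann (\<lambda>\<xi>. m \<xi> * (c * fourier f \<xi>)) (\<i> *s z)"
        unfolding cF by (rule TB[OF hermite_sobolev_cmult(1)[OF f(1)] L2_cmult[OF Ff(1)]])
          (simp add: coef_cmult Ff)
      also have "\<dots> = c * T F z"
        unfolding f(2) TBf[OF f(1)] mult.left_commute[of "m _" c] bargmann_cmult by simp
      finally show "T (\<lambda>z. c * F z) z = c * T F z" .
    qed
  qed
  moreover have "\<forall>F\<in>holomorphic_polys. T F = S_op (gauss_bargmann m) F"
  proof
    fix F :: "complex ^ 'n \<Rightarrow> complex" assume "F \<in> holomorphic_polys"
    then obtain A c where A: "finite A" "F = bargmann (hsum A c)" by (auto simp: holomorphic_polys_iff)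
    have gauss_weighted: "gauss_weighted (\<lambda>\<xi>. m \<xi> * fourier (hsum A c) \<xi>) \<xi> = gauss_weighted m \<xi> * fourier (hsum A c) \<xi>" for \<xi>
      by (simp add: gauss_weighted_def mult_ac)
    show "T F = S_op (gauss_bargmann m) F"
      unfolding A(2)
      by (rule ext) (simp add: TBf[OF hsum_sobolev[OF A(1)]] S_op_poly[OF hermite_multiplier_gw_L2[OF m]] bargmann_rotated gauss_weighted pi_powr_quarter)
  qed
  ultimately show ?thesis unfolding S_bounded_def by blast
qed

text \<open>The multiplier is read off from \<open>\<phi> = T 1\<close>. That \<open>m\<close> times the Fourier transform of
  \<open>f\<close> is square integrable for every \<open>f\<close> in the Sobolev space is not known beforehand; it is
  obtained by comparing with the Fourier transform of \<open>g\<close>, where \<open>B g = T (B f)\<close>.\<close>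

lemma multiplier_of_S_bounded:
  fixes \<phi> :: "complex ^ 'n \<Rightarrow> complex"
  assumes s: "s \<ge> 0" and \<phi>: "\<phi> \<in> fock_space" and S: "S_bounded s \<phi>"
  obtains m where "m \<in> hermite_multipliers s" "\<phi> = gauss_bargmann m"
proof -
  obtain T where T: "bounded_linear_op_fock_sobolev s T" and TS: "\<And>F. F \<in> holomorphic_polys \<Longrightarrow> T F = S_op \<phi> F"
    using S by (auto simp: S_bounded_def)
  have Tin: "T F \<in> fock_sobolev s" if "F \<in> fock_sobolev s" for F
    using T that by (auto simp: bounded_linear_op_fock_sobolev_def)
  have Tadd: "T (\<lambda>z. F z + G z) = (\<lambda>z. T F z + T G z)" if "F \<in> fock_sobolev s" "G \<in> fock_sobolev s" for F G
    using T that by (auto simp: bounded_linear_op_fock_sobolev_def)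
  obtain C where C: "\<And>F. F \<in> fock_sobolev s \<Longrightarrow> fock_sobolev_norm s (T F) \<le> C * fock_sobolev_norm s F"
    using T unfolding bounded_linear_op_fock_sobolev_def by blast
  have one: "(\<lambda>w. 1) = bargmann (hsum {0} (\<lambda>_. 1) :: real ^ 'n \<Rightarrow> complex)"
    by (simp add: fun_eq_iff bargmann_hsum fock_monomial_def)
  have "\<phi> = T (\<lambda>w. 1)"
  proof -
    have "(\<lambda>w::complex^'n. 1) \<in> holomorphic_polys" unfolding one holomorphic_polys_iff by blast
    then show ?thesis using TS S_op_one[OF \<phi>] by (simp add: fun_eq_iff)
  qed
  moreover have "(\<lambda>w::complex^'n. 1) \<in> fock_sobolev s"
    unfolding one by (rule fock_sobolev_bargmann) simp
  ultimately have "\<phi> \<in> fock_sobolev s" using Tin by simp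
  then obtain f0 where f0: "f0 \<in> hermite_sobolev s" "\<phi> = bargmann f0" by (auto simp: fock_sobolev_def)
  have f0L: "f0 \<in> L2" using f0 by (auto intro: hermite_sobolev_L2)
  note F0 = fourier_L2[OF f0L]
  define m where "m \<xi> = of_real (pi powr (- real CARD('n) / 4)) * (fourier f0 \<xi> * of_real (exp ((norm \<xi>)\<^sup>2 / 2)))" for \<xi>
  have gwm: "gauss_weighted m = (\<lambda>\<xi>. of_real (pi powr (- real CARD('n) / 4)) * fourier f0 \<xi>)"
  proof
    fix \<xi> :: "real ^ 'n"
    have "of_real (exp ((norm \<xi>)\<^sup>2 / 2)) * gaussian \<xi> = (1 :: complex)"
      unfolding of_real_mult[symmetric] mult_exp_exp by simp
    then show "gauss_weighted m \<xi> = of_real (pi powr (- real CARD('n) / 4)) * fourier f0 \<xi>"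
      unfolding gauss_weighted_def m_def by (simp only: mult.assoc) simp
  qed
  have gwL: "gauss_weighted m \<in> L2" unfolding gwm by (rule L2_cmult[OF F0(1)])
  have mm: "m \<in> borel_measurable lebesgue"
    unfolding m_def using L2_measurable[OF F0(1)] by measurable
  have \<phi>m: "\<phi> = gauss_bargmann m"
  proof
    fix z
    have "gauss_bargmann m z = of_real (pi powr (real CARD('n) / 4)) * bargmann (gauss_weighted m) (\<i> *s z)"
      unfolding gauss_bargmann_bargmann gauss_weighted_def[abs_def] ..
    also have "\<dots> = of_real (pi powr (real CARD('n) / 4)) * (of_real (pi powr (- real CARD('n) / 4)) * bargmann (fourier f0) (\<i> *s z))"
      unfolding gwm bargmann_cmult ..
    also have "\<dots> = \<phi> z"
      unfolding bargmann_fourier[OF f0L] f0(2) mult.assoc[symmetric] of_real_mult[symmetric] powr_add[symmetric] by simp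
    finally show "\<phi> z = gauss_bargmann m z" ..
  qed
  \<comment> \<open>Up to the factor \<open>kk y\<close>, these are the values at the real point \<open>y\<close> of \<open>T (bargmann f)\<close>, computed from the formula for \<open>S\<close>, and of \<open>bargmann g\<close>.\<close>
  define \<Lambda> where "\<Lambda> h y = S_factor TYPE('n) * (LINT \<xi>|lebesgue. (gauss_weighted m \<xi> * h \<xi>) * fourier_char \<xi> y)" for h and y :: "real ^ 'n"
  define \<Gamma> where "\<Gamma> h y = (LINT \<xi>|lebesgue. gauss_weighted h \<xi> * fourier_char \<xi> y)" for h and y :: "real ^ 'n"
  have cy: "\<i> * cdot (cvec \<xi>) (cvec y) = \<i> * of_real (\<xi> \<bullet> y)" for \<xi> y :: "real ^ 'n"
    by (simp add: cdot_cvec)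
  define kk where "kk y = of_real (pi powr (- real CARD('n) / 4)) * exp (cdot (cvec y) (cvec y) / 4)" for y :: "real ^ 'n"
  have kk0: "kk y \<noteq> 0" for y by (simp add: kk_def)
  have gaussL: "(\<lambda>\<xi>::real^'n. gaussian \<xi> * fourier_char \<xi> y) \<in> L2" for y
    using L2_mult_bounded[OF gauss_norm_L2[of 0], of "\<lambda>\<xi>. fourier_char \<xi> y" 1] by (simp add: mult.commute)
  have mexpL: "(\<lambda>\<xi>. gauss_weighted m \<xi> * fourier_char \<xi> y) \<in> L2" for y
    using L2_mult_bounded[OF gwL, of "\<lambda>\<xi>. fourier_char \<xi> y" 1] by (simp add: mult.commute)
  have key: "AE \<xi> in lebesgue. S_factor TYPE('n) * (m \<xi> * fourier f \<xi>) = fourier g \<xi>"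
    if f: "f \<in> hermite_sobolev s" and g: "g \<in> hermite_sobolev s" and Tg: "T (bargmann f) = bargmann g" for f g
  proof -
    have fL: "f \<in> L2" and gL: "g \<in> L2" using f g by (auto intro: hermite_sobolev_L2)
    note Ff = fourier_L2[OF fL] and Fg = fourier_L2[OF gL]
    have id: "\<Lambda> (fourier f) y = \<Gamma> (fourier g) y" for y
    proof (rule ccontr)
      assume ne: "\<Lambda> (fourier f) y \<noteq> \<Gamma> (fourier g) y"
      \<comment> \<open>Both sides are continuous in \<open>f\<close> with constants \<open>P\<close> and \<open>Q\<close>, so a Hermite sum \<open>p\<close> close to \<open>f\<close> contradicts a gap of size \<open>d\<close>.\<close>
      define P where "P = cmod (S_factor TYPE('n)) * l2_norm (\<lambda>\<xi>. gauss_weighted m \<xi> * fourier_char \<xi> y)"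
      define Q where "Q = \<bar>C\<bar> * l2_norm (\<lambda>\<xi>::real^'n. gaussian \<xi> * fourier_char \<xi> y)"
      have PQ: "P \<ge> 0" "Q \<ge> 0" by (auto simp: P_def Q_def)
      define d where "d = cmod (\<Lambda> (fourier f) y - \<Gamma> (fourier g) y)"
      have d: "d > 0" using ne by (simp add: d_def)
      define e where "e = d / (P + Q + 1)"
      have e: "e > 0" using d PQ by (simp add: e_def)
      obtain A where A: "finite A" "hermite_sobolev_norm s (\<lambda>x. f x - hsum A (coef f) x) < e"
        using sobolev_approx[OF f e] .
      define p where "p = hsum A (coef f)"
      have p: "p \<in> hermite_sobolev s" "p \<in> L2" using A by (auto simp: p_def)
      define r where "r x = f x - p x" for x
      have r: "r \<in> hermite_sobolev s" unfolding r_def by (rule hermite_sobolev_diff[OF f p(1)])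
      have rL: "r \<in> L2" using r by (rule hermite_sobolev_L2)
      have re: "hermite_sobolev_norm s r < e" using A(2) by (simp add: r_def[abs_def] p_def)
      obtain q where q: "q \<in> hermite_sobolev s" "T (bargmann r) = bargmann q"
        using Tin[OF fock_sobolev_bargmann(1)[OF r]] by (auto simp: fock_sobolev_def)
      have qL: "q \<in> L2" using q by (auto intro: hermite_sobolev_L2)
      have qe: "hermite_sobolev_norm s q \<le> \<bar>C\<bar> * e"
      proof -
        have "hermite_sobolev_norm s q = fock_sobolev_norm s (T (bargmann r))"
          unfolding q(2) by (rule fock_sobolev_bargmann(2)[OF q(1), symmetric])
        also have "\<dots> \<le> C * fock_sobolev_norm s (bargmann r)" by (rule C[OF fock_sobolev_bargmann(1)[OF r]])
        also have "\<dots> = C * hermite_sobolev_norm s r" by (simp add: fock_sobolev_bargmann(2)[OF r])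
        also have "\<dots> \<le> \<bar>C\<bar> * e" using re by (intro mult_mono) auto
        finally show ?thesis .
      qed
      have Tp: "T (bargmann p) = bargmann (\<lambda>x. g x - q x)"
      proof
        fix z
        have "bargmann f = (\<lambda>z. bargmann p z + bargmann r z)"
          by (simp add: r_def[abs_def] bargmann_diff[OF fL p(2)] fun_eq_iff)
        then have "bargmann g = (\<lambda>z. T (bargmann p) z + bargmann q z)"
          using Tadd[OF fock_sobolev_bargmann(1)[OF p(1)] fock_sobolev_bargmann(1)[OF r]] Tg q(2) by simp
        from fun_cong[OF this, of z] show "T (bargmann p) z = bargmann (\<lambda>x. g x - q x) z" by (simp add: bargmann_diff[OF gL qL])
      qed
      have gqL: "(\<lambda>x. g x - q x) \<in> L2" using gL qL by auto
      have "bargmann p \<in> holomorphic_polys" unfolding holomorphic_polys_iff p_def using A(1) by blast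
      then have "T (bargmann p) (cvec y) = S_op \<phi> (bargmann p) (cvec y)" using TS by simp
      also have "\<dots> = kk y * \<Lambda> (fourier p) y"
        unfolding \<phi>m p_def S_op_poly[OF mm gwL] kk_def \<Lambda>_def cy pi_powr_quarter by (simp only: mult_ac)
      also have "T (bargmann p) (cvec y) = kk y * \<Gamma> (fourier (\<lambda>x. g x - q x)) y"
        unfolding Tp bargmann_fourier[OF gqL, symmetric] bargmann_rotated kk_def \<Gamma>_def cy by (simp only: mult_ac)
      finally have eq: "\<Lambda> (fourier p) y = \<Gamma> (fourier (\<lambda>x. g x - q x)) y" using kk0 by simp
      note Fp = fourier_L2[OF p(2)] and Fgq = fourier_L2[OF gqL] and Fr = fourier_L2[OF rL] and Fq = fourier_L2[OF qL]
      have dL: "\<Lambda> (fourier f) y - \<Lambda> (fourier p) y = S_factor TYPE('n) * (LINT \<xi>|lebesgue. (gauss_weighted m \<xi> * fourier_char \<xi> y) * (fourier f \<xi> - fourier p \<xi>))"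
      proof -
        have "(LINT \<xi>|lebesgue. (gauss_weighted m \<xi> * fourier_char \<xi> y) * (fourier f \<xi> - fourier p \<xi>))
           = (LINT \<xi>|lebesgue. (gauss_weighted m \<xi> * fourier_char \<xi> y) * fourier f \<xi>) - (LINT \<xi>|lebesgue. (gauss_weighted m \<xi> * fourier_char \<xi> y) * fourier p \<xi>)"
          unfolding right_diff_distrib
          by (rule Bochner_Integration.integral_diff[OF L2_mult_integrable[OF mexpL Ff(1)] L2_mult_integrable[OF mexpL Fp(1)]])
        then show ?thesis unfolding \<Lambda>_def by (simp add: mult_ac right_diff_distrib)
      qed
      have "cmod (\<Lambda> (fourier f) y - \<Lambda> (fourier p) y) \<le> cmod (S_factor TYPE('n)) * (l2_norm (\<lambda>\<xi>. gauss_weighted m \<xi> * fourier_char \<xi> y) * l2_norm (\<lambda>\<xi>. fourier f \<xi> - fourier p \<xi>))"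
        unfolding dL norm_mult[of "S_factor _"]
        by (intro mult_left_mono order_trans[OF integral_norm_bound L2_Cauchy_Schwarz[OF mexpL L2_diff[OF Ff(1) Fp(1)]]]) simp
      also have "l2_norm (\<lambda>\<xi>. fourier f \<xi> - fourier p \<xi>) = l2_norm r"
        by (rule l2_norm_eq_of_coef[OF L2_diff[OF Ff(1) Fp(1)] rL])
           (simp add: coef_diff Ff Fp r_def[abs_def] fL p cmod_fourier_phase norm_mult flip: right_diff_distrib)
      also have "cmod (S_factor TYPE('n)) * (l2_norm (\<lambda>\<xi>. gauss_weighted m \<xi> * fourier_char \<xi> y) * l2_norm r) \<le> P * e"
        unfolding P_def mult.assoc using l2_norm_le_sobolev[OF s r] re by (intro mult_left_mono) auto
      finally have 1: "cmod (\<Lambda> (fourier f) y - \<Lambda> (fourier p) y) \<le> P * e" .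
      have dG: "\<Gamma> (fourier (\<lambda>x. g x - q x)) y - \<Gamma> (fourier g) y = (LINT \<xi>|lebesgue. (gaussian \<xi> * fourier_char \<xi> y) * (fourier (\<lambda>x. g x - q x) \<xi> - fourier g \<xi>))"
      proof -
        have "(LINT \<xi>|lebesgue. (gaussian \<xi> * fourier_char \<xi> y) * (fourier (\<lambda>x. g x - q x) \<xi> - fourier g \<xi>))
          = (LINT \<xi>|lebesgue. (gaussian \<xi> * fourier_char \<xi> y) * fourier (\<lambda>x. g x - q x) \<xi>)
            - (LINT \<xi>|lebesgue. (gaussian \<xi> * fourier_char \<xi> y) * fourier g \<xi>)"
          unfolding right_diff_distrib
          by (rule Bochner_Integration.integral_diff[OF L2_mult_integrable[OF gaussL Fgq(1)] L2_mult_integrable[OF gaussL Fg(1)]])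
        then show ?thesis unfolding \<Gamma>_def gauss_weighted_def by (simp add: mult_ac)
      qed
      have "cmod (\<Gamma> (fourier (\<lambda>x. g x - q x)) y - \<Gamma> (fourier g) y) \<le> l2_norm (\<lambda>\<xi>::real^'n. gaussian \<xi> * fourier_char \<xi> y) * l2_norm (\<lambda>\<xi>. fourier (\<lambda>x. g x - q x) \<xi> - fourier g \<xi>)"
        unfolding dG by (intro order_trans[OF integral_norm_bound L2_Cauchy_Schwarz[OF gaussL L2_diff[OF Fgq(1) Fg(1)]]])
      also have "l2_norm (\<lambda>\<xi>. fourier (\<lambda>x. g x - q x) \<xi> - fourier g \<xi>) = l2_norm q"
        by (rule l2_norm_eq_of_coef[OF L2_diff[OF Fgq(1) Fg(1)] qL])
           (simp add: coef_diff Fgq Fg gL qL cmod_fourier_phase norm_mult flip: right_diff_distrib)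
      also have "l2_norm (\<lambda>\<xi>::real^'n. gaussian \<xi> * fourier_char \<xi> y) * l2_norm q \<le> Q * e"
        unfolding Q_def using order_trans[OF l2_norm_le_sobolev[OF s q(1)] qe]
        by (subst mult.commute[of "\<bar>C\<bar>"], subst mult.assoc) (intro mult_left_mono, auto)
      finally have 2: "cmod (\<Gamma> (fourier (\<lambda>x. g x - q x)) y - \<Gamma> (fourier g) y) \<le> Q * e" .
      have "d \<le> cmod (\<Lambda> (fourier f) y - \<Lambda> (fourier p) y) + cmod (\<Gamma> (fourier (\<lambda>x. g x - q x)) y - \<Gamma> (fourier g) y)"
        unfolding d_def using norm_triangle_ineq[of "\<Lambda> (fourier f) y - \<Lambda> (fourier p) y" "\<Gamma> (fourier (\<lambda>x. g x - q x)) y - \<Gamma> (fourier g) y"]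
        by (simp add: eq)
      also have "\<dots> \<le> (P + Q) * e" using 1 2 by (simp add: distrib_right)
      also have "\<dots> < (P + Q + 1) * e" using e by (simp add: distrib_right)
      also have "\<dots> = d" using PQ by (simp add: e_def)
      finally show False by simp
    qed
    define h where "h \<xi> = S_factor TYPE('n) * (gauss_weighted m \<xi> * fourier f \<xi>) - gauss_weighted (fourier g) \<xi>" for \<xi>
    have i1: "integrable lebesgue (\<lambda>\<xi>. gauss_weighted m \<xi> * fourier f \<xi>)" by (rule L2_mult_integrable[OF gwL Ff(1)])
    have i2: "integrable lebesgue (gauss_weighted (fourier g))"
      unfolding gauss_weighted_def[abs_def] using L2_mult_integrable[OF Fg(1) gauss_norm_L2[of 0]] by simp
    have e1: "integrable lebesgue (\<lambda>\<xi>. (gauss_weighted m \<xi> * fourier f \<xi>) * fourier_char \<xi> y)" for y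
      using L2_mult_integrable[OF mexpL Ff(1), of y] by (simp add: mult_ac)
    have e2: "integrable lebesgue (\<lambda>\<xi>. gauss_weighted (fourier g) \<xi> * fourier_char \<xi> y)" for y
      using L2_mult_integrable[OF gaussL Fg(1), of y] by (simp add: gauss_weighted_def mult_ac)
    have "AE \<xi> in lebesgue. h \<xi> = 0"
    proof (rule fourier_injective_L1)
      show "integrable lebesgue h" unfolding h_def using i1 i2 by (intro Bochner_Integration.integrable_diff integrable_mult_right)
      fix y :: "real ^ 'n"
      have "(LINT \<xi>|lebesgue. fourier_char \<xi> y * h \<xi>)
        = (LINT \<xi>|lebesgue. S_factor TYPE('n) * ((gauss_weighted m \<xi> * fourier f \<xi>) * fourier_char \<xi> y) - gauss_weighted (fourier g) \<xi> * fourier_char \<xi> y)"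
        by (intro Bochner_Integration.integral_cong) (auto simp: h_def algebra_simps)
      also have "\<dots> = \<Lambda> (fourier f) y - \<Gamma> (fourier g) y"
        unfolding \<Lambda>_def \<Gamma>_def
        by (subst Bochner_Integration.integral_diff[OF integrable_mult_right[OF e1] e2]) simp
      finally show "(LINT \<xi>|lebesgue. fourier_char \<xi> y * h \<xi>) = 0" by (simp add: id)
    qed
    then show ?thesis
    proof eventually_elim
      case (elim \<xi>)
      have "h \<xi> = (S_factor TYPE('n) * (m \<xi> * fourier f \<xi>) - fourier g \<xi>) * gaussian \<xi>"
        by (simp add: h_def gauss_weighted_def algebra_simps)
      with elim show ?case by simp
    qed
  qed
  have mult: "(\<lambda>\<xi>. m \<xi> * fourier f \<xi>) \<in> L2 \<and> multiplier_op m f \<in> hermite_sobolev s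
     \<and> hermite_sobolev_norm s (multiplier_op m f) \<le> (cmod (inverse (S_factor TYPE('n))) * C) * hermite_sobolev_norm s f"
    if f: "f \<in> hermite_sobolev s" for f
  proof -
    obtain g where g: "g \<in> hermite_sobolev s" "T (bargmann f) = bargmann g"
      using Tin[OF fock_sobolev_bargmann(1)[OF f]] by (auto simp: fock_sobolev_def)
    have gL: "g \<in> L2" using g by (auto intro: hermite_sobolev_L2)
    note Fg = fourier_L2[OF gL]
    let ?k = "inverse (S_factor TYPE('n))"
    have ae: "AE \<xi> in lebesgue. ?k * fourier g \<xi> = m \<xi> * fourier f \<xi>"
      using key[OF f g] by eventually_elim (metis mult.assoc S_factor_nonzero left_inverse mult_1)
    have kL: "(\<lambda>\<xi>. ?k * fourier g \<xi>) \<in> L2" by (rule L2_cmult[OF Fg(1)])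
    have mL: "(\<lambda>\<xi>. m \<xi> * fourier f \<xi>) \<in> L2" by (rule L2_cong_AE[OF kL ae])
    note I = inv_fourier_L2[OF mL]
    have c: "coef (multiplier_op m f) \<alpha> = coef (\<lambda>x. ?k * g x) \<alpha>" for \<alpha>
    proof -
      have "coef (multiplier_op m f) \<alpha> = fourier_phase 1 \<alpha> * (?k * (fourier_phase (-1) \<alpha> * coef g \<alpha>))"
        unfolding multiplier_op_def I(2) coef_cong_AE[OF kL ae, symmetric] coef_cmult Fg(2) ..
      also have "\<dots> = (fourier_phase 1 \<alpha> * fourier_phase (-1) \<alpha>) * (?k * coef g \<alpha>)" by (simp only: mult_ac)
      finally show ?thesis by (simp add: fourier_phase_inverse coef_cmult)
    qed
    note sc = hermite_sobolev_cmult[OF g(1), of ?k]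
    have mo: "multiplier_op m f \<in> L2" unfolding multiplier_op_def by (rule I(1))
    note cg = hermite_sobolev_cong[OF sc(1) mo c]
    have "hermite_sobolev_norm s (multiplier_op m f) = cmod ?k * hermite_sobolev_norm s g"
      unfolding cg(2) sc(2) ..
    also have "hermite_sobolev_norm s g = fock_sobolev_norm s (T (bargmann f))"
      unfolding g(2) by (rule fock_sobolev_bargmann(2)[OF g(1), symmetric])
    also have "cmod ?k * fock_sobolev_norm s (T (bargmann f)) \<le> cmod ?k * (C * fock_sobolev_norm s (bargmann f))"
      by (intro mult_left_mono C fock_sobolev_bargmann(1) f) simp
    finally show ?thesis using mL cg(1) by (simp add: fock_sobolev_bargmann(2)[OF f] mult.assoc)
  qed
  have "m \<in> hermite_multipliers s"
    unfolding hermite_multipliers_def using mm mult by blast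
  then show ?thesis using \<phi>m by (rule that)
qed

theorem theorem1p6:
  fixes s :: real and \<phi> :: "complex ^ 'n \<Rightarrow> complex"
  assumes "s \<ge> 0" and "\<phi> \<in> fock_space"
  shows "(S_bounded s \<phi> \<longleftrightarrow> \<phi> \<in> fock_multipliers s) \<and>
         (S_bounded s \<phi> \<longleftrightarrow> (\<exists>m\<in>hermite_multipliers s. \<phi> = gauss_bargmann m))"
proof -
  have "S_bounded s \<phi> \<longleftrightarrow> (\<exists>m\<in>hermite_multipliers s. \<phi> = gauss_bargmann m)"
    using S_bounded_of_multiplier multiplier_of_S_bounded[OF assms] by metis
  then show ?thesis by (auto simp: fock_multipliers_def)
qed

end
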